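(* Let $n\ge1$, $k\ge1$ and $\mu\in\mathrm{WComp}_{n-1}$ with $\mathrm{supp}(\mu)\subseteq[k]$. The set $\{\bar c(T,\sigma):(T,\sigma)\in\mathsf{Lyn}_\mu\}$ is a basis of $\widetilde H^{n-3}((\hat0,[n]^\mu))$, and the set $\{[T,\sigma]:(T,\sigma)\in\mathsf{Lyn}_\mu\}$ is a basis of $\mathcal{L}ie(\mu)$.
   Context: Fix a field $\mathbf{k}$. $\mathrm{WComp}_{m}$: weak compositions (nonnegative integer sequences) with sum $m$; $\mathbf{e}_r$ the $r$-th unit vector. $\mathcal{L}ie(\mu)$ is the subspace of the multilinear component of the free Lie algebra on $[n]$ with compatible Lie brackets $[\cdot,\cdot]_j$, $j\in\mathbb{P}$ (relations: antisymmetry and Jacobi for each bracket, and $[x,[y,z]_j]_i+[z,[x,y]_j]_i+[y,[z,x]_j]_i+[x,[y,z]_i]_j+[z,[x,y]_i]_j+[y,[z,x]_i]_j=0$ for $i\ne j$) spanned by bracketed permutations with exactly $\mu(j)$ brackets of type $j$. $\Pi_n^k$ is the poset of weighted partitions $\{B_1^{\mu_1},\dots,B_t^{\mu_t}\}$ ($\{B_i\}$ set partition of $[n]$, $\mu_i\in\mathrm{WComp}_{|B_i|-1}$ with support in $[k]$), covers merging two blocks $A^a,B^b$ into $(A\cup B)^{a+b+\mathbf{e}_r}$, $r\in[k]$; $\hat0$ the singleton partition with zero weights; $[n]^\mu=\{[n]^\mu\}$; cohomology is reduced simplicial cohomology over $\mathbf{k}$ of the order complex. A labeled colored binary tree $(T,\sigma)$: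 planar rooted binary tree $T$ with $n$ leaves, each internal node colored in $\mathbb{P}$, the $j$-th leaf from the left labeled $\sigma(j)$, $\sigma\in\mathfrak{S}_n$. Define $[T,\sigma]=\sigma$ if $n=1$, and otherwise $[T,\sigma]=[[T_1,\sigma_1],[T_2,\sigma_2]]_j$ where $(T_1,\sigma_1),(T_2,\sigma_2)$ are the left and right labeled subtrees of the root and $j$ is the root's color. Let $v_1,\dots,v_{n-1}$ be the internal nodes in postorder (left subtree, right subtree, root, recursively). For $(T,\sigma)$ with $\mu(j)$ internal nodes of color $j$, $c(T,\sigma)$ is the maximal chain $\hat0=\alpha_0\lessdot\alpha_1\lessdot\dots\lessdot\alpha_{n-1}=[n]^\mu$ of $\Pi_n^k$ where $\alpha_t$ is obtained from $\alpha_{t-1}$ by merging the block containing the leaf labels of the left subtree of $v_t$ with the block containing the leaf labels of the right subtree of $v_t$ (these are blocks of $\alpha_{t-1}$), adding $\mathbf{e}_{\mathrm{color}(v_t)}$ to the sum of their weights. $\bar c(T,\sigma)=c(T,\sigma)\setminus\{\hat0,[n]^\mu\}$ is a maximal chain of the open interval, i.e. a top-dimensional face of its order complex, and also denotes its cohomology class. Valency $v(x)$: smallest leaf label in the subtree rooted at $x$; normalized means $v(x)=v(L(x))$ for all internal $x$; $x$ is a Lyndon node if $L(x)$ is a leaf or $v(R(L(x)))>v(R(x))$; a colored Lyndon tree is a normalized tree where every non-Lyndon internal node $x$ has $\mathrm{color}(L(x))>\mathrm{color}(x)$. $\mathsf{Lyn}_\mu$: colored Lyndon trees on $[n]$ with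 exactly $\mu(j)$ internal nodes of color $j$. *)

theory Defs
  imports
    "Jordan_Normal_Form.VS_Connect"
    "HOL-Library.Function_Algebras"
    "HOL-Library.Set_Algebras"
    "HOL-Library.Disjoint_Sets"
begin

section \<open>Quotients of spaces of functions\<close>

text \<open>
  The quotient \<open>U / W\<close>, as a set of cosets, for linear subspaces \<open>W \<subseteq> U\<close> of the space of all
  functions \<open>'x \<Rightarrow> 'k\<close>. Since cosets are nonempty and \<open>W + W = W\<close>, addition of cosets is addition
  of sets; adding \<open>W\<close> in the scalar multiplication only matters for the scalar \<open>0\<close>.
  The fields \<open>mult\<close> and \<open>one\<close> are required by the record type and are irrelevant.
\<close>

definition quotient_space ::
  "('x \<Rightarrow> 'k) set \<Rightarrow> ('x \<Rightarrow> 'k) set \<Rightarrow> ('k::field, ('x \<Rightarrow> 'k) set) module" where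
  "quotient_space U W =
    \<lparr> carrier = (\<lambda>f. f +o W) ` U, mult = (\<lambda>A B. W), one = W, zero = W, add = (+),
      smult = (\<lambda>c A. (\<lambda>f x. c * f x) ` A + W) \<rparr>"

definition linear_subspace :: "('x \<Rightarrow> 'k::field) set \<Rightarrow> bool" where
  "linear_subspace U \<longleftrightarrow>
    0 \<in> U \<and> (\<forall>f\<in>U. \<forall>g\<in>U. f + g \<in> U) \<and> (\<forall>c. \<forall>f\<in>U. (\<lambda>x. c * f x) \<in> U)"

lemma quotient_space_vectorspace:
  fixes U W :: "('x \<Rightarrow> 'k::field) set"
  assumes U: "linear_subspace U" and W: "linear_subspace W" and "W \<subseteq> U"
  shows "vectorspace class_ring (quotient_space U W)"
proof -
  let ?Q = "quotient_space U W"
  let ?s = "\<lambda>c A. (\<lambda>f x. c * f x) ` A + W"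
  have Uadd: "f + g \<in> U" and Usc: "(\<lambda>x. c * f x) \<in> U" if "f \<in> U" "g \<in> U" for f g c
    using U that by (auto simp: linear_subspace_def)
  have U0: "0 \<in> U" and W00: "0 \<in> W" using U W by (auto simp: linear_subspace_def)
  have WW: "W + W = W"
  proof
    show "W + W \<subseteq> W" using W by (auto simp: set_plus_def linear_subspace_def)
    show "W \<subseteq> W + W" using W00 by (metis set_zero_plus2 add.commute)
  qed
  have add: "(f +o W) + (g +o W) = (f + g) +o W" for f g
    by (simp add: set_plus_rearrange WW)
  have zero: "W = 0 +o W" by (simp add: elt_set_plus_def)
  have sm: "?s c (f +o W) = (\<lambda>x. c * f x) +o W" for c f
  proof
    show "?s c (f +o W) \<subseteq> (\<lambda>x. c * f x) +o W"
    proof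
      fix h assume "h \<in> ?s c (f +o W)"
      then obtain w v where h: "w \<in> W" "v \<in> W" "h = (\<lambda>x. c * (f + w) x) + v"
        by (auto simp: set_plus_def elt_set_plus_def)
      have "h = (\<lambda>x. c * f x) + ((\<lambda>x. c * w x) + v)"
        using h(3) by (auto simp: fun_eq_iff algebra_simps)
      moreover have "(\<lambda>x. c * w x) + v \<in> W" using h(1,2) W by (simp add: linear_subspace_def)
      ultimately show "h \<in> (\<lambda>x. c * f x) +o W" by (auto simp: elt_set_plus_def)
    qed
    show "(\<lambda>x. c * f x) +o W \<subseteq> ?s c (f +o W)"
    proof
      fix h assume "h \<in> (\<lambda>x. c * f x) +o W"
      then obtain v where v: "v \<in> W" "h = (\<lambda>x. c * f x) + v" by (auto simp: elt_set_plus_def)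
      have "f \<in> f +o W" using W00 by (force simp: elt_set_plus_def)
      then show "h \<in> ?s c (f +o W)" using v by (auto simp: set_plus_def)
    qed
  qed
  have Uneg: "- f \<in> U" if "f \<in> U" for f
    using Usc[OF that that, of "-1"] by (simp add: fun_Compl_def)
  have neg: "(- f +o W) + (f +o W) = W" for f
    by (metis add ab_left_minus zero)
  have carr: "carrier ?Q = (\<lambda>f. f +o W) ` U" and qadd: "add ?Q = (+)" and qzero: "zero ?Q = W"
    and qsm: "smult ?Q = ?s"
    by (simp_all add: quotient_space_def)
  have ag: "abelian_group ?Q"
  proof (rule abelian_groupI, unfold carr qadd qzero)
    show "W \<in> (\<lambda>f. f +o W) ` U" using zero U0 by blast
    fix A assume "A \<in> (\<lambda>f. f +o W) ` U"
    then obtain f where f: "f \<in> U" "A = f +o W" by blast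
    show "W + A = A" using add[of 0 f] zero f by simp
    show "\<exists>B\<in>(\<lambda>f. f +o W) ` U. B + A = W"
      using neg[of f] Uneg[OF f(1)] f(2) by blast
    fix B assume "B \<in> (\<lambda>f. f +o W) ` U"
    then obtain g where g: "g \<in> U" "B = g +o W" by blast
    show "A + B \<in> (\<lambda>f. f +o W) ` U" using f g add Uadd by blast
  qed (simp_all add: ac_simps)
  have fdist: "(\<lambda>x. (a + b) * f x) = (\<lambda>x. a * f x) + (\<lambda>x. b * f x)"
    "(\<lambda>x. a * (f + g) x) = (\<lambda>x. a * f x) + (\<lambda>x. a * g x)"
    for a b :: 'k and f g :: "'x \<Rightarrow> 'k"
    by (auto simp: fun_eq_iff algebra_simps)
  have mod: "module class_ring ?Q"
  proof (rule Module.moduleI[OF class_cring.cring_axioms ag], unfold carr qadd qsm)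
    fix a b :: 'k and A assume "A \<in> (\<lambda>f. f +o W) ` U"
    then obtain f where f: "f \<in> U" "A = f +o W" by blast
    show "?s a A \<in> (\<lambda>f. f +o W) ` U" using sm[of a f] f Usc by blast
    show "?s (a \<oplus>\<^bsub>class_ring\<^esub> b) A = ?s a A + ?s b A"
      unfolding f(2) sm add by (simp add: fdist)
    show "?s (a \<otimes>\<^bsub>class_ring\<^esub> b) A = ?s a (?s b A)"
      unfolding f(2) sm by (simp add: mult.assoc)
    show "?s \<one>\<^bsub>class_ring\<^esub> A = A"
      unfolding f(2) sm by simp
    fix B assume "B \<in> (\<lambda>f. f +o W) ` U"
    then obtain g where g: "g \<in> U" "B = g +o W" by blast
    show "?s a (A + B) = ?s a A + ?s a B"
      unfolding f(2) g(2) add sm fdist(2) ..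
  qed
  then show ?thesis
    by (rule vectorspace.intro) (rule class_field.field_axioms)
qed

definition point_mass :: "'x \<Rightarrow> 'x \<Rightarrow> 'k::field" where
  "point_mass a = (\<lambda>b. if b = a then 1 else 0)"


section \<open>Reduced simplicial cohomology of order complexes\<close>

definition open_interval :: "('p \<Rightarrow> 'p \<Rightarrow> bool) \<Rightarrow> 'p \<Rightarrow> 'p \<Rightarrow> 'p set" where
  "open_interval R x y = {z. R x z \<and> z \<noteq> x \<and> R z y \<and> z \<noteq> y}"

text \<open>The empty chain is a face (of dimension \<open>-1\<close>).\<close>

definition order_complex :: "('p \<Rightarrow> 'p \<Rightarrow> bool) \<Rightarrow> 'p set \<Rightarrow> 'p set set" where
  "order_complex R P = {F. finite F \<and> F \<subseteq> P \<and> Complete_Partial_Order.chain R F}"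

definition cochains :: "'p set set \<Rightarrow> int \<Rightarrow> ('p set \<Rightarrow> 'k::field) set" where
  "cochains \<Delta> d = {f. \<forall>F. f F \<noteq> 0 \<longrightarrow> F \<in> \<Delta> \<and> int (card F) = d + 1}"

text \<open>
  The vertices of every face are ordered by \<open>R\<close>; deleting the vertex in position \<open>i\<close>
  (counted from \<open>0\<close>) contributes the sign \<open>(-1)^i\<close>.
\<close>

definition coboundary ::
  "('p \<Rightarrow> 'p \<Rightarrow> bool) \<Rightarrow> 'p set set \<Rightarrow> ('p set \<Rightarrow> 'k::field) \<Rightarrow> 'p set \<Rightarrow> 'k" where
  "coboundary R \<Delta> f F =
    (if F \<in> \<Delta> then \<Sum>x\<in>F. (- 1) ^ card {y\<in>F. R y x \<and> y \<noteq> x} * f (F - {x}) else 0)"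

definition cocycles ::
  "('p \<Rightarrow> 'p \<Rightarrow> bool) \<Rightarrow> 'p set set \<Rightarrow> int \<Rightarrow> ('p set \<Rightarrow> 'k::field) set" where
  "cocycles R \<Delta> d = {f \<in> cochains \<Delta> d. coboundary R \<Delta> f = 0}"

definition coboundaries ::
  "('p \<Rightarrow> 'p \<Rightarrow> bool) \<Rightarrow> 'p set set \<Rightarrow> int \<Rightarrow> ('p set \<Rightarrow> 'k::field) set" where
  "coboundaries R \<Delta> d = coboundary R \<Delta> ` cochains \<Delta> (d - 1)"

definition reduced_cohomology ::
  "('p \<Rightarrow> 'p \<Rightarrow> bool) \<Rightarrow> 'p set set \<Rightarrow> int \<Rightarrow> ('k::field, ('p set \<Rightarrow> 'k) set) module" where
  "reduced_cohomology R \<Delta> d = quotient_space (cocycles R \<Delta> d) (coboundaries R \<Delta> d)"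

text \<open>The cohomology class of (the cochain dual to) a top-dimensional face.\<close>

definition face_class ::
  "('p \<Rightarrow> 'p \<Rightarrow> bool) \<Rightarrow> 'p set set \<Rightarrow> 'p set \<Rightarrow> ('p set \<Rightarrow> 'k::field) set" where
  "face_class R \<Delta> F = point_mass F +o coboundaries R \<Delta> (int (card F) - 1)"

abbreviation interval_complex :: "('p \<Rightarrow> 'p \<Rightarrow> bool) \<Rightarrow> 'p \<Rightarrow> 'p \<Rightarrow> 'p set set" where
  "interval_complex R x y \<equiv> order_complex R (open_interval R x y)"

text \<open>
  The cohomology of the open interval \<open>(x, y)\<close>. We follow the usual convention of poset topology
  that the degenerate interval \<open>(x, x)\<close> has dimension \<open>-2\<close>: its only reduced cohomology is
  one-dimensional, sits in degree \<open>-2\<close>, and is spanned by the class of the empty chain.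
\<close>

definition interval_cohomology ::
  "('p \<Rightarrow> 'p \<Rightarrow> bool) \<Rightarrow> 'p \<Rightarrow> 'p \<Rightarrow> int \<Rightarrow> ('k::field, ('p set \<Rightarrow> 'k) set) module" where
  "interval_cohomology R x y d =
    reduced_cohomology R (interval_complex R x y) (if x = y then d + 1 else d)"


section \<open>Weighted partitions\<close>

text \<open>
  Weak compositions are indexed by the positive integers; they are represented by functions
  on \<open>nat\<close> that vanish at \<open>0\<close>.
\<close>

definition supp :: "(nat \<Rightarrow> nat) \<Rightarrow> nat set" where
  "supp \<mu> = {j. \<mu> j \<noteq> 0}"

definition WComp :: "nat \<Rightarrow> (nat \<Rightarrow> nat) set" where
  "WComp m = {\<mu>. finite (supp \<mu>) \<and> \<mu> 0 = 0 \<and> (\<Sum>j\<in>supp \<mu>. \<mu> j) = m}"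

definition unit_comp :: "nat \<Rightarrow> nat \<Rightarrow> nat" where
  "unit_comp r = (\<lambda>j. if j = r then 1 else 0)"

text \<open>A weighted block \<open>B\<^sup>\<mu>\<close> is the pair \<open>(B, \<mu>)\<close>.\<close>

type_synonym wblock = "nat set \<times> (nat \<Rightarrow> nat)"
type_synonym wpartition = "wblock set"

definition wpartitions :: "nat \<Rightarrow> nat \<Rightarrow> wpartition set" where
  "wpartitions n k =
    {\<alpha>. partition_on {1..n} (fst ` \<alpha>) \<and> inj_on fst \<alpha> \<and>
        (\<forall>(B, \<mu>)\<in>\<alpha>. \<mu> \<in> WComp (card B - 1) \<and> supp \<mu> \<subseteq> {1..k})}"

fun merge :: "wpartition \<Rightarrow> wblock \<Rightarrow> wblock \<Rightarrow> nat \<Rightarrow> wpartition" where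
  "merge \<alpha> (A, a) (B, b) r = insert (A \<union> B, a + b + unit_comp r) (\<alpha> - {(A, a), (B, b)})"

definition wcover :: "nat \<Rightarrow> nat \<Rightarrow> wpartition \<Rightarrow> wpartition \<Rightarrow> bool" where
  "wcover n k \<alpha> \<beta> \<longleftrightarrow> \<alpha> \<in> wpartitions n k \<and> \<beta> \<in> wpartitions n k \<and>
    (\<exists>P\<in>\<alpha>. \<exists>Q\<in>\<alpha>. P \<noteq> Q \<and> (\<exists>r\<in>{1..k}. \<beta> = merge \<alpha> P Q r))"

definition wle :: "nat \<Rightarrow> nat \<Rightarrow> wpartition \<Rightarrow> wpartition \<Rightarrow> bool" where
  "wle n k \<alpha> \<beta> \<longleftrightarrow> \<alpha> \<in> wpartitions n k \<and> (wcover n k)\<^sup>*\<^sup>* \<alpha> \<beta>"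

definition wbot :: "nat \<Rightarrow> wpartition" where
  "wbot n = (\<lambda>i. ({i}, \<lambda>_. 0)) ` {1..n}"

definition wtop :: "nat \<Rightarrow> (nat \<Rightarrow> nat) \<Rightarrow> wpartition" where
  "wtop n \<mu> = {({1..n}, \<mu>)}"


section \<open>Labeled colored binary trees\<close>

text \<open>
  The pair \<open>(T, \<sigma>)\<close> is represented by the tree \<open>T\<close> with the labels \<open>\<sigma>(1), \<sigma>(2), \<dots>\<close> written into
  its leaves from left to right. Without the restriction on labels, these trees are also the
  bracket monomials in the free algebra below.
\<close>

datatype lctree =
    is_Leaf: Leaf (leaf_label: nat)
  | Node (color: nat) (left: lctree) (right: lctree)

primrec labels :: "lctree \<Rightarrow> nat list" where
  "labels (Leaf a) = [a]"
| "labels (Node j l r) = labels l @ labels r"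

text \<open>The subtrees rooted at the internal nodes, in postorder.\<close>

primrec internal_nodes :: "lctree \<Rightarrow> lctree list" where
  "internal_nodes (Leaf a) = []"
| "internal_nodes (Node j l r) = internal_nodes l @ internal_nodes r @ [Node j l r]"

definition bracket_monomials :: "nat \<Rightarrow> lctree set" where
  "bracket_monomials n =
    {T. set (labels T) \<subseteq> {1..n} \<and> (\<forall>x\<in>set (internal_nodes T). color x \<ge> 1)}"

definition labeled_trees :: "nat \<Rightarrow> (nat \<Rightarrow> nat) \<Rightarrow> lctree set" where
  "labeled_trees n \<mu> =
    {T. distinct (labels T) \<and> set (labels T) = {1..n} \<and>
        (\<forall>x\<in>set (internal_nodes T). color x \<ge> 1) \<and>
        (\<forall>j. length (filter (\<lambda>x. color x = j) (internal_nodes T)) = \<mu> j)}"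

definition valency :: "lctree \<Rightarrow> nat" where
  "valency T = Min (set (labels T))"

definition normalized :: "lctree \<Rightarrow> bool" where
  "normalized T \<longleftrightarrow> (\<forall>x\<in>set (internal_nodes T). valency x = valency (left x))"

definition lyndon_node :: "lctree \<Rightarrow> bool" where
  "lyndon_node x \<longleftrightarrow> is_Leaf (left x) \<or> valency (right (left x)) > valency (right x)"

definition Lyn :: "nat \<Rightarrow> (nat \<Rightarrow> nat) \<Rightarrow> lctree set" where
  "Lyn n \<mu> =
    {T \<in> labeled_trees n \<mu>. normalized T \<and>
        (\<forall>x\<in>set (internal_nodes T). \<not> lyndon_node x \<longrightarrow> color (left x) > color x)}"


section \<open>The maximal chain of a labeled tree\<close>

definition weight_of :: "wpartition \<Rightarrow> nat set \<Rightarrow> nat \<Rightarrow> nat" where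
  "weight_of \<alpha> B = (THE \<mu>. (B, \<mu>) \<in> \<alpha>)"

definition merge_at :: "wpartition \<Rightarrow> lctree \<Rightarrow> wpartition" where
  "merge_at \<alpha> x =
    (let A = set (labels (left x)); B = set (labels (right x))
     in merge \<alpha> (A, weight_of \<alpha> A) (B, weight_of \<alpha> B) (color x))"

definition tree_chain :: "nat \<Rightarrow> lctree \<Rightarrow> wpartition set" where
  "tree_chain n T =
    (\<lambda>t. foldl merge_at (wbot n) (take t (internal_nodes T))) ` {0..length (internal_nodes T)}"

definition tree_chain_bar :: "nat \<Rightarrow> (nat \<Rightarrow> nat) \<Rightarrow> lctree \<Rightarrow> wpartition set" where
  "tree_chain_bar n \<mu> T = tree_chain n T - {wbot n, wtop n \<mu>}"

definition tree_chain_class ::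
  "nat \<Rightarrow> nat \<Rightarrow> (nat \<Rightarrow> nat) \<Rightarrow> lctree \<Rightarrow> (wpartition set \<Rightarrow> 'k::field) set" where
  "tree_chain_class n k \<mu> T =
    face_class (wle n k) (interval_complex (wle n k) (wbot n) (wtop n \<mu>)) (tree_chain_bar n \<mu> T)"


section \<open>The free Lie algebra with compatible brackets\<close>

text \<open>
  The free nonassociative algebra on \<open>{1..n}\<close> with one bilinear product for every color \<open>j \<ge> 1\<close>:
  finitely supported functions on bracket monomials.
\<close>

definition free_algebra :: "nat \<Rightarrow> (lctree \<Rightarrow> 'k::field) set" where
  "free_algebra n = {f. finite {T. f T \<noteq> 0} \<and> {T. f T \<noteq> 0} \<subseteq> bracket_monomials n}"

primrec bracket ::
  "nat \<Rightarrow> (lctree \<Rightarrow> 'k::field) \<Rightarrow> (lctree \<Rightarrow> 'k) \<Rightarrow> lctree \<Rightarrow> 'k" where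
  "bracket j f g (Leaf a) = 0"
| "bracket j f g (Node i l r) = (if i = j then f l * g r else 0)"

text \<open>The ideal generated by antisymmetry, the Jacobi identities and the compatibility relations.\<close>

inductive_set lie_ideal :: "nat \<Rightarrow> (lctree \<Rightarrow> 'k::field) set" for n :: nat where
  antisymmetry:
    "x \<in> free_algebra n \<Longrightarrow> y \<in> free_algebra n \<Longrightarrow> j \<ge> 1 \<Longrightarrow>
     bracket j x y + bracket j y x \<in> lie_ideal n"
| jacobi:
    "x \<in> free_algebra n \<Longrightarrow> y \<in> free_algebra n \<Longrightarrow> z \<in> free_algebra n \<Longrightarrow> j \<ge> 1 \<Longrightarrow>
     bracket j x (bracket j y z) + bracket j z (bracket j x y) + bracket j y (bracket j z x)
     \<in> lie_ideal n"
| compatibility: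
    "x \<in> free_algebra n \<Longrightarrow> y \<in> free_algebra n \<Longrightarrow> z \<in> free_algebra n \<Longrightarrow>
     i \<ge> 1 \<Longrightarrow> j \<ge> 1 \<Longrightarrow> i \<noteq> j \<Longrightarrow>
     bracket i x (bracket j y z) + bracket i z (bracket j x y) + bracket i y (bracket j z x) +
     bracket j x (bracket i y z) + bracket j z (bracket i x y) + bracket j y (bracket i z x)
     \<in> lie_ideal n"
| zero: "0 \<in> lie_ideal n"
| add: "f \<in> lie_ideal n \<Longrightarrow> g \<in> lie_ideal n \<Longrightarrow> f + g \<in> lie_ideal n"
| scale: "f \<in> lie_ideal n \<Longrightarrow> (\<lambda>T. c * f T) \<in> lie_ideal n"
| bracket_left:
    "f \<in> lie_ideal n \<Longrightarrow> x \<in> free_algebra n \<Longrightarrow> j \<ge> 1 \<Longrightarrow> bracket j x f \<in> lie_ideal n"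
| bracket_right:
    "f \<in> lie_ideal n \<Longrightarrow> x \<in> free_algebra n \<Longrightarrow> j \<ge> 1 \<Longrightarrow> bracket j f x \<in> lie_ideal n"

definition free_lie :: "nat \<Rightarrow> ('k::field, (lctree \<Rightarrow> 'k) set) module" where
  "free_lie n = quotient_space (free_algebra n) (lie_ideal n)"

lemma linear_subspace_free_algebra: "linear_subspace (free_algebra n :: (lctree \<Rightarrow> 'k::field) set)"
  unfolding linear_subspace_def
proof (intro conjI ballI allI)
  show "0 \<in> (free_algebra n :: (lctree \<Rightarrow> 'k) set)" by (simp add: free_algebra_def)
next
  fix f g :: "lctree \<Rightarrow> 'k" assume fg: "f \<in> free_algebra n" "g \<in> free_algebra n"
  have sub: "{T. (f + g) T \<noteq> 0} \<subseteq> {T. f T \<noteq> 0} \<union> {T. g T \<noteq> 0}" by auto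
  show "f + g \<in> free_algebra n"
    using fg finite_subset[OF sub] sub unfolding free_algebra_def by blast
next
  fix c and f :: "lctree \<Rightarrow> 'k" assume f: "f \<in> free_algebra n"
  have sub: "{T. c * f T \<noteq> 0} \<subseteq> {T. f T \<noteq> 0}" by auto
  show "(\<lambda>T. c * f T) \<in> free_algebra n"
    using f finite_subset[OF sub] sub unfolding free_algebra_def by blast
qed

lemma bracket_in_free_algebra:
  fixes f g :: "lctree \<Rightarrow> 'k::field"
  assumes f: "f \<in> free_algebra n" and g: "g \<in> free_algebra n" and "j \<ge> 1"
  shows "bracket j f g \<in> free_algebra n"
proof -
  have sub: "{T. bracket j f g T \<noteq> 0} \<subseteq>
      (\<lambda>(l, r). Node j l r) ` ({T. f T \<noteq> 0} \<times> {T. g T \<noteq> 0})"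
  proof
    fix T assume "T \<in> {T. bracket j f g T \<noteq> 0}"
    then show "T \<in> (\<lambda>(l, r). Node j l r) ` ({T. f T \<noteq> 0} \<times> {T. g T \<noteq> 0})"
      by (cases T) (auto split: if_splits)
  qed
  have fin: "finite {T. bracket j f g T \<noteq> 0}"
    by (rule finite_subset[OF sub]) (use f g in \<open>simp add: free_algebra_def\<close>)
  have "Node j l r \<in> bracket_monomials n"
    if "l \<in> bracket_monomials n" "r \<in> bracket_monomials n" for l r
    using that \<open>j \<ge> 1\<close> by (auto simp: bracket_monomials_def)
  then have "{T. bracket j f g T \<noteq> 0} \<subseteq> bracket_monomials n"
    using sub f g unfolding free_algebra_def by fast
  with fin show ?thesis by (simp add: free_algebra_def)
qed

lemma lie_ideal_subset_free_algebra:
  "lie_ideal n \<subseteq> (free_algebra n :: (lctree \<Rightarrow> 'k::field) set)"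
proof
  fix f :: "lctree \<Rightarrow> 'k"
  have free: "0 \<in> (free_algebra n :: (lctree \<Rightarrow> 'k) set)"
    "g \<in> free_algebra n \<Longrightarrow> h \<in> free_algebra n \<Longrightarrow> g + h \<in> free_algebra n"
    "g \<in> free_algebra n \<Longrightarrow> (\<lambda>T. c * g T) \<in> free_algebra n"
    for g h :: "lctree \<Rightarrow> 'k" and c
    using linear_subspace_free_algebra[of n, where 'k = 'k] unfolding linear_subspace_def by blast+
  assume "f \<in> lie_ideal n"
  then show "f \<in> free_algebra n"
    by induction (intro free bracket_in_free_algebra; assumption)+
qed

lemma linear_subspace_lie_ideal: "linear_subspace (lie_ideal n)"
  by (auto simp: linear_subspace_def intro: lie_ideal.intros)

lemma free_lie_vectorspace:
  "vectorspace class_ring (free_lie n :: ('k::field, (lctree \<Rightarrow> 'k) set) module)"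
  unfolding free_lie_def
  by (intro quotient_space_vectorspace linear_subspace_free_algebra linear_subspace_lie_ideal
      lie_ideal_subset_free_algebra)

primrec bracketing :: "lctree \<Rightarrow> lctree \<Rightarrow> 'k::field" where
  "bracketing (Leaf a) = point_mass (Leaf a)"
| "bracketing (Node j l r) = bracket j (bracketing l) (bracketing r)"

definition bracketing_class :: "nat \<Rightarrow> lctree \<Rightarrow> (lctree \<Rightarrow> 'k::field) set" where
  "bracketing_class n T = bracketing T +o lie_ideal n"

definition Lie :: "nat \<Rightarrow> (nat \<Rightarrow> nat) \<Rightarrow> ('k::field, (lctree \<Rightarrow> 'k) set) module" where
  "Lie n \<mu> = (free_lie n)
    \<lparr> carrier := LinearCombinations.module.span class_ring (free_lie n)
                  (bracketing_class n ` labeled_trees n \<mu>) \<rparr>"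

end

theory Submission
  imports Defs
begin

text \<open>
  Call a node of a normalized tree a redex if it is not Lyndon and the color of its left child is
  not larger, so that the colored Lyndon trees are the normalized trees without redexes. The Jacobi
  or compatibility relation at a redex expresses the tree through smaller ones, hence Lyndon trees
  span every quotient in which these relations hold. The resulting rewriting system is confluent:
  its only critical pair is \<open>[[[P, Q], S], U]\<close> with weakly increasing colors, and it is resolved by
  writing the sum of all chains of an interval with four blocks in two ways. So for every Lyndon
  tree there is a functional on trees that respects all relations and is dual to it.

  On the Lie side such a functional, extended by antisymmetry, kills the ideal. On the side of
  cohomology a maximal chain is the same as a normalized tree with a linear extension of its
  internal nodes. An interval of length two contains two, three or six chains, and these give a
  sign change, a Jacobi identity or a compatibility relation. Therefore the functionals, multiplied
  by a sign, are top-dimensional cycles, and straightening of trees straightens chains up to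
  coboundaries.
\<close>

section \<open>Straightening of bracket monomials\<close>

text \<open>Independence is the difficult half: neither dimension is known in advance, so it cannot
  follow from spanning by a count. The functionals replace the count, and no isomorphism between the
  two spaces is needed, since one rewriting system serves both. A functional is defined by recursion
  along the rewriting order; confluence says that the recursion does not depend on the redex that is
  chosen. Its values are integers, so one construction serves every field. In characteristic 2 a
  doubled Jacobi identity would be empty, which is why for equal colors the relation is taken once
  instead of summed over both orders of the colors. On the poset side blocks are named by their
  minima, because a merge makes exactly one minimum disappear. A maximal chain then becomes a word
  whose letters can be read off from consecutive partitions. The remaining obstacle is that the
  postorder chain of a tree need not perform the two merges of a redex consecutively. Hence all
  chains that build the same tree have to be compared before a relation between trees can be read as
  a relation between chains.\<close>

abbreviation lnest :: "nat \<Rightarrow> nat \<Rightarrow> lctree \<Rightarrow> lctree \<Rightarrow> lctree \<Rightarrow> lctree" where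
  "lnest b c P Q S \<equiv> Node c (Node b P Q) S"

abbreviation rnest :: "nat \<Rightarrow> nat \<Rightarrow> lctree \<Rightarrow> lctree \<Rightarrow> lctree \<Rightarrow> lctree" where
  "rnest b c P Q S \<equiv> Node c P (Node b Q S)"

lemma labels_nonempty [simp]: "labels T \<noteq> []"
  by (induction T) auto

lemma valency_Leaf [simp]: "valency (Leaf a) = a"
  by (simp add: valency_def)

lemma valency_Node [simp]: "valency (Node j l r) = min (valency l) (valency r)"
  by (simp add: valency_def Min_Un)

text \<open>
  Three weights that make straightening terminate, compared lexicographically. The right weight is
  the same for \<open>[[P, Q], S]\<close> and \<open>[[P, S], Q]\<close> and smaller for \<open>[P, [Q, S]]\<close>; the valency weight
  drops on passing from \<open>[[P, Q], S]\<close> to \<open>[[P, S], Q]\<close> when \<open>Q\<close> has the smaller valency; the color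
  weight drops when the larger color moves inwards.
\<close>

primrec right_weight :: "lctree \<Rightarrow> nat" where
  "right_weight (Leaf a) = 1"
| "right_weight (Node j l r) = right_weight l * (1 + right_weight r)"

primrec spine_length :: "lctree \<Rightarrow> nat" where
  "spine_length (Leaf a) = 0"
| "spine_length (Node j l r) = Suc (spine_length l)"

primrec valency_weight :: "lctree \<Rightarrow> nat" where
  "valency_weight (Leaf a) = 0"
| "valency_weight (Node j l r) = valency_weight l + valency_weight r + valency r * spine_length l"

primrec color_weight :: "lctree \<Rightarrow> nat" where
  "color_weight (Leaf a) = 0"
| "color_weight (Node j l r) = color_weight l + color_weight r + j * spine_length l"

text \<open>For equal right weights the relation also fixes spine length and valency, because the
  two finer weights of a parent involve \<open>spine_length\<close> of its left child and
  \<open>valency\<close> of its right child. Without this, \<open>straighter_left\<close> and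
  \<open>straighter_right\<close> would fail.\<close>

definition straighter :: "lctree \<Rightarrow> lctree \<Rightarrow> bool" where
  "straighter t T \<longleftrightarrow> right_weight t < right_weight T \<or>
     right_weight t = right_weight T \<and> spine_length t = spine_length T \<and> valency t = valency T \<and>
     (valency_weight t < valency_weight T \<or>
      valency_weight t = valency_weight T \<and> color_weight t < color_weight T)"

lemma wf_straighter: "wf {(t, T). straighter t T}"
proof (rule wf_subset)
  show "wf (measures [right_weight, valency_weight, color_weight])" by simp
  show "{(t, T). straighter t T} \<subseteq> measures [right_weight, valency_weight, color_weight]"
    by (auto simp: straighter_def)
qed

lemma right_weight_pos [simp]: "right_weight T > 0"
  by (induction T) auto

lemma straighter_left: "straighter t T \<Longrightarrow> straighter (Node j t r) (Node j T r)"
  using mult_less_mono1[of "right_weight t" "right_weight T" "1 + right_weight r"]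
  by (auto simp: straighter_def)

lemma straighter_right: "straighter t T \<Longrightarrow> straighter (Node j l t) (Node j l T)"
  by (auto simp: straighter_def)

text \<open>The relation [[P, Q], S] - [[P, S], Q] - [P, [Q, S]] = 0, summed over both distributions
  of two different colors and solved for \<open>lnest b c P Q S\<close>. The same comb with
  exchanged colors is the one term that keeps a negative sign.\<close>

definition root_pos :: "nat \<Rightarrow> nat \<Rightarrow> lctree \<Rightarrow> lctree \<Rightarrow> lctree \<Rightarrow> lctree list" where
  "root_pos b c P Q S =
    (if b = c then [lnest b b P S Q, rnest b b P Q S]
     else [lnest b c P S Q, lnest c b P S Q, rnest b c P Q S, rnest c b P Q S])"

definition root_neg :: "nat \<Rightarrow> nat \<Rightarrow> lctree \<Rightarrow> lctree \<Rightarrow> lctree \<Rightarrow> lctree list" where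
  "root_neg b c P Q S = (if b = c then [] else [lnest c b P Q S])"

text \<open>
  \<open>straighten T ps ns\<close>: one of the Jacobi or compatibility relations, applied at a non-Lyndon node
  of \<open>T\<close> whose left child does not have a larger color, reads \<open>T = \<Sum>ps - \<Sum>ns\<close>.
\<close>

inductive straighten :: "lctree \<Rightarrow> lctree list \<Rightarrow> lctree list \<Rightarrow> bool" where
  root: "valency P < valency Q \<Longrightarrow> valency Q < valency S \<Longrightarrow> b \<le> c \<Longrightarrow>
    straighten (lnest b c P Q S) (root_pos b c P Q S) (root_neg b c P Q S)"
| left: "straighten l ps ns \<Longrightarrow>
    straighten (Node j l r) (map (\<lambda>t. Node j t r) ps) (map (\<lambda>t. Node j t r) ns)"
| right: "straighten r ps ns \<Longrightarrow>
    straighten (Node j l r) (map (Node j l) ps) (map (Node j l) ns)"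

lemma root_straighter:
  assumes "valency P < valency Q" "valency Q < valency S" "b \<le> c"
    and "t \<in> set (root_pos b c P Q S) \<union> set (root_neg b c P Q S)"
  shows "straighter t (lnest b c P Q S)"
  using assms
  by (auto simp: root_pos_def root_neg_def straighter_def algebra_simps split: if_splits)

lemma straighten_straighter:
  assumes "straighten T ps ns" "t \<in> set ps \<union> set ns"
  shows "straighter t T"
  using assms
proof (induction arbitrary: t)
  case root
  then show ?case using root_straighter by blast
qed (auto intro: straighter_left straighter_right)

lemma straighten_valency:
  assumes "straighten T ps ns" "t \<in> set ps \<union> set ns"
  shows "valency t = valency T"
  using assms
  by (induction arbitrary: t) (fastforce simp: root_pos_def root_neg_def split: if_splits)+

section \<open>Signed sums and maps that respect the straightening relations\<close>

definition signed_sum :: "('b \<Rightarrow> 'a::ab_group_add) \<Rightarrow> 'b list \<Rightarrow> 'b list \<Rightarrow> 'a" where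
  "signed_sum N ps ns = sum_list (map N ps) - sum_list (map N ns)"

lemma signed_sum_map: "signed_sum N (map f ps) (map f ns) = signed_sum (\<lambda>x. N (f x)) ps ns"
  by (simp add: signed_sum_def o_def)

lemma signed_sum_cong:
  assumes "\<And>x. x \<in> set ps \<union> set ns \<Longrightarrow> f x = g x"
  shows "signed_sum f ps ns = signed_sum g ps ns"
proof -
  have "map f ps = map g ps" "map f ns = map g ns" using assms by auto
  then show ?thesis by (simp only: signed_sum_def)
qed

lemma sum_list_signed_sum:
  fixes f :: "'b \<Rightarrow> 'c \<Rightarrow> 'a::ab_group_add"
  shows "(\<Sum>x\<leftarrow>xs. signed_sum (f x) ps ns) = signed_sum (\<lambda>y. \<Sum>x\<leftarrow>xs. f x y) ps ns"
  by (simp add: signed_sum_def sum_list_subtractf sum_list_sum_nth sum_subtractf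
      sum.swap[of _ "{0..<length xs}"])

lemma signed_sum_swap:
  fixes f :: "'b \<Rightarrow> 'c \<Rightarrow> 'a::ab_group_add"
  shows "signed_sum (\<lambda>x. signed_sum (f x) ps ns) qs ms =
    signed_sum (\<lambda>y. signed_sum (\<lambda>x. f x y) qs ms) ps ns"
proof -
  have "signed_sum (\<lambda>x. signed_sum (f x) ps ns) qs ms =
      signed_sum (\<lambda>y. \<Sum>x\<leftarrow>qs. f x y) ps ns - signed_sum (\<lambda>y. \<Sum>x\<leftarrow>ms. f x y) ps ns"
    unfolding signed_sum_def[of _ qs ms] sum_list_signed_sum ..
  also have "\<dots> = signed_sum (\<lambda>y. signed_sum (\<lambda>x. f x y) qs ms) ps ns"
    by (simp add: signed_sum_def sum_list_subtractf)
  finally show ?thesis .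
qed

text \<open>Relations at independent places can be applied in either order, which is an exchange of
  two sums. \<open>Fs\<close> and \<open>Gs\<close> are the terms of one relation as functions of
  the subtree that the other one rewrites; \<open>E\<close> is its leading term.\<close>

lemma signed_sum_exchange:
  fixes N :: "lctree \<Rightarrow> 'a::ab_group_add"
  assumes "\<And>F. F \<in> set Fs \<union> set Gs \<Longrightarrow> N (F x) = signed_sum (\<lambda>y. N (F y)) ps ns"
    and "\<And>y. y \<in> set ps \<union> set ns \<Longrightarrow> N (E y) = signed_sum (\<lambda>F. N (F y)) Fs Gs"
  shows "signed_sum (\<lambda>F. N (F x)) Fs Gs = signed_sum (\<lambda>y. N (E y)) ps ns"
proof -
  have "signed_sum (\<lambda>F. N (F x)) Fs Gs = signed_sum (\<lambda>F. signed_sum (\<lambda>y. N (F y)) ps ns) Fs Gs"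
    by (rule signed_sum_cong) (rule assms)
  also have "\<dots> = signed_sum (\<lambda>y. signed_sum (\<lambda>F. N (F y)) Fs Gs) ps ns"
    by (rule signed_sum_swap)
  also have "\<dots> = signed_sum (\<lambda>y. N (E y)) ps ns"
    by (rule signed_sum_cong) (rule assms(2)[symmetric])
  finally show ?thesis .
qed

definition jacobi_sum :: "(lctree \<Rightarrow> 'a::ab_group_add) \<Rightarrow> nat \<Rightarrow> nat \<Rightarrow> lctree \<Rightarrow> lctree \<Rightarrow> lctree \<Rightarrow> 'a"
  where "jacobi_sum N b c P Q S = N (lnest b c P Q S) - N (lnest b c P S Q) - N (rnest b c P Q S)"

text \<open>
  Up to antisymmetry, the compatibility relation for \<open>b \<noteq> c\<close> and the Jacobi identity for \<open>b = c\<close>.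
\<close>

definition jacobi_pair :: "(lctree \<Rightarrow> 'a::ab_group_add) \<Rightarrow> nat \<Rightarrow> nat \<Rightarrow> lctree \<Rightarrow> lctree \<Rightarrow> lctree \<Rightarrow> 'a"
  where "jacobi_pair N b c P Q S =
    (if b = c then jacobi_sum N b b P Q S else jacobi_sum N b c P Q S + jacobi_sum N c b P Q S)"

lemma jacobi_pair_commute: "jacobi_pair N b c P Q S = jacobi_pair N c b P Q S"
  by (simp add: jacobi_pair_def add.commute)

lemma jacobi_pair_root:
  "jacobi_pair N b c P Q S =
    N (lnest b c P Q S) - signed_sum N (root_pos b c P Q S) (root_neg b c P Q S)"
  by (simp add: jacobi_pair_def jacobi_sum_def root_pos_def root_neg_def signed_sum_def algebra_simps)

definition invariant_at :: "(lctree \<Rightarrow> 'a::ab_group_add) \<Rightarrow> lctree \<Rightarrow> bool" where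
  "invariant_at N T \<longleftrightarrow> (\<forall>ps ns. straighten T ps ns \<longrightarrow> N T = signed_sum N ps ns)"

text \<open>A redex has weakly increasing colors, but the relation is symmetric in them, so
  invariance at the comb with sorted colors gives it for either order.\<close>

lemma invariant_root:
  assumes "invariant_at N (lnest (min b c) (max b c) P Q S)" "valency P < valency Q" "valency Q < valency S"
  shows "jacobi_pair N b c P Q S = 0"
proof -
  have "jacobi_pair N (min b c) (max b c) P Q S = 0"
    unfolding jacobi_pair_root
    using assms root[of P Q S "min b c" "max b c"] unfolding invariant_at_def by auto
  then show ?thesis by (metis jacobi_pair_commute max_def min_def)
qed

lemma invariant_left: "invariant_at N (Node j T r) \<Longrightarrow> invariant_at (\<lambda>t. N (Node j t r)) T"
  unfolding invariant_at_def using left by (metis signed_sum_map)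

lemma invariant_right: "invariant_at N (Node j l T) \<Longrightarrow> invariant_at (\<lambda>t. N (Node j l t)) T"
  unfolding invariant_at_def using right by (metis signed_sum_map)

text \<open>
  The only overlap of straightening steps. The relations of the interval spanned by four blocks,
  summed over its atoms, agree with those summed over its coatoms (both give the alternating sum
  of all maximal chains). All of them but the two in question have straighter leading terms.
\<close>

lemma critical_pair:
  fixes N :: "lctree \<Rightarrow> int"
  assumes v: "valency P < valency Q" "valency Q < valency S" "valency S < valency U"
    and ab: "a \<le> b" and bc: "b \<le> c"
    and H: "\<And>t. straighter t (Node c (Node b (Node a P Q) S) U) \<Longrightarrow> invariant_at N t"
  shows "jacobi_pair N b c (Node a P Q) S U = jacobi_pair (\<lambda>t. N (Node c t U)) a b P Q S"
proof -
  let ?T = "Node c (Node b (Node a P Q) S) U"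
  note [simp] = v order_less_trans[OF v(1,2)] order_less_trans[OF v(2,3)]
    order_less_trans[OF order_less_trans[OF v(1,2)] v(3)]
  have [simp]: "min (valency P) (valency Q) = valency P" "min (valency P) (valency S) = valency P"
    "min (valency P) (valency U) = valency P" "min (valency Q) (valency S) = valency Q"
    "min (valency Q) (valency U) = valency Q" "min (valency S) (valency U) = valency S"
    using v by auto
  have [simp]: "valency Q + valency S < valency U + valency U"
    "valency Q + valency Q < valency S + valency U"
    using v by linarith+
  have PS: "jacobi_pair N y z (Node x P S) Q U = 0" for x y z
    by (rule invariant_root, rule H) (use v in \<open>auto simp: straighter_def algebra_simps\<close>)
  have PU: "jacobi_pair N y z (Node x P U) Q S = 0" for x y z
    by (rule invariant_root, rule H) (use v in \<open>auto simp: straighter_def algebra_simps\<close>)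
  have QS: "jacobi_pair N y z P (Node x Q S) U = 0" for x y z
    by (rule invariant_root, rule H) (use v in \<open>auto simp: straighter_def algebra_simps\<close>)
  have QU: "jacobi_pair N y z P (Node x Q U) S = 0" for x y z
    by (rule invariant_root, rule H) (use v in \<open>auto simp: straighter_def algebra_simps\<close>)
  have SU: "jacobi_pair N y z P Q (Node x S U) = 0" for x y z
    by (rule invariant_root, rule H) (use v in \<open>auto simp: straighter_def algebra_simps\<close>)
  have PSU: "jacobi_pair (\<lambda>t. N (Node z t Q)) x y P S U = 0" for x y z
    by (rule invariant_root, rule invariant_left, rule H) (use v in \<open>auto simp: straighter_def algebra_simps\<close>)
  have PQU: "jacobi_pair (\<lambda>t. N (Node z t S)) x y P Q U = 0" for x y z
    by (rule invariant_root, rule invariant_left, rule H) (use v in \<open>auto simp: straighter_def algebra_simps\<close>)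
  have QSU: "jacobi_pair (\<lambda>t. N (Node z P t)) x y Q S U = 0" for x y z
    by (rule invariant_root, rule invariant_right, rule H) (use v in \<open>auto simp: straighter_def algebra_simps\<close>)
  \<comment> \<open>With p the spine length of \<open>P\<close>, colors \<open>x\<close>,
    \<open>y\<close>, \<open>z\<close> read from the inside of a left comb outwards contribute p(x +
    y + z) + y + 2z to its color weight. For a fixed sum this is ordered like x + 2y + 3z.\<close>
  have PQ: "jacobi_pair N y z (Node x P Q) S U = 0"
    if "x + 2 * min y z + 3 * max y z < a + 2 * b + 3 * c" "x + y + z = a + b + c" for x y z
  proof (rule invariant_root, rule H)
    have "x + min y z + max y z = a + b + c" using that by (simp add: min_def max_def)
    then have "spine_length P * x + spine_length P * min y z + spine_length P * max y z =
      spine_length P * a + spine_length P * b + spine_length P * c"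
      by (metis distrib_left)
    then show "straighter (lnest (min y z) (max y z) (Node x P Q) S U) ?T"
      using that v by (simp add: straighter_def algebra_simps)
  qed auto
  have PQS: "jacobi_pair (\<lambda>t. N (Node z t U)) x y P Q S = 0"
    if "min x y + 2 * max x y + 3 * z < a + 2 * b + 3 * c" "x + y + z = a + b + c" for x y z
  proof (rule invariant_root, rule invariant_left, rule H)
    have "min x y + max x y + z = a + b + c" using that by (simp add: min_def max_def)
    then have "spine_length P * min x y + spine_length P * max x y + spine_length P * z =
      spine_length P * a + spine_length P * b + spine_length P * c"
      by (metis distrib_left)
    then show "straighter (Node z (lnest (min x y) (max x y) P Q S) U) ?T"
      using that v by (simp add: straighter_def algebra_simps)
  qed auto
  \<comment> \<open>Repeated colors make relations coincide, and \<open>jacobi_pair\<close> counts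
    coinciding ones once, so each pattern of equalities has its own list of relations.\<close>
  consider (1) "a = b" "b = c" | (2) "a = b" "b < c" | (3) "a < b" "b = c" | (4) "a < b" "b < c"
    using ab bc by linarith
  then show ?thesis
  proof cases
    case 1
    then show ?thesis
      using PS[of a a a] PU[of a a a] QS[of a a a] QU[of a a a] SU[of a a a] PSU[of a a a]
        PQU[of a a a] QSU[of a a a]
      by (simp add: jacobi_pair_def jacobi_sum_def)
  next
    case 2
    then show ?thesis
      using PS[of a c a] PS[of a a c] PU[of a c a] PU[of a a c] QS[of a c a] QS[of a a c]
        QU[of a c a] QU[of a a c] SU[of a c a] SU[of a a c] PSU[of c a a] PSU[of a a c]
        PQU[of c a a] PQU[of a a c] QSU[of c a a] QSU[of a a c] PQ[of c a a] PQS[of a c a]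
      by (simp add: jacobi_pair_def jacobi_sum_def)
  next
    case 3
    then show ?thesis
      using PS[of b b a] PS[of a b b] PU[of b b a] PU[of a b b] QS[of b b a] QS[of a b b]
        QU[of b b a] QU[of a b b] SU[of b b a] SU[of a b b] PSU[of b a b] PSU[of a b b]
        PQU[of b a b] PQU[of a b b] QSU[of b a b] QSU[of a b b] PQ[of b a b] PQS[of b b a]
      by (simp add: jacobi_pair_def jacobi_sum_def)
  next
    case 4
    then show ?thesis
      using PS[of b c a] PS[of a c b] PS[of a b c] PU[of b c a] PU[of a c b] PU[of a b c]
        QS[of b c a] QS[of a c b] QS[of a b c] QU[of b c a] QU[of a c b] QU[of a b c] SU[of b c a]
        SU[of a c b] SU[of a b c] PSU[of c a b] PSU[of b a c] PSU[of a b c] PQU[of c a b]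
        PQU[of b a c] PQU[of a b c] QSU[of c a b] QSU[of b a c] QSU[of a b c] PQ[of b a c]
        PQ[of c a b] PQS[of a c b] PQS[of b c a]
      by (simp add: jacobi_pair_def jacobi_sum_def)
  qed
qed

lemma straighten_nested:
  assumes "straighten x ps ns"
  shows "straighten (lnest b c x Q S) (map (\<lambda>x. lnest b c x Q S) ps) (map (\<lambda>x. lnest b c x Q S) ns)"
    and "straighten (lnest b c P x S) (map (\<lambda>x. lnest b c P x S) ps) (map (\<lambda>x. lnest b c P x S) ns)"
    and "straighten (lnest b c P Q x) (map (\<lambda>x. lnest b c P Q x) ps) (map (\<lambda>x. lnest b c P Q x) ns)"
    and "straighten (rnest b c x Q S) (map (\<lambda>x. rnest b c x Q S) ps) (map (\<lambda>x. rnest b c x Q S) ns)"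
    and "straighten (rnest b c P x S) (map (\<lambda>x. rnest b c P x S) ps) (map (\<lambda>x. rnest b c P x S) ns)"
    and "straighten (rnest b c P Q x) (map (\<lambda>x. rnest b c P Q x) ps) (map (\<lambda>x. rnest b c P Q x) ns)"
  using left[OF left[OF assms]] left[OF right[OF assms]] right[OF assms] left[OF assms]
    right[OF left[OF assms]] right[OF right[OF assms]]
  by (simp_all add: o_def)

text \<open>A step inside an argument of a redex is independent of the redex. With \<open>P\<close>,
  \<open>Q\<close>, \<open>S\<close> as functions of the rewritten subtree the three positions are
  treated at once; in each use two of the functions are constant.\<close>

lemma root_exchange:
  fixes N :: "lctree \<Rightarrow> int"
  assumes Fs: "\<And>y. root_pos b c (P y) (Q y) (S y) = map (\<lambda>F. F y) Fs"
    and Gs: "\<And>y. root_neg b c (P y) (Q y) (S y) = map (\<lambda>F. F y) Gs"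
    and str: "\<And>F. F \<in> set Fs \<union> set Gs \<Longrightarrow> straighten (F x) (map F ps) (map F ns)"
    and v: "\<And>y. y \<in> insert x (set ps \<union> set ns) \<Longrightarrow>
      valency (P y) < valency (Q y) \<and> valency (Q y) < valency (S y)"
    and bc: "b \<le> c"
    and less: "\<And>y. y \<in> set ps \<union> set ns \<Longrightarrow>
      straighter (lnest b c (P y) (Q y) (S y)) (lnest b c (P x) (Q x) (S x))"
    and H: "\<And>t. straighter t (lnest b c (P x) (Q x) (S x)) \<Longrightarrow> invariant_at N t"
  shows "signed_sum N (root_pos b c (P x) (Q x) (S x)) (root_neg b c (P x) (Q x) (S x)) =
    signed_sum (\<lambda>y. N (lnest b c (P y) (Q y) (S y))) ps ns"
  unfolding Fs Gs signed_sum_map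
proof (rule signed_sum_exchange)
  fix F assume F: "F \<in> set Fs \<union> set Gs"
  then have "F x \<in> set (root_pos b c (P x) (Q x) (S x)) \<union> set (root_neg b c (P x) (Q x) (S x))"
    by (auto simp: Fs Gs)
  then have "invariant_at N (F x)" using H root_straighter v bc by blast
  then show "N (F x) = signed_sum (\<lambda>y. N (F y)) ps ns"
    using str[OF F] by (simp add: invariant_at_def signed_sum_map)
next
  fix y assume y: "y \<in> set ps \<union> set ns"
  then have "straighten (lnest b c (P y) (Q y) (S y)) (map (\<lambda>F. F y) Fs) (map (\<lambda>F. F y) Gs)"
    using root[of "P y" "Q y" "S y" b c] v bc by (simp add: Fs Gs)
  then show "N (lnest b c (P y) (Q y) (S y)) = signed_sum (\<lambda>F. N (F y)) Fs Gs"
    using H[OF less[OF y]] by (simp add: invariant_at_def signed_sum_map)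
qed

text \<open>A step elsewhere lies inside \<open>S\<close>, inside \<open>P\<close> or
  \<open>Q\<close>, or at the left child. Only the last one overlaps with the root, and there
  \<open>critical_pair\<close> compares the two relations.\<close>

lemma root_confluent:
  fixes N :: "lctree \<Rightarrow> int"
  assumes v: "valency P < valency Q" "valency Q < valency S" and bc: "b \<le> c"
    and H: "\<And>t. straighter t (lnest b c P Q S) \<Longrightarrow> invariant_at N t"
    and str: "straighten (lnest b c P Q S) qs ms"
  shows "signed_sum N (root_pos b c P Q S) (root_neg b c P Q S) = signed_sum N qs ms"
  using str
proof cases
  case root
  then show ?thesis by simp
next
  case (right ps ns)
  note val = straighten_valency[OF right(3)] and less = straighten_straighter[OF right(3)]
  have "signed_sum N (root_pos b c P Q S) (root_neg b c P Q S) =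
      signed_sum (\<lambda>y. N (lnest b c P Q y)) ps ns"
  proof (rule root_exchange[where P = "\<lambda>_. P" and Q = "\<lambda>_. Q" and S = "\<lambda>y. y" and x = S])
    show "root_pos b c P Q y = map (\<lambda>F. F y)
        (if b = c then [\<lambda>y. lnest b b P y Q, \<lambda>y. rnest b b P Q y]
         else [\<lambda>y. lnest b c P y Q, \<lambda>y. lnest c b P y Q, \<lambda>y. rnest b c P Q y, \<lambda>y. rnest c b P Q y])"
      for y by (simp add: root_pos_def)
    show "root_neg b c P Q y = map (\<lambda>F. F y) (if b = c then [] else [\<lambda>y. lnest c b P Q y])"
      for y by (simp add: root_neg_def)
  qed (use v bc H val less right(3) in \<open>auto split: if_splits intro: straighter_right
        straighten_nested\<close>)
  then show ?thesis by (simp add: right signed_sum_map)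
next
  case (left ls ms')
  from left(3) show ?thesis
  proof cases
    case (root P' Q' a)
    have "jacobi_pair N b c (Node a P' Q') Q S = jacobi_pair (\<lambda>t. N (Node c t S)) a b P' Q' Q"
      by (rule critical_pair) (use v bc H root in auto)
    then show ?thesis
      by (simp add: jacobi_pair_root root left signed_sum_map)
  next
    case l: (left ps ns)
    note val = straighten_valency[OF l(3)] and less = straighten_straighter[OF l(3)]
    have "signed_sum N (root_pos b c P Q S) (root_neg b c P Q S) =
        signed_sum (\<lambda>y. N (lnest b c y Q S)) ps ns"
    proof (rule root_exchange[where P = "\<lambda>y. y" and Q = "\<lambda>_. Q" and S = "\<lambda>_. S" and x = P])
      show "root_pos b c y Q S = map (\<lambda>F. F y)
          (if b = c then [\<lambda>y. lnest b b y S Q, \<lambda>y. rnest b b y Q S]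
           else [\<lambda>y. lnest b c y S Q, \<lambda>y. lnest c b y S Q, \<lambda>y. rnest b c y Q S, \<lambda>y. rnest c b y Q S])"
        for y by (simp add: root_pos_def)
      show "root_neg b c y Q S = map (\<lambda>F. F y) (if b = c then [] else [\<lambda>y. lnest c b y Q S])"
        for y by (simp add: root_neg_def)
    qed (use v bc H val less l(3) in \<open>auto split: if_splits
          intro: straighter_left[OF straighter_left] straighten_nested\<close>)
    then show ?thesis by (simp add: left l signed_sum_map)
  next
    case r: (right ps ns)
    note val = straighten_valency[OF r(3)] and less = straighten_straighter[OF r(3)]
    have "signed_sum N (root_pos b c P Q S) (root_neg b c P Q S) =
        signed_sum (\<lambda>y. N (lnest b c P y S)) ps ns"
    proof (rule root_exchange[where P = "\<lambda>_. P" and Q = "\<lambda>y. y" and S = "\<lambda>_. S" and x = Q])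
      show "root_pos b c P y S = map (\<lambda>F. F y)
          (if b = c then [\<lambda>y. lnest b b P S y, \<lambda>y. rnest b b P y S]
           else [\<lambda>y. lnest b c P S y, \<lambda>y. lnest c b P S y, \<lambda>y. rnest b c P y S, \<lambda>y. rnest c b P y S])"
        for y by (simp add: root_pos_def)
      show "root_neg b c P y S = map (\<lambda>F. F y) (if b = c then [] else [\<lambda>y. lnest c b P y S])"
        for y by (simp add: root_neg_def)
    qed (use v bc H val less r(3) in \<open>auto split: if_splits 
          intro: straighter_left[OF straighter_right] straighten_nested\<close>)
    then show ?thesis by (simp add: left r signed_sum_map)
  qed
qed

text \<open>Joinability is replaced by the induction hypothesis of the later recursion:
  \<open>N\<close> is already invariant at all straighter trees. \<open>N\<close> is generalized in
  the induction because a step in a subtree concerns \<open>N\<close> composed with the surrounding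
  node.\<close>

lemma confluent:
  fixes N :: "lctree \<Rightarrow> int"
  assumes "\<And>t. straighter t T \<Longrightarrow> invariant_at N t"
    and "straighten T ps ns" "straighten T qs ms"
  shows "signed_sum N ps ns = signed_sum N qs ms"
  using assms
proof (induction T arbitrary: N ps ns qs ms)
  case (Leaf a)
  then show ?case by (auto elim: straighten.cases)
next
  case (Node j l r)
  note H = Node.prems(1)
  have Hl: "invariant_at (\<lambda>t. N (Node j t r)) t" if "straighter t l" for t
    using H[OF straighter_left[OF that]] by (rule invariant_left)
  have Hr: "invariant_at (\<lambda>t. N (Node j l t)) t" if "straighter t r" for t
    using H[OF straighter_right[OF that]] by (rule invariant_right)
  have both: "signed_sum (\<lambda>t. N (Node j t r)) ps ns = signed_sum (\<lambda>t. N (Node j l t)) qs ms"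
    if l: "straighten l ps ns" and r: "straighten r qs ms" for ps ns qs ms
  proof -
    have 1: "N (Node j t r) = signed_sum (\<lambda>u. N (Node j t u)) qs ms" if "t \<in> set ps \<union> set ns" for t
      using invariant_right[OF H[OF straighter_left[OF straighten_straighter[OF l that]]]] r
      by (simp add: invariant_at_def)
    have 2: "N (Node j l u) = signed_sum (\<lambda>t. N (Node j t u)) ps ns" if "u \<in> set qs \<union> set ms" for u
      using invariant_left[OF H[OF straighter_right[OF straighten_straighter[OF r that]]]] l
      by (simp add: invariant_at_def)
    have "signed_sum (\<lambda>t. N (Node j t r)) ps ns =
        signed_sum (\<lambda>t. signed_sum (\<lambda>u. N (Node j t u)) qs ms) ps ns"
      by (rule signed_sum_cong) (rule 1)
    also have "\<dots> = signed_sum (\<lambda>u. signed_sum (\<lambda>t. N (Node j t u)) ps ns) qs ms"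
      by (rule signed_sum_swap)
    also have "\<dots> = signed_sum (\<lambda>t. N (Node j l t)) qs ms"
      by (rule signed_sum_cong) (rule 2[symmetric])
    finally show ?thesis .
  qed
  show ?case
    using Node.prems(2)
  proof cases
    case (root P Q b)
    then show ?thesis
      using root_confluent[of P Q r b j N qs ms] Node.prems by simp
  next
    case l: (left ps' ns')
    show ?thesis
      using Node.prems(3)
    proof cases
      case (root P Q b)
      then show ?thesis
        using root_confluent[of P Q r b j N ps ns] Node.prems by simp
    next
      case (left qs' ms')
      then show ?thesis
        using Node.IH(1)[OF Hl l(3) left(3)] by (simp add: l signed_sum_map)
    next
      case (right qs' ms')
      then show ?thesis using both[OF l(3) right(3)] by (simp add: l signed_sum_map)
    qed
  next
    case r: (right ps' ns')
    show ?thesis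
      using Node.prems(3)
    proof cases
      case (root P Q b)
      then show ?thesis
        using root_confluent[of P Q r b j N ps ns] Node.prems by simp
    next
      case (left qs' ms')
      then show ?thesis using both[OF left(3) r(3)] by (simp add: r signed_sum_map)
    next
      case (right qs' ms')
      then show ?thesis
        using Node.IH(2)[OF Hr r(3) right(3)] by (simp add: r signed_sum_map)
    qed
  qed
qed

text \<open>The value at a reducible tree is computed from an arbitrarily chosen step, whose terms
  are straighter; by confluence every other step yields the same value. Free values at irreducible
  trees later give a functional dual to one Lyndon tree.\<close>

lemma invariant_functional:
  fixes N0 :: "lctree \<Rightarrow> int"
  obtains N where "\<And>T. invariant_at N T"
    and "\<And>T. (\<nexists>ps ns. straighten T ps ns) \<Longrightarrow> N T = N0 T"
proof -
  let ?R = "{(t, T). straighter t T}"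
  let ?E = "\<lambda>T (ps, ns). straighten T ps ns"
  define H where "H = (\<lambda>N T. if Ex (?E T)
    then signed_sum N (fst (SOME e. ?E T e)) (snd (SOME e. ?E T e)) else N0 T)"
  define N where "N = wfrec ?R H"
  have N: "N T = H N T" for T
  proof -
    have "N T = H (cut N ?R T) T" unfolding N_def by (rule wfrec[OF wf_straighter])
    also have "\<dots> = H N T"
    proof (cases "Ex (?E T)")
      case True
      then have "?E T (SOME e. ?E T e)" by (rule someI_ex)
      then have "straighten T (fst (SOME e. ?E T e)) (snd (SOME e. ?E T e))"
        by (simp add: case_prod_beta)
      then have "signed_sum (cut N ?R T) (fst (SOME e. ?E T e)) (snd (SOME e. ?E T e)) =
          signed_sum N (fst (SOME e. ?E T e)) (snd (SOME e. ?E T e))"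
        by (intro signed_sum_cong cut_apply) (use straighten_straighter in blast)
      then show ?thesis unfolding H_def by (simp only: True if_True)
    next
      case False
      then show ?thesis unfolding H_def by (simp only: if_False)
    qed
    finally show ?thesis .
  qed
  have inv: "invariant_at N T" for T
    using wf_straighter
  proof (induction T rule: wf_induct_rule)
    case (less T)
    show ?case
      unfolding invariant_at_def
    proof (intro allI impI)
      fix ps ns assume str: "straighten T ps ns"
      then have ex: "Ex (?E T)" by auto
      then have "?E T (SOME e. ?E T e)" by (rule someI_ex)
      then have "straighten T (fst (SOME e. ?E T e)) (snd (SOME e. ?E T e))"
        by (simp add: case_prod_beta)
      then have "signed_sum N (fst (SOME e. ?E T e)) (snd (SOME e. ?E T e)) = signed_sum N ps ns"
        by (rule confluent[rotated]) (use str less in auto)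
      then show "N T = signed_sum N ps ns" by (subst N) (simp only: H_def ex if_True)
    qed
  qed
  show ?thesis
    by (rule that[OF inv]) (subst N, auto simp: H_def)
qed

section \<open>Lyndon trees span\<close>

definition color_count :: "lctree \<Rightarrow> nat \<Rightarrow> nat" where
  "color_count T = (\<lambda>j. length (filter (\<lambda>x. color x = j) (internal_nodes T)))"

lemma color_count_Leaf [simp]: "color_count (Leaf a) = (\<lambda>_. 0)"
  by (simp add: color_count_def)

lemma color_count_Node [simp]:
  "color_count (Node j l r) = color_count l + color_count r + unit_comp j"
  by (auto simp: color_count_def unit_comp_def)

lemma color_count_zero: "color_count T 0 = 0 \<longleftrightarrow> (\<forall>x\<in>set (internal_nodes T). color x \<ge> 1)"
  by (auto simp: color_count_def filter_empty_conv Suc_le_eq)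

lemma labeled_trees_iff:
  "T \<in> labeled_trees n \<mu> \<longleftrightarrow>
    distinct (labels T) \<and> set (labels T) = {1..n} \<and> color_count T = \<mu> \<and> \<mu> 0 = 0"
proof -
  have "T \<in> labeled_trees n \<mu> \<longleftrightarrow>
    distinct (labels T) \<and> set (labels T) = {1..n} \<and> color_count T 0 = 0 \<and> color_count T = \<mu>"
    unfolding labeled_trees_def mem_Collect_eq color_count_zero by (auto simp: color_count_def)
  then show ?thesis by auto
qed

lemma normalized_Leaf [simp]: "normalized (Leaf a)"
  by (simp add: normalized_def)

lemma normalized_Node [simp]:
  "normalized (Node j l r) \<longleftrightarrow> normalized l \<and> normalized r \<and> valency l \<le> valency r"
  by (auto simp: normalized_def)

definition normal_trees :: "nat \<Rightarrow> (nat \<Rightarrow> nat) \<Rightarrow> lctree set" where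
  "normal_trees n \<mu> = {T \<in> labeled_trees n \<mu>. normalized T}"

lemma straighten_preserves:
  assumes "straighten T ps ns" "t \<in> set ps \<union> set ns"
  shows "mset (labels t) = mset (labels T) \<and> color_count t = color_count T \<and>
    (normalized T \<longrightarrow> normalized t)"
  using assms
proof (induction arbitrary: t)
  case (root P Q S b c)
  then show ?case
    by (auto simp: root_pos_def root_neg_def ac_simps split: if_splits)
next
  case (left l ps ns j r)
  then show ?case using straighten_valency[OF left(1)] by fastforce
next
  case (right r ps ns j l)
  then show ?case using straighten_valency[OF right(1)] by fastforce
qed

lemma straighten_normal_trees:
  assumes "straighten T ps ns" "t \<in> set ps \<union> set ns" "T \<in> normal_trees n \<mu>"
  shows "t \<in> normal_trees n \<mu>"
  using straighten_preserves[OF assms(1,2)] assms(3)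
  by (auto simp: normal_trees_def labeled_trees_iff dest: mset_eq_setD mset_eq_imp_distinct_iff)

lemma valency_in_labels: "valency T \<in> set (labels T)"
  by (simp add: valency_def)

lemma valency_neq:
  "distinct (labels l @ labels r) \<Longrightarrow> valency l \<noteq> valency r"
  using valency_in_labels[of l] valency_in_labels[of r] by auto

text \<open>Distinct labels give distinct valencies, which turns the weak inequalities of
  normalization and of a non-Lyndon node into the strict ones that \<open>straighten\<close>
  demands.\<close>

lemma straighten_exists:
  assumes "normalized T" "distinct (labels T)" "x \<in> set (internal_nodes T)"
    and "\<not> lyndon_node x" "\<not> color (left x) > color x"
  shows "\<exists>ps ns. straighten T ps ns"
  using assms
proof (induction T)
  case (Node j l r)
  consider "x \<in> set (internal_nodes l)" | "x \<in> set (internal_nodes r)" | "x = Node j l r"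
    using Node.prems(3) by auto
  then show ?case
  proof cases
    case 1
    then show ?thesis using Node by (auto intro: straighten.left)
  next
    case 2
    then show ?thesis using Node by (auto intro: straighten.right)
  next
    case 3
    then obtain b P Q where l: "l = Node b P Q"
      using Node.prems(4) by (cases l) (auto simp: lyndon_node_def)
    have "valency P \<noteq> valency Q" "valency Q \<noteq> valency r"
      using Node.prems(2) valency_neq[of P Q] valency_neq[of Q r] by (auto simp: l)
    then have "straighten (Node j l r) (root_pos b j P Q r) (root_neg b j P Q r)"
      unfolding l using Node.prems 3 by (intro root) (auto simp: l lyndon_node_def)
    then show ?thesis by blast
  qed
qed simp

lemma straighten_not_lyndon:
  assumes "straighten T ps ns"
  shows "\<exists>x\<in>set (internal_nodes T). \<not> lyndon_node x \<and> \<not> color (left x) > color x"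
  using assms by induction (auto simp: lyndon_node_def)

lemma Lyn_iff: "T \<in> Lyn n \<mu> \<longleftrightarrow> T \<in> normal_trees n \<mu> \<and> (\<nexists>ps ns. straighten T ps ns)"
proof
  assume T: "T \<in> Lyn n \<mu>"
  then show "T \<in> normal_trees n \<mu> \<and> (\<nexists>ps ns. straighten T ps ns)"
    using straighten_not_lyndon[of T] by (fastforce simp: Lyn_def normal_trees_def)
next
  assume "T \<in> normal_trees n \<mu> \<and> (\<nexists>ps ns. straighten T ps ns)"
  then show "T \<in> Lyn n \<mu>"
    using straighten_exists[of T]
    by (auto simp: Lyn_def normal_trees_def labeled_trees_iff)
qed

text \<open>An arbitrary map into an abelian group and a set closed under its operations let one
  induction serve both monomials modulo the Lie ideal and signed chains modulo coboundaries.\<close>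

lemma normal_trees_span:
  fixes \<Phi> :: "lctree \<Rightarrow> 'a::ab_group_add"
  assumes V: "0 \<in> V" "\<And>f g. f \<in> V \<Longrightarrow> g \<in> V \<Longrightarrow> f + g \<in> V" "\<And>f. f \<in> V \<Longrightarrow> - f \<in> V"
    and rel: "\<And>T ps ns. T \<in> normal_trees n \<mu> \<Longrightarrow> straighten T ps ns \<Longrightarrow>
      \<Phi> T - signed_sum \<Phi> ps ns \<in> V"
    and Lyn: "\<And>T. T \<in> Lyn n \<mu> \<Longrightarrow> \<Phi> T \<in> V"
    and T: "T \<in> normal_trees n \<mu>"
  shows "\<Phi> T \<in> V"
  using wf_straighter T
proof (induction T rule: wf_induct_rule)
  case (less T)
  show ?case
  proof (cases "\<exists>ps ns. straighten T ps ns")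
    case True
    then obtain ps ns where str: "straighten T ps ns" by blast
    have t: "\<Phi> t \<in> V" if "t \<in> set ps \<union> set ns" for t
      using less.IH[of t] straighten_straighter[OF str that]
        straighten_normal_trees[OF str that less.prems] by simp
    have sum: "sum_list (map \<Phi> ts) \<in> V" if "set ts \<subseteq> set ps \<union> set ns" for ts
      using that by (induction ts) (auto simp: V t subset_iff)
    have "signed_sum \<Phi> ps ns \<in> V"
      using V(2)[OF sum[of ps] V(3)[OF sum[of ns]]] by (simp add: signed_sum_def)
    then show ?thesis using V(2)[OF rel[OF less.prems str]] by fastforce
  next
    case False
    then show ?thesis using Lyn less.prems by (simp add: Lyn_iff)
  qed
qed

section \<open>Bases of quotient spaces\<close>

lemma coset_add:
  fixes W :: "('x \<Rightarrow> 'k::field) set"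
  assumes "linear_subspace W"
  shows "(f +o W) + (g +o W) = (f + g) +o W"
proof -
  have "W + W = W"
    using assms set_zero_plus2[of W W] by (fastforce simp: set_plus_def linear_subspace_def)
  then show ?thesis by (simp add: set_plus_rearrange)
qed

lemma coset_smult:
  fixes W :: "('x \<Rightarrow> 'k::field) set"
  assumes W: "linear_subspace W"
  shows "smult (quotient_space U W) c (f +o W) = (\<lambda>x. c * f x) +o W"
proof -
  have "(\<lambda>f x. c * f x) ` (f +o W) + W = (\<lambda>x. c * f x) +o W"
  proof (intro equalityI subsetI)
    fix h assume "h \<in> (\<lambda>f x. c * f x) ` (f +o W) + W"
    then obtain w v where h: "w \<in> W" "v \<in> W" "h = (\<lambda>x. c * (f + w) x) + v"
      by (auto simp: set_plus_def elt_set_plus_def)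
    then have "h = (\<lambda>x. c * f x) + ((\<lambda>x. c * w x) + v)" by (auto simp: fun_eq_iff algebra_simps)
    then show "h \<in> (\<lambda>x. c * f x) +o W"
      using h(1,2) W by (auto simp: elt_set_plus_def linear_subspace_def)
  next
    fix h assume "h \<in> (\<lambda>x. c * f x) +o W"
    then obtain v where v: "v \<in> W" "h = (\<lambda>x. c * f x) + v" by (auto simp: elt_set_plus_def)
    have "f \<in> f +o W" using W by (force simp: elt_set_plus_def linear_subspace_def)
    then show "h \<in> (\<lambda>f x. c * f x) ` (f +o W) + W" using v by (auto simp: set_plus_def)
  qed
  then show ?thesis by (simp add: quotient_space_def)
qed

lemma coset_eq_iff:
  fixes W :: "('x \<Rightarrow> 'k::field) set"
  assumes W: "linear_subspace W"
  shows "f +o W = g +o W \<longleftrightarrow> f - g \<in> W"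
proof
  assume "f +o W = g +o W"
  moreover have "f \<in> f +o W" using W by (force simp: elt_set_plus_def linear_subspace_def)
  ultimately show "f - g \<in> W" by (auto simp: elt_set_plus_def)
next
  assume fg: "f - g \<in> W"
  then have "(\<lambda>x. -1 * (f - g) x) \<in> W" using W unfolding linear_subspace_def by blast
  then have gf: "g - f \<in> W" by (simp add: fun_diff_def)
  have "h \<in> f +o W \<Longrightarrow> f - g \<in> W \<Longrightarrow> h \<in> g +o W" for f g h
    using W by (force simp: elt_set_plus_def linear_subspace_def)
  then show "f +o W = g +o W" using fg gf by blast
qed

lemma linear_subspace_neg: "linear_subspace W \<Longrightarrow> f \<in> W \<Longrightarrow> - f \<in> W"
  unfolding linear_subspace_def by (metis (no_types, lifting) fun_Compl_def mult_minus1 ext)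

lemma linear_subspace_diff: "linear_subspace W \<Longrightarrow> f \<in> W \<Longrightarrow> g \<in> W \<Longrightarrow> f - g \<in> W"
  using linear_subspace_neg[of W g] unfolding linear_subspace_def diff_conv_add_uminus by blast

lemma quotient_space_submodule:
  fixes U V W :: "('x \<Rightarrow> 'k::field) set"
  assumes U: "linear_subspace U" and V: "linear_subspace V" and W: "linear_subspace W"
    and WV: "W \<subseteq> V" and VU: "V \<subseteq> U"
  shows "submodule class_ring ((\<lambda>f. f +o W) ` V) (quotient_space U W)"
proof -
  interpret vectorspace class_ring "quotient_space U W"
    using WV VU by (intro quotient_space_vectorspace U W) auto
  show ?thesis
  proof (rule submodule.intro)
    show "module class_ring (quotient_space U W)" ..
    show "(\<lambda>f. f +o W) ` V \<subseteq> carrier (quotient_space U W)"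
      using VU by (auto simp: quotient_space_def)
    have "W = 0 +o W" by (simp add: elt_set_plus_def)
    then show "\<zero>\<^bsub>quotient_space U W\<^esub> \<in> (\<lambda>f. f +o W) ` V"
      using V unfolding linear_subspace_def quotient_space_def by fastforce
  next
    fix A B assume "A \<in> (\<lambda>f. f +o W) ` V" "B \<in> (\<lambda>f. f +o W) ` V"
    then obtain f g where "f \<in> V" "g \<in> V" "A = f +o W" "B = g +o W" by blast
    then show "A \<oplus>\<^bsub>quotient_space U W\<^esub> B \<in> (\<lambda>f. f +o W) ` V"
      using V coset_add[OF W, of f g] by (auto simp: quotient_space_def linear_subspace_def)
  next
    fix c A assume "A \<in> (\<lambda>f. f +o W) ` V"
    then obtain f where "f \<in> V" "A = f +o W" by blast
    then show "c \<odot>\<^bsub>quotient_space U W\<^esub> A \<in> (\<lambda>f. f +o W) ` V"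
      using V coset_smult[OF W, of U c f] by (auto simp: linear_subspace_def)
  qed
qed

text \<open>With the preimage of a span, later arguments can stay with functions and subspaces
  instead of cosets.\<close>

lemma span_quotient_space_subset:
  fixes U W :: "('x \<Rightarrow> 'k::field) set"
  assumes U: "linear_subspace U" and W: "linear_subspace W" and WU: "W \<subseteq> U"
    and B: "B \<subseteq> carrier (quotient_space U W)"
  shows "linear_subspace {f \<in> U. f +o W \<in> LinearCombinations.module.span class_ring (quotient_space U W) B}"
    (is "linear_subspace ?V")
    and "W \<subseteq> {f \<in> U. f +o W \<in> LinearCombinations.module.span class_ring (quotient_space U W) B}"
proof -
  interpret vectorspace class_ring "quotient_space U W"
    by (rule quotient_space_vectorspace[OF U W WU])
  have sub: "submodule class_ring (span B) (quotient_space U W)" using B by (rule span_is_submodule)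
  have zero: "W \<in> span B" using submodule.zero_closed[OF sub] by (simp add: quotient_space_def)
  have eqW: "f +o W = W" if "f \<in> W" for f
    using coset_eq_iff[OF W, of f 0] that by simp
  show 1: "W \<subseteq> ?V" using zero WU eqW by auto
  show "linear_subspace ?V"
    unfolding linear_subspace_def
  proof (intro conjI ballI allI)
    show "0 \<in> ?V" using 1 W by (auto simp: linear_subspace_def)
  next
    fix f g assume fg: "f \<in> ?V" "g \<in> ?V"
    have "(f +o W) \<oplus>\<^bsub>quotient_space U W\<^esub> (g +o W) \<in> span B"
      using fg by (intro submodule.m_closed[OF sub]) auto
    then have "(f + g) +o W \<in> span B"
      using coset_add[OF W, of f g] by (simp add: quotient_space_def)
    then show "f + g \<in> ?V" using fg U by (auto simp: linear_subspace_def)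
  next
    fix c f assume f: "f \<in> ?V"
    have "c \<odot>\<^bsub>quotient_space U W\<^esub> (f +o W) \<in> span B"
      using f by (intro submodule.smult_closed[OF sub]) auto
    then show "(\<lambda>x. c * f x) \<in> ?V"
      using f U coset_smult[OF W, of U c f] by (auto simp: linear_subspace_def)
  qed
qed

text \<open>Spanning is required in the form that an induction over trees delivers: a subspace that
  contains \<open>W\<close> and the generators contains \<open>U\<close>. Independence is required
  through functionals that vanish on \<open>W\<close> and separate one generator from all
  others.\<close>

lemma quotient_space_basis:
  fixes U W :: "('x \<Rightarrow> 'k::field) set" and \<Phi> :: "'i \<Rightarrow> 'x \<Rightarrow> 'k"
  assumes U: "linear_subspace U" and W: "linear_subspace W" and WU: "W \<subseteq> U"
    and \<Phi>: "\<And>i. i \<in> I \<Longrightarrow> \<Phi> i \<in> U"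
    and span: "\<And>V. linear_subspace V \<Longrightarrow> W \<subseteq> V \<Longrightarrow> \<Phi> ` I \<subseteq> V \<Longrightarrow> U \<subseteq> V"
    and indep: "\<And>i. i \<in> I \<Longrightarrow> \<exists>\<Lambda>.
      (\<forall>f\<in>U. \<forall>g\<in>U. \<Lambda> (f + g) = \<Lambda> f + \<Lambda> g) \<and> (\<forall>c. \<forall>f\<in>U. \<Lambda> (\<lambda>x. c * f x) = c * \<Lambda> f) \<and>
      (\<forall>f\<in>W. \<Lambda> f = (0::'k)) \<and> \<Lambda> (\<Phi> i) \<noteq> 0 \<and> (\<forall>j\<in>I. j \<noteq> i \<longrightarrow> \<Lambda> (\<Phi> j) = 0)"
  shows "vectorspace.basis class_ring (quotient_space U W) {\<Phi> i +o W | i. i \<in> I}"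
proof -
  let ?Q = "quotient_space U W" and ?B = "{\<Phi> i +o W | i. i \<in> I}"
  interpret vectorspace class_ring ?Q by (rule quotient_space_vectorspace[OF U W WU])
  have carr: "carrier ?Q = (\<lambda>f. f +o W) ` U" by (simp add: quotient_space_def)
  have B: "?B \<subseteq> carrier ?Q" using \<Phi> by (auto simp: carr)
  have "U \<subseteq> {f \<in> U. f +o W \<in> span ?B}"
    using in_own_span[OF B] \<Phi>
    by (intro span span_quotient_space_subset[OF U W WU B]) auto
  then have "carrier ?Q \<subseteq> span ?B" by (auto simp: carr)
  then have gen: "span ?B = carrier ?Q" using span_is_subset2[OF B] by blast
  have "\<not> lin_dep ?B"
  proof
    assume "lin_dep ?B"
    then obtain A a v where A: "finite A" "A \<subseteq> ?B" "lincomb a A = \<zero>\<^bsub>?Q\<^esub>" "v \<in> A" "a v \<noteq> 0"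
      by (auto simp: lin_dep_def)
    obtain i where i: "i \<in> I" "v = \<Phi> i +o W" using A by blast
    obtain \<Lambda> where add: "\<And>f g. f \<in> U \<Longrightarrow> g \<in> U \<Longrightarrow> \<Lambda> (f + g) = \<Lambda> f + \<Lambda> g"
      and scale: "\<And>c f. f \<in> U \<Longrightarrow> \<Lambda> (\<lambda>x. c * f x) = c * \<Lambda> f"
      and ker: "\<And>f. f \<in> W \<Longrightarrow> \<Lambda> f = 0"
      and dual: "\<Lambda> (\<Phi> i) \<noteq> 0" "\<And>j. j \<in> I \<Longrightarrow> j \<noteq> i \<Longrightarrow> \<Lambda> (\<Phi> j) = 0"
      using indep[OF i(1)] by blast
    have coset: "\<Lambda> f = \<Lambda> g" if "f +o W = g +o W" "g \<in> U" for f g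
    proof -
      have "f - g \<in> W" using that coset_eq_iff[OF W] by blast
      then show ?thesis using add[of "f - g" g] ker[of "f - g"] WU that(2) by auto
    qed
    \<comment> \<open>The elements of \<open>A\<close> are cosets, so an index is chosen for each.
      The one chosen for \<open>v\<close> is not known to be \<open>i\<close>, but \<Lambda> is
      constant on cosets and takes the same value at both.\<close>
    obtain \<psi> where \<psi>: "\<And>C. C \<in> A \<Longrightarrow> \<psi> C \<in> I \<and> C = \<Phi> (\<psi> C) +o W"
      using bchoice[of A "\<lambda>C i. i \<in> I \<and> C = \<Phi> i +o W"] A(2) by blast
    \<comment> \<open>A linear combination in the quotient is lifted to a representative at which
      \<Lambda> can be evaluated.\<close>
    have "\<exists>f\<in>U. lincomb a A' = f +o W \<and> \<Lambda> f = (\<Sum>C\<in>A'. a C * \<Lambda> (\<Phi> (\<psi> C)))" if "A' \<subseteq> A" for A'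
      using finite_subset[OF that A(1)] that
    proof (induction A' rule: finite_induct)
      case empty
      have "\<Lambda> 0 = 0" using ker W by (auto simp: linear_subspace_def)
      moreover have "0 \<in> U" using U by (simp add: linear_subspace_def)
      moreover have "lincomb a {} = 0 +o W"
        unfolding lincomb_def by simp (simp add: quotient_space_def)
      ultimately show ?case by (metis sum.empty)
    next
      case (insert C A')
      then obtain f where f: "f \<in> U" "lincomb a A' = f +o W"
        "\<Lambda> f = (\<Sum>C\<in>A'. a C * \<Lambda> (\<Phi> (\<psi> C)))" by blast
      have \<psi>C: "\<psi> C \<in> I" "C = \<Phi> (\<psi> C) +o W" using \<psi> insert by auto
      let ?g = "\<lambda>x. a C * \<Phi> (\<psi> C) x"
      have g: "?g \<in> U" using U \<Phi>[OF \<psi>C(1)] by (simp add: linear_subspace_def)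
      have "lincomb a (insert C A') = (a C \<odot>\<^bsub>?Q\<^esub> C) \<oplus>\<^bsub>?Q\<^esub> lincomb a A'"
      proof -
        have "A' \<subseteq> carrier ?Q" "C \<in> carrier ?Q" using insert.prems A(2) B by blast+
        then show ?thesis using lincomb_insert[of A' a C] insert.hyps by simp
      qed
      also have "a C \<odot>\<^bsub>?Q\<^esub> C = ?g +o W"
        using coset_smult[OF W, of U "a C" "\<Phi> (\<psi> C)"] \<psi>C(2) by simp
      also have "(?g +o W) \<oplus>\<^bsub>?Q\<^esub> lincomb a A' = (?g + f) +o W"
        using coset_add[OF W, of ?g f] by (simp add: f(2)) (simp add: quotient_space_def)
      finally have "lincomb a (insert C A') = (?g + f) +o W" .
      moreover have "\<Lambda> (?g + f) = (\<Sum>C\<in>insert C A'. a C * \<Lambda> (\<Phi> (\<psi> C)))"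
        using add[OF g f(1)] scale[OF \<Phi>[OF \<psi>C(1)]] f(3) insert by simp
      moreover have "?g + f \<in> U" using g f(1) U by (simp add: linear_subspace_def)
      ultimately show ?case by blast
    qed
    then obtain f where f: "f \<in> U" "lincomb a A = f +o W"
      "\<Lambda> f = (\<Sum>C\<in>A. a C * \<Lambda> (\<Phi> (\<psi> C)))" by blast
    have "f +o W = 0 +o W" using f(2) A(3) by (simp add: quotient_space_def)
    then have "\<Lambda> f = 0" using ker coset_eq_iff[OF W, of f 0] by simp
    moreover have "(\<Sum>C\<in>A. a C * \<Lambda> (\<Phi> (\<psi> C))) = a v * \<Lambda> (\<Phi> (\<psi> v))"
    proof -
      have "\<psi> C \<noteq> i" if "C \<in> A - {v}" for C using \<psi>[of C] that i by auto
      then have "(\<Sum>C\<in>A - {v}. a C * \<Lambda> (\<Phi> (\<psi> C))) = 0"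
        using dual(2) \<psi> by (intro sum.neutral) auto
      then show ?thesis using sum.remove[OF A(1,4), of "\<lambda>C. a C * \<Lambda> (\<Phi> (\<psi> C))"] by simp
    qed
    moreover have "\<Lambda> (\<Phi> (\<psi> v)) = \<Lambda> (\<Phi> i)"
      by (rule coset) (use \<psi>[OF A(4)] i \<Phi> in auto)
    ultimately show False using f(3) A(5) dual(1) by simp
  qed
  then show ?thesis using gen B by (simp add: basis_def)
qed

section \<open>The Lie side\<close>

lemma bracket_point_mass:
  "bracket j (point_mass l) (point_mass r) = (point_mass (Node j l r) :: lctree \<Rightarrow> 'k::field)"
proof
  show "bracket j (point_mass l) (point_mass r) T = (point_mass (Node j l r) T :: 'k)" for T
    by (cases T) (auto simp: point_mass_def)
qed

lemma bracketing_eq: "bracketing T = point_mass T"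
  by (induction T) (simp_all add: bracket_point_mass)

lemma bracket_simps:
  "bracket j (f + g) h = bracket j f h + bracket j g h"
  "bracket j h (f + g) = bracket j h f + bracket j h g"
  "bracket j (f - g) h = bracket j f h - bracket j g h"
  "bracket j h (f - g) = bracket j h f - bracket j h g"
  "bracket j 0 h = 0" "bracket j h 0 = 0"
  by (rule ext, rename_tac T, case_tac T; simp add: algebra_simps)+

lemma bracket_sum_list:
  "bracket j (sum_list (map f ts)) h = (\<Sum>t\<leftarrow>ts. bracket j (f t) h)"
  "bracket j h (sum_list (map f ts)) = (\<Sum>t\<leftarrow>ts. bracket j h (f t))"
  by (induction ts) (simp_all add: bracket_simps)

lemma bracket_signed_sum:
  "bracket j (signed_sum f ps ns) h = signed_sum (\<lambda>t. bracket j (f t) h) ps ns"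
  "bracket j h (signed_sum f ps ns) = signed_sum (\<lambda>t. bracket j h (f t)) ps ns"
  by (simp_all add: signed_sum_def bracket_simps bracket_sum_list)

lemma point_mass_free_algebra: "T \<in> bracket_monomials n \<Longrightarrow> point_mass T \<in> free_algebra n"
  by (auto simp: point_mass_def free_algebra_def)

lemma bracket_monomials_Node [simp]:
  "Node j l r \<in> bracket_monomials n \<longleftrightarrow>
    1 \<le> j \<and> l \<in> bracket_monomials n \<and> r \<in> bracket_monomials n"
  by (auto simp: bracket_monomials_def)

lemma lie_ideal_diff: "f \<in> lie_ideal n \<Longrightarrow> g \<in> lie_ideal n \<Longrightarrow> f - g \<in> lie_ideal n"
  using linear_subspace_diff[OF linear_subspace_lie_ideal] .

text \<open>Modulo antisymmetry \<open>jacobi_sum\<close> is the negative of the cyclic sum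
  \<open>J\<close> that occurs in the generators. Antisymmetry is used for [[P, Q], S], for [[P, S],
  Q], and for [P, S] inside the bracket with \<open>Q\<close>.\<close>

lemma jacobi_pair_lie_ideal:
  assumes "P \<in> bracket_monomials n" "Q \<in> bracket_monomials n" "S \<in> bracket_monomials n"
    and b: "1 \<le> b" and c: "1 \<le> c"
  shows "jacobi_pair point_mass b c P Q S \<in> (lie_ideal n :: (lctree \<Rightarrow> 'k::field) set)"
proof -
  let ?p = "\<lambda>T. point_mass T :: lctree \<Rightarrow> 'k"
  have free: "?p P \<in> free_algebra n" "?p Q \<in> free_algebra n" "?p S \<in> free_algebra n"
    using assms by (simp_all add: point_mass_free_algebra)
  have anti: "?p (Node j l r) + ?p (Node j r l) \<in> lie_ideal n"
    if "l \<in> bracket_monomials n" "r \<in> bracket_monomials n" "1 \<le> j" for l r j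
    using lie_ideal.antisymmetry[of "?p l" n "?p r" j] that
    by (simp add: point_mass_free_algebra bracket_point_mass)
  have anti2: "?p (Node i x (Node j l r)) + ?p (Node i x (Node j r l)) \<in> lie_ideal n"
    if "l \<in> bracket_monomials n" "r \<in> bracket_monomials n" "x \<in> bracket_monomials n" "1 \<le> j" "1 \<le> i"
    for l r x i j
    using lie_ideal.bracket_left[OF anti[OF that(1,2,4)] point_mass_free_algebra[OF that(3)] that(5)]
    by (simp add: bracket_simps bracket_point_mass)
  define J where "J i j = ?p (rnest j i P Q S) + ?p (rnest j i S P Q) + ?p (rnest j i Q S P)" for i j
  have sum: "jacobi_sum ?p j i P Q S + J i j \<in> lie_ideal n" if "1 \<le> i" "1 \<le> j" for i j
  proof -
    have "jacobi_sum ?p j i P Q S + J i j =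
        (?p (lnest j i P Q S) + ?p (rnest j i S P Q)) - (?p (lnest j i P S Q) + ?p (rnest j i Q P S))
        + (?p (rnest j i Q P S) + ?p (rnest j i Q S P))"
      by (simp add: jacobi_sum_def J_def)
    moreover have "\<dots> \<in> lie_ideal n"
      by (rule lie_ideal.add[OF lie_ideal_diff[OF anti anti] anti2]) (use assms that in auto)
    ultimately show ?thesis by simp
  qed
  show ?thesis
  proof (cases "b = c")
    case True
    have "J b b \<in> lie_ideal n"
      using lie_ideal.jacobi[OF free b] by (simp add: bracket_point_mass J_def)
    then show ?thesis
      using lie_ideal_diff[OF sum[OF b b]] True by (fastforce simp: jacobi_pair_def)
  next
    case False
    have "J b c + J c b \<in> lie_ideal n"
      using lie_ideal.compatibility[OF free b c False] by (simp add: bracket_point_mass J_def ac_simps)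
    with lie_ideal.add[OF sum[OF b c] sum[OF c b]]
    have "(jacobi_sum ?p c b P Q S + J b c) + (jacobi_sum ?p b c P Q S + J c b) -
      (J b c + J c b) \<in> lie_ideal n"
      by (rule lie_ideal_diff)
    then show ?thesis using False by (simp add: jacobi_pair_def algebra_simps)
  qed
qed

lemma straighten_lie_ideal:
  assumes "straighten T ps ns" "T \<in> bracket_monomials n"
  shows "point_mass T - signed_sum point_mass ps ns \<in> (lie_ideal n :: (lctree \<Rightarrow> 'k::field) set)"
  using assms
proof induction
  case (root P Q S b c)
  then have "jacobi_pair point_mass b c P Q S \<in> (lie_ideal n :: (lctree \<Rightarrow> 'k) set)"
    by (intro jacobi_pair_lie_ideal) auto
  then show ?case unfolding jacobi_pair_root .
next
  case (left l ps ns j r)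
  then have "1 \<le> j" "l \<in> bracket_monomials n" "r \<in> bracket_monomials n" by simp_all
  then have "bracket j (point_mass l - signed_sum point_mass ps ns) (point_mass r)
      \<in> (lie_ideal n :: (lctree \<Rightarrow> 'k) set)"
    by (intro lie_ideal.bracket_right point_mass_free_algebra left.IH)
  then show ?case
    unfolding bracket_simps bracket_signed_sum bracket_point_mass signed_sum_map .
next
  case (right r ps ns j l)
  then have "1 \<le> j" "l \<in> bracket_monomials n" "r \<in> bracket_monomials n" by simp_all
  then have "bracket j (point_mass l) (point_mass r - signed_sum point_mass ps ns)
      \<in> (lie_ideal n :: (lctree \<Rightarrow> 'k) set)"
    by (intro lie_ideal.bracket_left point_mass_free_algebra right.IH)
  then show ?case
    unfolding bracket_simps bracket_signed_sum bracket_point_mass signed_sum_map .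
qed

section \<open>Normalization by antisymmetry\<close>

primrec normalize_tree :: "lctree \<Rightarrow> lctree" where
  "normalize_tree (Leaf a) = Leaf a"
| "normalize_tree (Node j l r) =
    (if valency l \<le> valency r then Node j (normalize_tree l) (normalize_tree r)
     else Node j (normalize_tree r) (normalize_tree l))"

primrec flip_sign :: "lctree \<Rightarrow> int" where
  "flip_sign (Leaf a) = 1"
| "flip_sign (Node j l r) =
    (if valency l \<le> valency r then 1 else - 1) * flip_sign l * flip_sign r"

lemma valency_normalize_tree [simp]: "valency (normalize_tree T) = valency T"
  by (induction T) auto

lemma normalize_tree_preserves:
  "mset (labels (normalize_tree T)) = mset (labels T)" "color_count (normalize_tree T) = color_count T"
  "normalized (normalize_tree T)"
  by (induction T) (auto simp: ac_simps)

lemma normalize_tree_in_normal_trees: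
  "T \<in> labeled_trees n \<mu> \<Longrightarrow> normalize_tree T \<in> normal_trees n \<mu>"
  using normalize_tree_preserves[of T]
  by (auto simp: normal_trees_def labeled_trees_iff dest: mset_eq_setD mset_eq_imp_distinct_iff)

lemma normalize_tree_normalized: "normalized T \<Longrightarrow> normalize_tree T = T \<and> flip_sign T = 1"
  by (induction T) auto

text \<open>This serves spanning only, where a sign is harmless, so the sign is left open instead of
  being carried through the induction.\<close>

lemma normalize_tree_lie_ideal:
  assumes "T \<in> bracket_monomials n"
  shows "point_mass T - point_mass (normalize_tree T) \<in> (lie_ideal n :: (lctree \<Rightarrow> 'k::field) set) \<or>
    point_mass T + point_mass (normalize_tree T) \<in> (lie_ideal n :: (lctree \<Rightarrow> 'k) set)"
  using assms
proof (induction T)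
  case (Leaf a)
  have "point_mass (Leaf a) - point_mass (normalize_tree (Leaf a)) = (0 :: lctree \<Rightarrow> 'k)" by simp
  then show ?case using lie_ideal.zero by metis
next
  case (Node j l r)
  let ?p = "\<lambda>T. point_mass T :: lctree \<Rightarrow> 'k" and ?l = "normalize_tree l" and ?r = "normalize_tree r"
  have T: "l \<in> bracket_monomials n" "r \<in> bracket_monomials n" "1 \<le> j" using Node.prems by auto
  have nrm: "normalize_tree T \<in> bracket_monomials n" if "T \<in> bracket_monomials n" for T
    using that by (induction T) auto
  have L: "?p (Node j l r) - ?p (Node j ?l r) \<in> lie_ideal n \<or>
      ?p (Node j l r) + ?p (Node j ?l r) \<in> lie_ideal n"
    using Node.IH(1)[OF T(1)]
  proof (rule disj_forward)
    show "?p (Node j l r) - ?p (Node j ?l r) \<in> lie_ideal n" if "?p l - ?p ?l \<in> lie_ideal n"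
      using lie_ideal.bracket_right[OF that point_mass_free_algebra[OF T(2)] T(3)]
      unfolding bracket_simps bracket_point_mass .
    show "?p (Node j l r) + ?p (Node j ?l r) \<in> lie_ideal n" if "?p l + ?p ?l \<in> lie_ideal n"
      using lie_ideal.bracket_right[OF that point_mass_free_algebra[OF T(2)] T(3)]
      unfolding bracket_simps bracket_point_mass .
  qed
  have R: "?p (Node j ?l r) - ?p (Node j ?l ?r) \<in> lie_ideal n \<or>
      ?p (Node j ?l r) + ?p (Node j ?l ?r) \<in> lie_ideal n"
    using Node.IH(2)[OF T(2)]
  proof (rule disj_forward)
    show "?p (Node j ?l r) - ?p (Node j ?l ?r) \<in> lie_ideal n" if "?p r - ?p ?r \<in> lie_ideal n"
      using lie_ideal.bracket_left[OF that point_mass_free_algebra[OF nrm[OF T(1)]] T(3)]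
      unfolding bracket_simps bracket_point_mass .
    show "?p (Node j ?l r) + ?p (Node j ?l ?r) \<in> lie_ideal n" if "?p r + ?p ?r \<in> lie_ideal n"
      using lie_ideal.bracket_left[OF that point_mass_free_algebra[OF nrm[OF T(1)]] T(3)]
      unfolding bracket_simps bracket_point_mass .
  qed
  have A: "?p (Node j ?l ?r) + ?p (Node j ?r ?l) \<in> lie_ideal n"
    using lie_ideal.antisymmetry[of "?p ?l" n "?p ?r" j] T nrm
    by (simp add: point_mass_free_algebra bracket_point_mass)
  have trans: "x - z \<in> lie_ideal n \<or> x + z \<in> lie_ideal n"
    if "x - y \<in> lie_ideal n \<or> x + y \<in> lie_ideal n" "y - z \<in> lie_ideal n \<or> y + z \<in> lie_ideal n"
    for x y z :: "lctree \<Rightarrow> 'k"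
    using that lie_ideal.add[of "x - y" n "y - z"] lie_ideal.add[of "x - y" n "y + z"]
      lie_ideal_diff[of "x + y" n "y - z"] lie_ideal_diff[of "x + y" n "y + z"] by auto
  show ?case
    unfolding normalize_tree.simps using trans[OF L R] trans[OF trans[OF L R] disjI2[OF A]]
    by (cases "valency l \<le> valency r") (simp_all only: if_True if_False)
qed

section \<open>Functionals that vanish on the Lie ideal\<close>

definition pairing :: "('x \<Rightarrow> 'k::field) \<Rightarrow> ('x \<Rightarrow> 'k) \<Rightarrow> 'k" where
  "pairing \<phi> f = (\<Sum>T | f T \<noteq> 0. f T * \<phi> T)"

lemma pairing_superset:
  assumes "finite A" "{T. f T \<noteq> 0} \<subseteq> A"
  shows "pairing \<phi> f = (\<Sum>T\<in>A. f T * \<phi> T)"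
  unfolding pairing_def using assms by (intro sum.mono_neutral_left) auto

text \<open>Over an infinite support the sum is 0 by convention, hence the finiteness hypotheses;
  elements of the free algebra satisfy them.\<close>

lemma pairing_add:
  assumes "finite {T. f T \<noteq> 0}" "finite {T. g T \<noteq> 0}"
  shows "pairing \<phi> (f + g) = pairing \<phi> f + pairing \<phi> g"
proof -
  let ?A = "{T. f T \<noteq> 0} \<union> {T. g T \<noteq> 0}"
  have "pairing \<phi> (f + g) = (\<Sum>T\<in>?A. (f + g) T * \<phi> T)"
    by (rule pairing_superset) (use assms in auto)
  also have "\<dots> = (\<Sum>T\<in>?A. f T * \<phi> T) + (\<Sum>T\<in>?A. g T * \<phi> T)"
    by (simp add: distrib_right sum.distrib)
  also have "\<dots> = pairing \<phi> f + pairing \<phi> g"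
    using assms by (subst (1 2) pairing_superset[of ?A]) auto
  finally show ?thesis .
qed

lemma pairing_scale: "pairing \<phi> (\<lambda>x. c * f x) = c * pairing \<phi> f"
  by (cases "c = 0") (simp_all add: pairing_def sum_distrib_left mult.assoc)

lemma pairing_zero [simp]: "pairing \<phi> 0 = 0"
  by (simp add: pairing_def)

lemma pairing_zero_fun [simp]: "pairing (\<lambda>_. 0) f = 0"
  by (simp add: pairing_def)

lemma pairing_add_fun: "pairing (\<lambda>x. \<phi> x + \<psi> x) f = pairing \<phi> f + pairing \<psi> f"
  by (simp add: pairing_def distrib_left sum.distrib)

lemma pairing_point_mass [simp]: "pairing \<phi> (point_mass T) = \<phi> T"
  by (subst pairing_superset[of "{T}"]) (auto simp: point_mass_def)

lemma pairing_swap: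
  "pairing (\<lambda>x. pairing (\<lambda>y. \<phi> x y) g) f = pairing (\<lambda>y. pairing (\<lambda>x. \<phi> x y) f) g"
  unfolding pairing_def sum_distrib_left by (subst sum.swap) (simp add: ac_simps)

lemma pairing_bracket:
  assumes "finite {T. f T \<noteq> 0}" "finite {T. g T \<noteq> 0}"
  shows "pairing \<phi> (bracket j f g) = pairing (\<lambda>l. pairing (\<lambda>r. \<phi> (Node j l r)) g) f"
proof -
  let ?A = "{T. f T \<noteq> 0}" and ?B = "{T. g T \<noteq> 0}" and ?N = "\<lambda>(l, r). Node j l r"
  have "pairing \<phi> (bracket j f g) = (\<Sum>T\<in>?N ` (?A \<times> ?B). bracket j f g T * \<phi> T)"
  proof (rule pairing_superset)
    show "{T. bracket j f g T \<noteq> 0} \<subseteq> ?N ` (?A \<times> ?B)"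
    proof
      fix T assume "T \<in> {T. bracket j f g T \<noteq> 0}"
      then show "T \<in> ?N ` (?A \<times> ?B)" by (cases T) (auto split: if_splits)
    qed
  qed (use assms in simp)
  also have "\<dots> = (\<Sum>(l, r)\<in>?A \<times> ?B. f l * (g r * \<phi> (Node j l r)))"
    by (subst sum.reindex) (auto simp: inj_on_def intro!: sum.cong)
  also have "\<dots> = (\<Sum>l\<in>?A. \<Sum>r\<in>?B. f l * (g r * \<phi> (Node j l r)))"
    by (simp add: sum.cartesian_product)
  finally show ?thesis by (simp add: pairing_def sum_distrib_left)
qed

text \<open>Contexts grow at the hole and not at the root: in an induction over the ideal the
  outermost bracket is removed before the inner ones, and it becomes the node next to the
  hole.\<close>

inductive tree_context :: "(lctree \<Rightarrow> lctree) \<Rightarrow> bool" where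
  hole: "tree_context (\<lambda>t. t)"
| left_hole: "tree_context \<kappa> \<Longrightarrow> tree_context (\<lambda>t. \<kappa> (Node j t r))"
| right_hole: "tree_context \<kappa> \<Longrightarrow> tree_context (\<lambda>t. \<kappa> (Node j l t))"

text \<open>The generators of the ideal take arbitrary algebra elements as arguments, but the
  pairing is multilinear, so each relation need only be checked on monomials, in every
  context.\<close>

lemma lie_ideal_pairing:
  fixes \<phi> :: "lctree \<Rightarrow> 'k::field"
  assumes anti: "\<And>\<kappa> j x y. tree_context \<kappa> \<Longrightarrow> \<phi> (\<kappa> (Node j x y)) + \<phi> (\<kappa> (Node j y x)) = 0"
    and jac: "\<And>\<kappa> j x y z. tree_context \<kappa> \<Longrightarrow>
      \<phi> (\<kappa> (rnest j j x y z)) + \<phi> (\<kappa> (rnest j j z x y)) + \<phi> (\<kappa> (rnest j j y z x)) = 0"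
    and compat: "\<And>\<kappa> i j x y z. tree_context \<kappa> \<Longrightarrow> i \<noteq> j \<Longrightarrow>
      \<phi> (\<kappa> (rnest j i x y z)) + \<phi> (\<kappa> (rnest j i z x y)) + \<phi> (\<kappa> (rnest j i y z x)) +
      \<phi> (\<kappa> (rnest i j x y z)) + \<phi> (\<kappa> (rnest i j z x y)) + \<phi> (\<kappa> (rnest i j y z x)) = 0"
    and f: "f \<in> lie_ideal n" and \<kappa>: "tree_context \<kappa>"
  shows "pairing (\<lambda>T. \<phi> (\<kappa> T)) f = 0"
proof -
  have fin: "finite {T. f T \<noteq> 0}" if "f \<in> free_algebra n" for f :: "lctree \<Rightarrow> 'k"
    using that by (simp add: free_algebra_def)
  have free_add: "f + g \<in> free_algebra n" if "f \<in> free_algebra n" "g \<in> free_algebra n"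
    for f g :: "lctree \<Rightarrow> 'k"
    using that linear_subspace_free_algebra[of n, where 'k = 'k] by (simp add: linear_subspace_def)
  have padd: "pairing \<psi> (f + g) = pairing \<psi> f + pairing \<psi> g"
    if "f \<in> free_algebra n" "g \<in> free_algebra n" for f g :: "lctree \<Rightarrow> 'k" and \<psi>
    by (intro pairing_add fin that)
  have pbracket: "pairing \<psi> (bracket j f g) = pairing (\<lambda>l. pairing (\<lambda>r. \<psi> (Node j l r)) g) f"
    if "f \<in> free_algebra n" "g \<in> free_algebra n" for f g :: "lctree \<Rightarrow> 'k" and \<psi> j
    by (intro pairing_bracket fin that)
  note simps = padd pbracket free_add bracket_in_free_algebra
  \<comment> \<open>The terms of a cyclic sum are paired with \<open>x\<close>, \<open>y\<close>,
    \<open>z\<close> in different orders. \<open>rot1\<close> and \<open>rot2\<close> bring them to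
    one order, so that the functionals can be added.\<close>
  have rot1: "pairing (\<lambda>c. pairing (\<lambda>a. pairing (\<lambda>b. F a b c) y) x) z =
    pairing (\<lambda>a. pairing (\<lambda>b. pairing (\<lambda>c. F a b c) z) y) x"
    for F :: "lctree \<Rightarrow> lctree \<Rightarrow> lctree \<Rightarrow> 'k" and x y z
    by (subst pairing_swap) (subst pairing_swap[of _ y], rule refl)
  have rot2: "pairing (\<lambda>b. pairing (\<lambda>c. pairing (\<lambda>a. F a b c) x) z) y =
    pairing (\<lambda>a. pairing (\<lambda>b. pairing (\<lambda>c. F a b c) z) y) x"
    for F :: "lctree \<Rightarrow> lctree \<Rightarrow> lctree \<Rightarrow> 'k" and x y z
    by (subst pairing_swap[of _ x]) (subst pairing_swap[of _ x y], rule refl)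
  from f \<kappa> show ?thesis
  proof (induction arbitrary: \<kappa>)
    case (antisymmetry x y j)
    have "pairing (\<lambda>T. \<phi> (\<kappa> T)) (bracket j x y + bracket j y x) =
      pairing (\<lambda>a. pairing (\<lambda>b. \<phi> (\<kappa> (Node j a b))) y) x +
      pairing (\<lambda>b. pairing (\<lambda>a. \<phi> (\<kappa> (Node j b a))) x) y"
      using antisymmetry by (simp add: simps)
    also have "\<dots> = pairing (\<lambda>a. pairing (\<lambda>b. \<phi> (\<kappa> (Node j a b)) + \<phi> (\<kappa> (Node j b a))) y) x"
      by (subst (2) pairing_swap) (simp add: pairing_add_fun)
    also have "\<dots> = 0" using anti[OF antisymmetry(4)] by simp
    finally show ?case .
  next
    case (jacobi x y z j)
    let ?F = "pairing (\<lambda>a. pairing (\<lambda>b. pairing (\<lambda>c. \<phi> (\<kappa> (rnest j j a b c))) z) y) x +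
      pairing (\<lambda>a. pairing (\<lambda>b. pairing (\<lambda>c. \<phi> (\<kappa> (rnest j j c a b))) z) y) x +
      pairing (\<lambda>a. pairing (\<lambda>b. pairing (\<lambda>c. \<phi> (\<kappa> (rnest j j b c a))) z) y) x"
    have "pairing (\<lambda>T. \<phi> (\<kappa> T))
      (bracket j x (bracket j y z) + bracket j z (bracket j x y) + bracket j y (bracket j z x)) = ?F"
      using jacobi(1-4) by (simp add: simps rot1[of _ y x z] rot2[of _ x z y])
    also have "?F = 0" using jac[OF jacobi(5)] by (simp flip: pairing_add_fun)
    finally show ?case .
  next
    case (compatibility x y z i j)
    let ?F = "\<lambda>i j. pairing (\<lambda>a. pairing (\<lambda>b. pairing (\<lambda>c. \<phi> (\<kappa> (rnest j i a b c))) z) y) x +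
      pairing (\<lambda>a. pairing (\<lambda>b. pairing (\<lambda>c. \<phi> (\<kappa> (rnest j i c a b))) z) y) x +
      pairing (\<lambda>a. pairing (\<lambda>b. pairing (\<lambda>c. \<phi> (\<kappa> (rnest j i b c a))) z) y) x"
    have "pairing (\<lambda>T. \<phi> (\<kappa> T))
      (bracket i x (bracket j y z) + bracket i z (bracket j x y) + bracket i y (bracket j z x) +
       bracket j x (bracket i y z) + bracket j z (bracket i x y) + bracket j y (bracket i z x)) =
       ?F i j + ?F j i"
      using compatibility(1-5) by (simp add: simps rot1[of _ y x z] rot2[of _ x z y])
    also have "\<dots> = 0"
      using compat[OF compatibility(7,6)] by (simp flip: pairing_add_fun add.assoc)
    finally show ?case .
  next
    case zero
    show ?case by (rule pairing_zero)
  next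
    case (add f g)
    then show ?case
      using fin[OF subsetD[OF lie_ideal_subset_free_algebra]] by (subst pairing_add) auto
  next
    case (scale f c)
    then show ?case by (simp add: pairing_scale)
  next
    case (bracket_left f x j)
    then show ?case
      using lie_ideal_subset_free_algebra[of n, where 'k = 'k] right_hole
      by (subst pairing_bracket) (auto intro: fin)
  next
    case (bracket_right f x j)
    then show ?case
      using lie_ideal_subset_free_algebra[of n, where 'k = 'k] left_hole
      by (subst pairing_bracket, blast intro: fin, blast intro: fin, subst pairing_swap) (auto intro: fin)
  qed
qed

lemma invariant_context:
  assumes "tree_context \<kappa>" "\<And>T. invariant_at N T"
  shows "invariant_at (\<lambda>t. N (\<kappa> t)) T"
  using assms(1)
proof (induction arbitrary: T)
  case hole
  then show ?case using assms(2) by simp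
next
  case (left_hole \<kappa> j r)
  show ?case using invariant_left[OF left_hole.IH] .
next
  case (right_hole \<kappa> j l)
  show ?case using invariant_right[OF right_hole.IH] .
qed

text \<open>Which ancestors of the hole are flipped depends on the inserted tree only through its
  valency, so one context and one sign serve all trees of that valency.\<close>

lemma normalize_tree_context:
  assumes "tree_context \<kappa>"
  shows "\<exists>\<kappa>' s. tree_context \<kappa>' \<and> (\<forall>T. valency T = v \<longrightarrow>
    normalize_tree (\<kappa> T) = \<kappa>' (normalize_tree T) \<and> flip_sign (\<kappa> T) = s * flip_sign T)"
  using assms
proof (induction arbitrary: v)
  case hole
  show ?case by (intro exI[of _ "\<lambda>t. t"] exI[of _ 1]) (simp add: tree_context.hole)
next
  case (left_hole \<kappa> j r)
  obtain \<kappa>' s where \<kappa>': "tree_context \<kappa>'" "\<And>T. valency T = min v (valency r) \<Longrightarrow>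
    normalize_tree (\<kappa> T) = \<kappa>' (normalize_tree T) \<and> flip_sign (\<kappa> T) = s * flip_sign T"
    using left_hole.IH by blast
  show ?case
  proof (cases "v \<le> valency r")
    case True
    then show ?thesis
      using tree_context.left_hole[OF \<kappa>'(1), of j "normalize_tree r"] \<kappa>'(2)
      by (intro exI[of _ "\<lambda>t. \<kappa>' (Node j t (normalize_tree r))"] exI[of _ "s * flip_sign r"]) auto
  next
    case False
    then show ?thesis
      using tree_context.right_hole[OF \<kappa>'(1), of j "normalize_tree r"] \<kappa>'(2)
      by (intro exI[of _ "\<lambda>t. \<kappa>' (Node j (normalize_tree r) t)"] exI[of _ "- s * flip_sign r"]) auto
  qed
next
  case (right_hole \<kappa> j l)
  obtain \<kappa>' s where \<kappa>': "tree_context \<kappa>'" "\<And>T. valency T = min (valency l) v \<Longrightarrow>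
    normalize_tree (\<kappa> T) = \<kappa>' (normalize_tree T) \<and> flip_sign (\<kappa> T) = s * flip_sign T"
    using right_hole.IH by blast
  show ?case
  proof (cases "valency l \<le> v")
    case True
    then show ?thesis
      using tree_context.right_hole[OF \<kappa>'(1), of j "normalize_tree l"] \<kappa>'(2)
      by (intro exI[of _ "\<lambda>t. \<kappa>' (Node j (normalize_tree l) t)"] exI[of _ "s * flip_sign l"]) auto
  next
    case False
    then show ?thesis
      using tree_context.left_hole[OF \<kappa>'(1), of j "normalize_tree l"] \<kappa>'(2)
      by (intro exI[of _ "\<lambda>t. \<kappa>' (Node j t (normalize_tree l))"] exI[of _ "- s * flip_sign l"]) auto
  qed
qed

lemma tree_context_labels:
  assumes "tree_context \<kappa>"
  shows "mset (labels t) = mset (labels t') \<Longrightarrow> color_count t = color_count t' \<Longrightarrow>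
    mset (labels (\<kappa> t)) = mset (labels (\<kappa> t')) \<and> color_count (\<kappa> t) = color_count (\<kappa> t')"
    and "distinct (labels (\<kappa> t)) \<Longrightarrow> distinct (labels t)"
proof -
  show "mset (labels t) = mset (labels t') \<Longrightarrow> color_count t = color_count t' \<Longrightarrow>
      mset (labels (\<kappa> t)) = mset (labels (\<kappa> t')) \<and> color_count (\<kappa> t) = color_count (\<kappa> t')"
    using assms by (induction arbitrary: t t') auto
  show "distinct (labels (\<kappa> t)) \<Longrightarrow> distinct (labels t)"
    using assms by (induction arbitrary: t) fastforce+
qed

text \<open>The relations preserve labels and color counts, so they are compatible with the value 0
  outside the component of \<mu>. Inside it siblings have different valencies, and exchanging them
  really changes the sign.\<close>

definition antisymmetric_extension :: "(lctree \<Rightarrow> int) \<Rightarrow> nat \<Rightarrow> (nat \<Rightarrow> nat) \<Rightarrow> lctree \<Rightarrow> int" where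
  "antisymmetric_extension N n \<mu> T =
    (if T \<in> labeled_trees n \<mu> then flip_sign T * N (normalize_tree T) else 0)"

lemma labeled_trees_cong:
  assumes "mset (labels t) = mset (labels t')" "color_count t = color_count t'"
  shows "t \<in> labeled_trees n \<mu> \<longleftrightarrow> t' \<in> labeled_trees n \<mu>"
  using mset_eq_setD[OF assms(1)] mset_eq_imp_distinct_iff[OF assms(1)] assms(2)
  by (simp add: labeled_trees_iff)

lemma antisymmetric_extension_swap:
  assumes \<kappa>: "tree_context \<kappa>"
  shows "antisymmetric_extension N n \<mu> (\<kappa> (Node j x y)) + antisymmetric_extension N n \<mu> (\<kappa> (Node j y x)) = 0"
proof -
  have iff: "\<kappa> (Node j x y) \<in> labeled_trees n \<mu> \<longleftrightarrow> \<kappa> (Node j y x) \<in> labeled_trees n \<mu>"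
    using tree_context_labels(1)[OF \<kappa>, of "Node j x y" "Node j y x"]
    by (intro labeled_trees_cong) (auto simp: ac_simps)
  show ?thesis
  proof (cases "\<kappa> (Node j x y) \<in> labeled_trees n \<mu>")
    case True
    have "distinct (labels (Node j x y))"
      by (rule tree_context_labels(2)[OF \<kappa>]) (use True in \<open>simp add: labeled_trees_iff\<close>)
    then have neq: "valency x \<noteq> valency y" using valency_neq[of x y] by simp
    obtain \<kappa>' s where \<kappa>': "\<And>T. valency T = min (valency x) (valency y) \<Longrightarrow>
        normalize_tree (\<kappa> T) = \<kappa>' (normalize_tree T) \<and> flip_sign (\<kappa> T) = s * flip_sign T"
      using normalize_tree_context[OF \<kappa>] by metis
    have "normalize_tree (Node j x y) = normalize_tree (Node j y x)"
      "flip_sign (Node j x y) = - flip_sign (Node j y x)" using neq by auto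
    then have "normalize_tree (\<kappa> (Node j x y)) = normalize_tree (\<kappa> (Node j y x))"
      "flip_sign (\<kappa> (Node j x y)) = - flip_sign (\<kappa> (Node j y x))"
      using \<kappa>'[of "Node j x y"] \<kappa>'[of "Node j y x"] by (simp_all add: min.commute)
    then show ?thesis
      using True iff by (simp add: antisymmetric_extension_def)
  next
    case False
    then show ?thesis using iff by (simp add: antisymmetric_extension_def)
  qed
qed

text \<open>The sum \<open>K\<close> is alternating in \<open>x\<close>, \<open>y\<close>,
  \<open>z\<close>, so the arguments may be sorted by valency. The trees of
  \<open>jacobi_pair\<close> then need no flip at the two nodes of the relation, and
  \<open>K\<close> is a multiple of a relation that \<open>N\<close> respects.\<close>

lemma antisymmetric_extension_jacobi:
  fixes N :: "lctree \<Rightarrow> int" and n :: nat and \<mu> :: "nat \<Rightarrow> nat"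
  assumes N: "\<And>T. invariant_at N T" and \<kappa>: "tree_context \<kappa>"
  defines "J \<equiv> \<lambda>i j x y z. antisymmetric_extension N n \<mu> (\<kappa> (rnest j i x y z)) +
    antisymmetric_extension N n \<mu> (\<kappa> (rnest j i z x y)) +
    antisymmetric_extension N n \<mu> (\<kappa> (rnest j i y z x))"
  shows "(if i = j then J i i x y z else J i j x y z + J j i x y z) = 0"
proof -
  let ?e = "\<lambda>T. antisymmetric_extension N n \<mu> (\<kappa> T)"
  define K where "K x y z = (if i = j then J i i x y z else J i j x y z + J j i x y z)" for x y z
  have anti: "?e (Node j l r) = - ?e (Node j r l)" for j l r
    using antisymmetric_extension_swap[OF \<kappa>, of N n \<mu> j l r] by simp
  have anti2: "?e (Node i x (Node j l r)) = - ?e (Node i x (Node j r l))" for i j x l r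
    using antisymmetric_extension_swap[OF tree_context.right_hole[OF \<kappa>], of N n \<mu> i x j l r] by simp
  have rot: "K x y z = K y z x" for x y z by (simp add: K_def J_def)
  have flip: "K x y z = - K y x z" for x y z
    using anti2[of _ x _ y z] anti2[of _ y _ z x] anti2[of _ z _ x y] by (simp add: K_def J_def)
  have J_pair: "K x y z = - jacobi_pair ?e i j x y z" for x y z
  proof -
    have "J i j x y z = - jacobi_sum ?e j i x y z" for i j
      using anti[of i "Node j x y" z] anti[of i "Node j x z" y] anti2[of i y j x z]
      by (simp add: J_def jacobi_sum_def)
    then show ?thesis by (auto simp: K_def jacobi_pair_def)
  qed
  have sorted: "K x y z = 0" if v: "valency x < valency y" "valency y < valency z" for x y z
  proof -
    have v': "valency x < valency z" using v by simp
    obtain \<kappa>' s where \<kappa>': "tree_context \<kappa>'" "\<And>T. valency T = valency x \<Longrightarrow>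
        normalize_tree (\<kappa> T) = \<kappa>' (normalize_tree T) \<and> flip_sign (\<kappa> T) = s * flip_sign T"
      using normalize_tree_context[OF \<kappa>] by metis
    have 0: "jacobi_pair (\<lambda>T. N (\<kappa>' T)) i j (normalize_tree x) (normalize_tree y) (normalize_tree z) = 0"
      by (rule invariant_root) (use v invariant_context[OF \<kappa>'(1) N] in auto)
    \<comment> \<open>All trees of the relation have the same labels and colors, so either all of
      them lie in the component of \<mu> or none does.\<close>
    define X where "X = (\<kappa> (lnest i j x y z) \<in> labeled_trees n \<mu>)"
    have X: "(\<kappa> t \<in> labeled_trees n \<mu>) = X" if "mset (labels t) = mset (labels (lnest i j x y z))"
      "color_count t = color_count (lnest i j x y z)" for t
      unfolding X_def using tree_context_labels(1)[OF \<kappa> that] by (intro labeled_trees_cong) auto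
    define k where "k = (if X then s * flip_sign x * flip_sign y * flip_sign z else 0)"
    have e: "?e t = k * N (\<kappa>' (normalize_tree t))"
      if "t \<in> {lnest b c x y z, lnest b c x z y, rnest b c x y z}" "b = i \<and> c = j \<or> b = j \<and> c = i"
      for t b c
    proof -
      have "(\<kappa> t \<in> labeled_trees n \<mu>) = X" by (rule X) (use that in \<open>auto simp: ac_simps\<close>)
      moreover have "valency t = valency x" "flip_sign t = flip_sign x * flip_sign y * flip_sign z"
        using that v by auto
      ultimately show ?thesis
        using \<kappa>'(2)[of t] by (simp add: antisymmetric_extension_def k_def)
    qed
    have "jacobi_sum ?e b c x y z =
      k * jacobi_sum (\<lambda>T. N (\<kappa>' T)) b c (normalize_tree x) (normalize_tree y) (normalize_tree z)"
      if "b = i \<and> c = j \<or> b = j \<and> c = i" for b c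
      unfolding jacobi_sum_def e[OF insertI1 that] e[OF insertI2[OF insertI1] that]
        e[OF insertI2[OF insertI2[OF insertI1]] that]
      using v v' by (simp add: right_diff_distrib)
    then have "jacobi_pair ?e i j x y z = k *
      jacobi_pair (\<lambda>T. N (\<kappa>' T)) i j (normalize_tree x) (normalize_tree y) (normalize_tree z)"
      by (simp add: jacobi_pair_def distrib_left)
    then show ?thesis using 0 by (simp add: J_pair)
  qed
  have "K x y z = 0"
  proof (cases "\<kappa> (rnest i j x y z) \<in> labeled_trees n \<mu>")
    case True
    have "distinct (labels (rnest i j x y z))"
      by (rule tree_context_labels(2)[OF \<kappa>]) (use True in \<open>simp add: labeled_trees_iff\<close>)
    then have "valency x \<noteq> valency y" "valency y \<noteq> valency z" "valency x \<noteq> valency z"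
      using valency_neq[of x y] valency_neq[of y z] valency_neq[of x z] by auto
    then consider "valency x < valency y" "valency y < valency z" |
      "valency y < valency z" "valency z < valency x" | "valency z < valency x" "valency x < valency y" |
      "valency y < valency x" "valency x < valency z" | "valency x < valency z" "valency z < valency y" |
      "valency z < valency y" "valency y < valency x"
      by linarith
    then show ?thesis
    proof cases
      case 1
      then show ?thesis by (rule sorted)
    next
      case 2
      then show ?thesis using sorted rot by metis
    next
      case 3
      then show ?thesis using sorted rot by metis
    next
      case 4
      then show ?thesis using sorted[of y x z] flip[of x y z] by simp
    next
      case 5
      then show ?thesis using sorted[of x z y] flip[of x y z] rot[of y x z] by simp
    next
      case 6
      then show ?thesis using sorted[of z y x] flip[of x y z] rot[of z y x] by simp
    qed
  next
    case False
    have "?e t = 0" if "mset (labels t) = mset (labels (rnest i j x y z))"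
      "color_count t = color_count (rnest i j x y z)" for t
      using False labeled_trees_cong[of "\<kappa> t" "\<kappa> (rnest i j x y z)"] tree_context_labels(1)[OF \<kappa> that]
      by (simp add: antisymmetric_extension_def)
    then show ?thesis by (simp add: K_def J_def ac_simps)
  qed
  then show ?thesis by (simp add: K_def)
qed

lemma labeled_trees_bracket_monomials: "labeled_trees n \<mu> \<subseteq> bracket_monomials n"
  by (auto simp: labeled_trees_def bracket_monomials_def)

theorem Lie_basis:
  "vectorspace.basis (class_ring :: 'k::field ring) (Lie n \<mu>) {bracketing_class n T | T. T \<in> Lyn n \<mu>}"
proof -
  let ?A = "free_algebra n :: (lctree \<Rightarrow> 'k) set" and ?I = "lie_ideal n :: (lctree \<Rightarrow> 'k) set"
  let ?p = "\<lambda>T. point_mass T :: lctree \<Rightarrow> 'k"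
  let ?B = "(\<lambda>T. ?p T +o ?I) ` labeled_trees n \<mu>"
  note A = linear_subspace_free_algebra[of n, where 'k = 'k]
    and I = linear_subspace_lie_ideal[of n]
    and IA = lie_ideal_subset_free_algebra[of n, where 'k = 'k]
  interpret vectorspace class_ring "quotient_space ?A ?I" by (rule quotient_space_vectorspace[OF A I IA])
  have pA: "?p T \<in> ?A" if "T \<in> labeled_trees n \<mu>" for T
    using that labeled_trees_bracket_monomials point_mass_free_algebra by blast
  have B: "?B \<subseteq> carrier (quotient_space ?A ?I)"
    using pA by (auto simp: quotient_space_def)
  \<comment> \<open>The carrier of \<open>Lie\<close> is a span inside a quotient. Its preimage
    \<open>U\<close> turns \<open>Lie\<close> into the quotient of \<open>U\<close> by the ideal, to
    which the criterion for bases applies.\<close>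
  define U where "U = {f \<in> ?A. f +o ?I \<in> span ?B}"
  have U: "linear_subspace U" and IU: "?I \<subseteq> U"
    unfolding U_def using span_quotient_space_subset[OF A I IA B] by blast+
  have pU: "?p T \<in> U" if "T \<in> labeled_trees n \<mu>" for T
    using that pA in_own_span[OF B] by (auto simp: U_def)
  have carr: "(\<lambda>f. f +o ?I) ` U = span ?B"
    using span_is_subset2[OF B] by (auto simp: U_def quotient_space_def)
  have classes: "bracketing_class n T = ?p T +o ?I" for T
    by (simp add: bracketing_class_def bracketing_eq)
  have Lie: "Lie n \<mu> = quotient_space U ?I"
    using carr by (simp add: Lie_def free_lie_def classes cong: image_cong) (simp add: quotient_space_def)
  have Lyn_sub: "Lyn n \<mu> \<subseteq> labeled_trees n \<mu>" by (auto simp: Lyn_def)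
  have span: "U \<subseteq> V" if V: "linear_subspace V" and IV: "?I \<subseteq> V" and LV: "?p ` Lyn n \<mu> \<subseteq> V" for V
  proof -
    have V': "linear_subspace (V \<inter> ?A)" using V A by (simp add: linear_subspace_def)
    have Vops: "0 \<in> V" "\<And>f g. f \<in> V \<Longrightarrow> g \<in> V \<Longrightarrow> f + g \<in> V" "\<And>f. f \<in> V \<Longrightarrow> - f \<in> V"
      using V linear_subspace_neg[OF V] by (auto simp: linear_subspace_def)
    have normal: "?p T \<in> V" if "T \<in> normal_trees n \<mu>" for T
    proof (rule normal_trees_span[OF Vops _ _ that])
      show "?p T - signed_sum ?p ps ns \<in> V" if "T \<in> normal_trees n \<mu>" "straighten T ps ns" for T ps ns
        using straighten_lie_ideal[OF that(2), of n] IV that(1) labeled_trees_bracket_monomials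
        by (auto simp: normal_trees_def)
    qed (use LV in auto)
    have "?p T \<in> V" if T: "T \<in> labeled_trees n \<mu>" for T
    proof -
      have N: "?p (normalize_tree T) \<in> V" using T by (intro normal normalize_tree_in_normal_trees)
      have "?p T - ?p (normalize_tree T) \<in> V \<or> ?p T + ?p (normalize_tree T) \<in> V"
        using normalize_tree_lie_ideal[of T n, where 'k = 'k] IV T labeled_trees_bracket_monomials by blast
      then show ?thesis
      proof
        assume "?p T - ?p (normalize_tree T) \<in> V"
        from Vops(2)[OF this N] show ?thesis by simp
      next
        assume "?p T + ?p (normalize_tree T) \<in> V"
        from linear_subspace_diff[OF V this N] show ?thesis by simp
      qed
    qed
    \<comment> \<open>\<open>V\<close> need not lie in the free algebra; its intersection with it
      has a submodule of the quotient as image.\<close>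
    then have "?B \<subseteq> (\<lambda>f. f +o ?I) ` (V \<inter> ?A)" using pA by blast
    then have sp: "span ?B \<subseteq> (\<lambda>f. f +o ?I) ` (V \<inter> ?A)"
      using IV IA by (intro span_is_subset quotient_space_submodule A V' I) auto
    show "U \<subseteq> V"
    proof
      fix f assume "f \<in> U"
      then obtain g where g: "f +o ?I = g +o ?I" "g \<in> V" using sp by (auto simp: U_def)
      then have "f - g \<in> V" using coset_eq_iff[OF I] IV by blast
      from Vops(2)[OF this g(2)] show "f \<in> V" by simp
    qed
  qed
  have "vectorspace.basis class_ring (quotient_space U ?I) {?p T +o ?I | T. T \<in> Lyn n \<mu>}"
  proof (rule quotient_space_basis[OF U I IU])
    fix F assume F: "F \<in> Lyn n \<mu>"
    obtain N :: "lctree \<Rightarrow> int" where N: "\<And>T. invariant_at N T"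
      "\<And>T. (\<nexists>ps ns. straighten T ps ns) \<Longrightarrow> N T = (if T = F then 1 else 0)"
      using invariant_functional[of "\<lambda>T. if T = F then 1 else 0"] by blast
    define \<phi> where "\<phi> T = (of_int (antisymmetric_extension N n \<mu> T) :: 'k)" for T
    have jac: "(if i = j then J i i x y z else J i j x y z + J j i x y z) = 0"
      if "tree_context \<kappa>" "J = (\<lambda>i j x y z. \<phi> (\<kappa> (rnest j i x y z)) + \<phi> (\<kappa> (rnest j i z x y)) +
        \<phi> (\<kappa> (rnest j i y z x)))" for \<kappa> J i j x y z
      using antisymmetric_extension_jacobi[OF N(1) that(1), of i j n \<mu> x y z] that(2)
      by (simp add: \<phi>_def split: if_splits flip: of_int_add)
    have lie: "pairing \<phi> f = 0" if "f \<in> ?I" for f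
    proof (rule lie_ideal_pairing[where \<kappa> = "\<lambda>t. t", OF _ _ _ that hole])
      fix \<kappa> i j x y z assume \<kappa>: "tree_context \<kappa>"
      show "\<phi> (\<kappa> (Node j x y)) + \<phi> (\<kappa> (Node j y x)) = 0"
        unfolding \<phi>_def of_int_add[symmetric] antisymmetric_extension_swap[OF \<kappa>] by simp
      show "\<phi> (\<kappa> (rnest j j x y z)) + \<phi> (\<kappa> (rnest j j z x y)) + \<phi> (\<kappa> (rnest j j y z x)) = 0"
        using jac[OF \<kappa> refl, of j j x y z] by simp
      show "\<phi> (\<kappa> (rnest j i x y z)) + \<phi> (\<kappa> (rnest j i z x y)) + \<phi> (\<kappa> (rnest j i y z x)) +
        \<phi> (\<kappa> (rnest i j x y z)) + \<phi> (\<kappa> (rnest i j z x y)) + \<phi> (\<kappa> (rnest i j y z x)) = 0"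
        if "i \<noteq> j" using jac[OF \<kappa> refl, of i j x y z] that by (simp add: add.assoc)
    qed
    have dual: "pairing \<phi> (?p T) = (if T = F then 1 else 0)" if "T \<in> Lyn n \<mu>" for T
      using that normalize_tree_normalized[of T] N(2)[of T]
      by (auto simp: Lyn_iff normal_trees_def \<phi>_def antisymmetric_extension_def)
    have add: "pairing \<phi> (f + g) = pairing \<phi> f + pairing \<phi> g" if "f \<in> U" "g \<in> U" for f g
      using that by (intro pairing_add) (auto simp: U_def free_algebra_def)
    show "\<exists>\<Lambda>. (\<forall>f\<in>U. \<forall>g\<in>U. \<Lambda> (f + g) = \<Lambda> f + \<Lambda> g) \<and> (\<forall>c. \<forall>f\<in>U. \<Lambda> (\<lambda>x. c * f x) = c * \<Lambda> f) \<and>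
      (\<forall>f\<in>?I. \<Lambda> f = (0::'k)) \<and> \<Lambda> (?p F) \<noteq> 0 \<and> (\<forall>T\<in>Lyn n \<mu>. T \<noteq> F \<longrightarrow> \<Lambda> (?p T) = 0)"
      using add lie dual F by (intro exI[of _ "pairing \<phi>"]) (simp add: pairing_scale)
  qed (use pU Lyn_sub span in auto)
  then show ?thesis by (simp add: Lie classes)
qed

section \<open>Merge sequences\<close>

text \<open>
  A block of a weighted partition is referred to by its minimum. The triple \<open>(a, b, r)\<close> with
  \<open>a < b\<close> stands for merging the blocks with minima \<open>a\<close> and \<open>b\<close>, adding the unit vector of \<open>r\<close> to the weight;
  the minimum of the result is \<open>a\<close> again.
\<close>

type_synonym merge_step = "nat \<times> nat \<times> nat"

abbreviation absorbed :: "merge_step \<Rightarrow> nat" where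
  "absorbed m \<equiv> fst (snd m)"

text \<open>The entry at \<open>b\<close> becomes stale instead of being removed, so such a function
  counts only on the current minima, which \<open>merge_seq\<close> keeps track of.\<close>

fun merge_trees :: "(nat \<Rightarrow> lctree) \<Rightarrow> merge_step \<Rightarrow> nat \<Rightarrow> lctree" where
  "merge_trees \<phi> (a, b, r) = \<phi>(a := Node r (\<phi> a) (\<phi> b))"

abbreviation grow :: "(nat \<Rightarrow> lctree) \<Rightarrow> merge_step list \<Rightarrow> nat \<Rightarrow> lctree" where
  "grow \<equiv> foldl merge_trees"

fun merge_seq :: "nat \<Rightarrow> nat set \<Rightarrow> merge_step list \<Rightarrow> bool" where
  "merge_seq k S [] \<longleftrightarrow> True"
| "merge_seq k S ((a, b, r) # ms) \<longleftrightarrow>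
    a \<in> S \<and> b \<in> S \<and> a < b \<and> r \<in> {1..k} \<and> merge_seq k (S - {b}) ms"

lemma merge_seq_append:
  "merge_seq k S (ms @ ms') \<longleftrightarrow> merge_seq k S ms \<and> merge_seq k (S - absorbed ` set ms) ms'"
  by (induction k S ms rule: merge_seq.induct) (simp_all flip: Diff_insert2)

definition partition_of :: "(nat \<Rightarrow> lctree) \<Rightarrow> nat set \<Rightarrow> wpartition" where
  "partition_of \<phi> S = (\<lambda>a. (set (labels (\<phi> a)), color_count (\<phi> a))) ` S"

definition forest_on :: "nat \<Rightarrow> nat \<Rightarrow> (nat \<Rightarrow> lctree) \<Rightarrow> nat set \<Rightarrow> bool" where
  "forest_on n k \<phi> S \<longleftrightarrow> S \<subseteq> {1..n} \<and>
    (\<forall>a\<in>S. valency (\<phi> a) = a \<and> normalized (\<phi> a) \<and> distinct (labels (\<phi> a)) \<and>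
      supp (color_count (\<phi> a)) \<subseteq> {1..k}) \<and>
    (\<forall>a\<in>S. \<forall>b\<in>S. a \<noteq> b \<longrightarrow> set (labels (\<phi> a)) \<inter> set (labels (\<phi> b)) = {}) \<and>
    (\<Union>a\<in>S. set (labels (\<phi> a))) = {1..n}"

lemma forest_on_Leaf: "forest_on n k Leaf {1..n}"
  by (auto simp: forest_on_def supp_def)

lemma supp_color_count_Node:
  "supp (color_count (Node j l r)) = insert j (supp (color_count l) \<union> supp (color_count r))"
  by (auto simp: supp_def unit_comp_def)

text \<open>Each tree is indexed by its valency, so \<open>a < b\<close> makes the new node
  normalized. This is why maximal chains yield normalized trees.\<close>

lemma forest_on_step:
  assumes \<phi>: "forest_on n k \<phi> S" and m: "a \<in> S" "b \<in> S" "a < b" "r \<in> {1..k}"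
  shows "forest_on n k (merge_trees \<phi> (a, b, r)) (S - {b})"
proof -
  have disj: "set (labels (\<phi> x)) \<inter> set (labels (\<phi> y)) = {}" if "x \<in> S" "y \<in> S" "x \<noteq> y" for x y
    using \<phi> that by (auto simp: forest_on_def)
  have union: "(\<Union>x\<in>S - {b}. set (labels (merge_trees \<phi> (a, b, r) x))) = (\<Union>x\<in>S. set (labels (\<phi> x)))"
  proof (intro equalityI subsetI)
    fix y assume "y \<in> (\<Union>x\<in>S. set (labels (\<phi> x)))"
    then obtain x where x: "x \<in> S" "y \<in> set (labels (\<phi> x))" by blast
    show "y \<in> (\<Union>x\<in>S - {b}. set (labels (merge_trees \<phi> (a, b, r) x)))"
      using x m by (intro UN_I[of "if x = b then a else x"]) auto
  qed (use m in \<open>auto split: if_splits\<close>)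
  show ?thesis
    unfolding forest_on_def union
  proof (intro conjI ballI impI)
    fix x assume x: "x \<in> S - {b}"
    show "valency (merge_trees \<phi> (a, b, r) x) = x" "normalized (merge_trees \<phi> (a, b, r) x)"
      using \<phi> m x by (auto simp: forest_on_def)
    show "distinct (labels (merge_trees \<phi> (a, b, r) x))"
      using \<phi> m x disj[of a b] by (auto simp: forest_on_def)
    show "supp (color_count (merge_trees \<phi> (a, b, r) x)) \<subseteq> {1..k}"
      using \<phi> m x by (auto simp: forest_on_def supp_color_count_Node simp del: color_count_Node)
    fix y assume y: "y \<in> S - {b}" and xy: "x \<noteq> y"
    show "set (labels (merge_trees \<phi> (a, b, r) x)) \<inter> set (labels (merge_trees \<phi> (a, b, r) y)) = {}"
      using disj[of x y] disj[of a y] disj[of b y] disj[of a x] disj[of b x] x y xy m by auto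
  qed (use \<phi> in \<open>auto simp: forest_on_def\<close>)
qed

lemma forest_on_seq:
  assumes "forest_on n k \<phi> S" "merge_seq k S ms"
  shows "forest_on n k (grow \<phi> ms) (S - absorbed ` set ms)"
  using assms
proof (induction k S ms arbitrary: \<phi> rule: merge_seq.induct)
  case (2 k S a b r ms)
  then show ?case using forest_on_step[of n k \<phi> S a b r] by (simp_all flip: Diff_insert2)
qed simp

lemma length_labels: "length (labels T) = Suc (length (internal_nodes T))"
  by (induction T) auto

lemma supp_zero: "supp (\<lambda>_. 0) = {}"
  by (simp add: supp_def)

lemma finite_supp_color_count: "finite (supp (color_count T))"
  by (induction T) (simp_all add: supp_color_count_Node supp_zero del: color_count_Node)

lemma sum_color_count:
  assumes "finite A" "supp (color_count T) \<subseteq> A"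
  shows "(\<Sum>j\<in>A. color_count T j) = length (internal_nodes T)"
  using assms
proof (induction T)
  case (Node j l r)
  then have "j \<in> A" "supp (color_count l) \<subseteq> A" "supp (color_count r) \<subseteq> A"
    by (auto simp: supp_color_count_Node simp del: color_count_Node)
  then show ?case using Node by (simp add: sum.distrib unit_comp_def)
qed simp

lemma partition_of_wpartitions:
  assumes \<phi>: "forest_on n k \<phi> S"
  shows "partition_of \<phi> S \<in> wpartitions n k"
proof -
  have disj: "set (labels (\<phi> x)) \<inter> set (labels (\<phi> y)) = {}" if "x \<in> S" "y \<in> S" "x \<noteq> y" for x y
    using \<phi> that by (auto simp: forest_on_def)
  have blocks: "fst ` partition_of \<phi> S = (\<lambda>a. set (labels (\<phi> a))) ` S"
    by (simp add: partition_of_def image_image)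
  have inj: "inj_on fst (partition_of \<phi> S)"
    using disj by (fastforce simp: inj_on_def partition_of_def)
  have part: "partition_on {1..n} ((\<lambda>a. set (labels (\<phi> a))) ` S)"
  proof (rule partition_onI)
    show "\<Union> ((\<lambda>a. set (labels (\<phi> a))) ` S) = {1..n}" using \<phi> by (simp add: forest_on_def)
    show "disjnt p q" if "p \<in> (\<lambda>a. set (labels (\<phi> a))) ` S" "q \<in> (\<lambda>a. set (labels (\<phi> a))) ` S"
      "p \<noteq> q" for p q using that disj by (auto simp: disjnt_def)
  qed auto
  have "color_count (\<phi> a) \<in> WComp (card (set (labels (\<phi> a))) - 1)"
    "supp (color_count (\<phi> a)) \<subseteq> {1..k}" if "a \<in> S" for a
  proof -
    show s: "supp (color_count (\<phi> a)) \<subseteq> {1..k}" using \<phi> that by (simp add: forest_on_def)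
    have "card (set (labels (\<phi> a))) = Suc (length (internal_nodes (\<phi> a)))"
      using \<phi> that by (simp add: forest_on_def distinct_card length_labels)
    moreover have "color_count (\<phi> a) 0 = 0" using s by (auto simp: supp_def)
    ultimately show "color_count (\<phi> a) \<in> WComp (card (set (labels (\<phi> a))) - 1)"
      by (simp add: WComp_def finite_supp_color_count sum_color_count)
  qed
  then have "\<forall>(B, \<nu>)\<in>partition_of \<phi> S. \<nu> \<in> WComp (card B - 1) \<and> supp \<nu> \<subseteq> {1..k}"
    by (simp add: partition_of_def)
  then show ?thesis
    using inj part unfolding wpartitions_def mem_Collect_eq blocks by blast
qed

lemma partition_of_step:
  assumes \<phi>: "forest_on n k \<phi> S" and m: "a \<in> S" "b \<in> S" "a \<noteq> b"
  shows "partition_of (merge_trees \<phi> (a, b, r)) (S - {b}) =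
    merge (partition_of \<phi> S) (set (labels (\<phi> a)), color_count (\<phi> a))
      (set (labels (\<phi> b)), color_count (\<phi> b)) r"
proof -
  let ?B = "\<lambda>\<phi> a. (set (labels (\<phi> a)), color_count (\<phi> a))"
  have neq: "?B \<phi> x \<noteq> ?B \<phi> y" if "x \<in> S" "y \<in> S" "x \<noteq> y" for x y
  proof -
    have "set (labels (\<phi> x)) \<inter> set (labels (\<phi> y)) = {}" using \<phi> that by (auto simp: forest_on_def)
    then show ?thesis by auto
  qed
  have "partition_of (merge_trees \<phi> (a, b, r)) (S - {b}) =
      insert (?B (merge_trees \<phi> (a, b, r)) a) (?B \<phi> ` (S - {a, b}))"
  proof -
    have "S - {b} = insert a (S - {a, b})" using m by auto
    moreover have "?B (merge_trees \<phi> (a, b, r)) ` (S - {a, b}) = ?B \<phi> ` (S - {a, b})"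
      by (intro image_cong) auto
    ultimately show ?thesis unfolding partition_of_def by (simp only: image_insert)
  qed
  also have "?B \<phi> ` (S - {a, b}) = partition_of \<phi> S - {?B \<phi> a, ?B \<phi> b}"
    using m neq by (auto simp: partition_of_def)
  finally show ?thesis
    by (simp only: merge_trees.simps merge.simps fun_upd_same labels.simps set_append color_count_Node)
qed

lemma wcover_step:
  assumes \<phi>: "forest_on n k \<phi> S" and m: "a \<in> S" "b \<in> S" "a < b" "r \<in> {1..k}"
  shows "wcover n k (partition_of \<phi> S) (partition_of (merge_trees \<phi> (a, b, r)) (S - {b}))"
proof -
  have "set (labels (\<phi> a)) \<inter> set (labels (\<phi> b)) = {}" using \<phi> m by (auto simp: forest_on_def)
  then have neq: "(set (labels (\<phi> a)), color_count (\<phi> a)) \<noteq> (set (labels (\<phi> b)), color_count (\<phi> b))"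
    by auto
  have "(set (labels (\<phi> x)), color_count (\<phi> x)) \<in> partition_of \<phi> S" if "x \<in> S" for x
    using that by (simp add: partition_of_def)
  then show ?thesis
    unfolding wcover_def using partition_of_wpartitions[OF \<phi>]
      partition_of_wpartitions[OF forest_on_step[OF \<phi> m]] partition_of_step[OF \<phi> m(1,2), of r] m neq
    by blast
qed

lemma wcover_partition_of:
  assumes \<phi>: "forest_on n k \<phi> S" and cov: "wcover n k (partition_of \<phi> S) \<beta>"
  shows "\<exists>a b r. a \<in> S \<and> b \<in> S \<and> a < b \<and> r \<in> {1..k} \<and>
    \<beta> = partition_of (merge_trees \<phi> (a, b, r)) (S - {b})"
proof -
  let ?B = "\<lambda>a. (set (labels (\<phi> a)), color_count (\<phi> a))"
  obtain a b r where ab: "a \<in> S" "b \<in> S" "a \<noteq> b" "r \<in> {1..k}"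
    and \<beta>: "\<beta> = merge (partition_of \<phi> S) (?B a) (?B b) r"
    using cov unfolding wcover_def partition_of_def by blast
  have sym: "merge (partition_of \<phi> S) (?B a) (?B b) r = merge (partition_of \<phi> S) (?B b) (?B a) r"
    by (simp add: Un_commute add.commute insert_commute)
  show ?thesis
  proof (cases "a < b")
    case True
    then show ?thesis using ab \<beta> partition_of_step[OF \<phi> ab(1-3), of r] by metis
  next
    case False
    then show ?thesis using ab \<beta> sym partition_of_step[OF \<phi> ab(2,1), of r] by (metis linorder_neqE_nat)
  qed
qed

lemma partition_of_eq:
  assumes \<phi>: "forest_on n k \<phi> S" and \<psi>: "forest_on n k \<psi> R" and eq: "partition_of \<phi> S = partition_of \<psi> R"
  shows "S = R" and "a \<in> S \<Longrightarrow> set (labels (\<phi> a)) = set (labels (\<psi> a)) \<and> color_count (\<phi> a) = color_count (\<psi> a)"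
proof -
  have mins: "(\<lambda>P. Min (fst P)) ` partition_of \<phi> S = S" if "forest_on n k \<phi> S" for \<phi> S
  proof -
    have "Min (set (labels (\<phi> a))) = a" if "a \<in> S" for a
      using \<open>forest_on n k \<phi> S\<close> that by (simp add: forest_on_def valency_def)
    then show ?thesis by (force simp: partition_of_def image_image)
  qed
  show "S = R" using mins[OF \<phi>] mins[OF \<psi>] eq by simp
  assume a: "a \<in> S"
  then have "(set (labels (\<phi> a)), color_count (\<phi> a)) \<in> partition_of \<psi> R"
    unfolding eq[symmetric] by (simp add: partition_of_def)
  then obtain b where b: "b \<in> R" "set (labels (\<phi> a)) = set (labels (\<psi> b))"
    "color_count (\<phi> a) = color_count (\<psi> b)" by (auto simp: partition_of_def)
  then have "valency (\<phi> a) = valency (\<psi> b)" by (simp add: valency_def)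
  then have "a = b" using \<phi> \<psi> a b(1) by (simp add: forest_on_def)
  then show "set (labels (\<phi> a)) = set (labels (\<psi> a)) \<and> color_count (\<phi> a) = color_count (\<psi> a)"
    using b by simp
qed

lemma partition_of_cong:
  assumes "\<And>a. a \<in> S \<Longrightarrow> set (labels (\<phi> a)) = set (labels (\<psi> a)) \<and> color_count (\<phi> a) = color_count (\<psi> a)"
  shows "partition_of \<phi> S = partition_of \<psi> S"
  using assms by (auto simp: partition_of_def intro!: image_cong)

lemma forest_on_label_iff:
  assumes "forest_on n k \<phi> S" "a \<in> S" "b \<in> S"
  shows "b \<in> set (labels (\<phi> a)) \<longleftrightarrow> a = b"
proof -
  have "b \<in> set (labels (\<phi> b))" using assms valency_in_labels[of "\<phi> b"] by (simp add: forest_on_def)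
  moreover have "set (labels (\<phi> a)) \<inter> set (labels (\<phi> b)) = {}" if "a \<noteq> b"
    using assms that by (auto simp: forest_on_def)
  ultimately show ?thesis by auto
qed

lemma unit_comp_eq_iff [simp]: "unit_comp r = unit_comp s \<longleftrightarrow> r = s"
proof
  assume "unit_comp r = unit_comp s"
  then have "unit_comp r r = unit_comp s r" by simp
  then show "r = s" by (simp add: unit_comp_def split: if_splits)
qed simp

text \<open>A cover reveals its step: \<open>b\<close> is the minimum that disappears,
  \<open>a\<close> is the minimum of the block that now contains \<open>b\<close>, and the weight of
  this block gives \<open>r\<close>. The two forests may consist of different trees; only their
  partitions agree.\<close>

lemma merge_step_unique:
  assumes \<phi>: "forest_on n k \<phi> S" and \<psi>: "forest_on n k \<psi> S" and eq: "partition_of \<phi> S = partition_of \<psi> S"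
    and m: "a \<in> S" "b \<in> S" "a < b" "r \<in> {1..k}" and m': "a' \<in> S" "b' \<in> S" "a' < b'" "r' \<in> {1..k}"
    and eq': "partition_of (merge_trees \<phi> (a, b, r)) (S - {b}) =
      partition_of (merge_trees \<psi> (a', b', r')) (S - {b'})"
  shows "(a, b, r) = (a', b', r')"
proof -
  note same = partition_of_eq(2)[OF \<phi> \<psi> eq]
  note f = forest_on_step[OF \<phi> m] and f' = forest_on_step[OF \<psi> m']
  have "S - {b} = S - {b'}" using partition_of_eq(1)[OF f f' eq'] .
  then have bb: "b = b'" using m m' by blast
  have a: "a \<in> S - {b}" using m by auto
  have "b \<in> set (labels (merge_trees \<phi> (a, b, r) a))"
    using valency_in_labels[of "\<phi> b"] \<phi> m by (simp add: forest_on_def)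
  then have "b \<in> set (labels (merge_trees \<psi> (a', b', r') a))"
    by (simp only: partition_of_eq(2)[OF f f' eq' a])
  then have aa: "a = a'" using forest_on_label_iff[OF \<psi>, of a b] m by (simp split: if_splits)
  have "color_count (merge_trees \<phi> (a, b, r) a) = color_count (merge_trees \<psi> (a', b', r') a)"
    using partition_of_eq(2)[OF f f' eq' a] by blast
  then have "unit_comp r = unit_comp r'" using same[of a] same[of b] m aa bb by simp
  then show ?thesis using aa bb by simp
qed

section \<open>Partitions reached by merge sequences\<close>

definition level :: "nat \<Rightarrow> merge_step list \<Rightarrow> wpartition" where
  "level n ms = partition_of (grow Leaf ms) ({1..n} - absorbed ` set ms)"

lemma forest_on_level:
  "merge_seq k {1..n} ms \<Longrightarrow>
    forest_on n k (grow Leaf ms) ({1..n} - absorbed ` set ms)"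
  by (rule forest_on_seq[OF forest_on_Leaf])

lemma merge_seq_absorbed:
  assumes "merge_seq k S ms"
  shows "absorbed ` set ms \<subseteq> S" "distinct (map absorbed ms)"
proof -
  have "absorbed ` set ms \<subseteq> S \<and> distinct (map absorbed ms)"
    using assms by (induction k S ms rule: merge_seq.induct) auto
  then show "absorbed ` set ms \<subseteq> S" "distinct (map absorbed ms)" by auto
qed

lemma card_partition_of:
  assumes "forest_on n k \<phi> S"
  shows "card (partition_of \<phi> S) = card S"
  unfolding partition_of_def
proof (rule card_image, rule inj_onI)
  fix x y assume xy: "x \<in> S" "y \<in> S"
    and eq: "(set (labels (\<phi> x)), color_count (\<phi> x)) = (set (labels (\<phi> y)), color_count (\<phi> y))"
  have "y \<in> set (labels (\<phi> x))" using eq forest_on_label_iff[OF assms xy(2,2)] by simp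
  then show "x = y" using forest_on_label_iff[OF assms xy] by simp
qed

lemma card_absorbed: "merge_seq k S ms \<Longrightarrow> card (absorbed ` set ms) = length ms"
  using distinct_card[OF merge_seq_absorbed(2)] by (simp only: set_map length_map)

lemma card_level:
  assumes "merge_seq k {1..n} ms"
  shows "card (level n ms) = n - length ms"
proof -
  note card_absorbed[OF assms]
  moreover have "card ({1..n} - absorbed ` set ms) = card {1..n} - card (absorbed ` set ms)"
    by (rule card_Diff_subset) (use merge_seq_absorbed(1)[OF assms] in auto)
  ultimately show ?thesis
    unfolding level_def card_partition_of[OF forest_on_level[OF assms]] by simp
qed

lemma length_merge_seq:
  assumes "merge_seq k {1..n} ms" "n \<ge> 1"
  shows "length ms \<le> n - 1" "1 \<notin> absorbed ` set ms"
proof -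
  have "0 \<notin> S \<Longrightarrow> 1 \<notin> absorbed ` set ms" if "merge_seq k S ms" for S
    using that by (induction k S ms rule: merge_seq.induct) auto
  then show 1: "1 \<notin> absorbed ` set ms" using assms(1) by auto
  have "absorbed ` set ms \<subseteq> {1..n} - {1}" using merge_seq_absorbed(1)[OF assms(1)] 1 by blast
  then have "card (absorbed ` set ms) \<le> card ({1..n} - {1})" by (intro card_mono) auto
  then show "length ms \<le> n - 1" using assms(2) card_absorbed[OF assms(1)] by simp
qed

lemma level_Nil: "level n [] = wbot n"
  by (auto simp: level_def partition_of_def wbot_def)

lemma level_snoc:
  "level n (ms @ [(a, b, r)]) =
    partition_of (merge_trees (grow Leaf ms) (a, b, r)) ({1..n} - absorbed ` set ms - {b})"
proof -
  have "{1..n} - absorbed ` set (ms @ [(a, b, r)]) = {1..n} - absorbed ` set ms - {b}" by auto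
  then show ?thesis by (simp only: level_def foldl_append foldl_Cons foldl_Nil)
qed

lemma wcover_level:
  assumes "merge_seq k {1..n} (ms @ [m])"
  shows "wcover n k (level n ms) (level n (ms @ [m]))"
proof -
  obtain a b r where m: "m = (a, b, r)" by (cases m)
  show ?thesis
    using assms wcover_step[OF forest_on_level] unfolding m level_snoc
    by (simp add: merge_seq_append level_def)
qed

lemma wcover_level_ex:
  assumes "merge_seq k {1..n} ms" "wcover n k (level n ms) \<beta>"
  shows "\<exists>m. merge_seq k {1..n} (ms @ [m]) \<and> \<beta> = level n (ms @ [m])"
proof -
  obtain a b r where "a \<in> {1..n} - absorbed ` set ms" "b \<in> {1..n} - absorbed ` set ms" "a < b"
    "r \<in> {1..k}" "\<beta> = level n (ms @ [(a, b, r)])"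
    using wcover_partition_of[OF forest_on_level[OF assms(1)] assms(2)[unfolded level_def]]
    unfolding level_snoc by blast
  then show ?thesis using assms(1) by (intro exI[of _ "(a, b, r)"]) (simp add: merge_seq_append)
qed

lemma level_wpartitions: "merge_seq k {1..n} ms \<Longrightarrow> level n ms \<in> wpartitions n k"
  unfolding level_def by (intro partition_of_wpartitions forest_on_level)

lemma wle_level_append:
  assumes "merge_seq k {1..n} (ms @ ms')"
  shows "wle n k (level n ms) (level n (ms @ ms'))"
  using assms
proof (induction ms' rule: rev_induct)
  case Nil
  then show ?case by (simp add: wle_def level_wpartitions)
next
  case (snoc m ms')
  then have "wcover n k (level n (ms @ ms')) (level n ((ms @ ms') @ [m]))"
    by (intro wcover_level) simp
  moreover have "wle n k (level n ms) (level n (ms @ ms'))"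
    using snoc by (simp add: merge_seq_append)
  ultimately show ?case by (auto simp: wle_def intro: rtranclp.rtrancl_into_rtrancl)
qed

text \<open>Applied to the empty sequence, this describes everything above the bottom by merge
  sequences, so that questions about the order become questions about sequences and their
  lengths.\<close>

lemma wle_level_ex:
  assumes "merge_seq k {1..n} ms" "wle n k (level n ms) \<beta>"
  shows "\<exists>ms'. merge_seq k {1..n} (ms @ ms') \<and> \<beta> = level n (ms @ ms')"
proof -
  have "(wcover n k)\<^sup>*\<^sup>* (level n ms) \<beta>" using assms(2) by (simp add: wle_def)
  then show ?thesis
  proof induction
    case base
    show ?case using assms(1) by (intro exI[of _ "[]"]) simp
  next
    case (step \<beta> \<gamma>)
    then obtain ms' where ms': "merge_seq k {1..n} (ms @ ms')" "\<beta> = level n (ms @ ms')" by blast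
    then obtain m where "merge_seq k {1..n} ((ms @ ms') @ [m])" "\<gamma> = level n ((ms @ ms') @ [m])"
      using wcover_level_ex step.hyps(2) by blast
    then show ?case by (intro exI[of _ "ms' @ [m]"]) simp
  qed
qed

lemma wle_take_level:
  assumes "merge_seq k {1..n} ms" "s \<le> t"
  shows "wle n k (level n (take s ms)) (level n (take t ms))"
proof -
  have "take t ms = take s ms @ drop s (take t ms)"
    using assms(2) by (metis append_take_drop_id min.absorb1 take_take)
  moreover have "merge_seq k {1..n} (take t ms)"
    using assms(1) merge_seq_append[of k "{1..n}" "take t ms" "drop t ms"] by simp
  ultimately show ?thesis using wle_level_append by metis
qed

lemma merge_seq_take: "merge_seq k S ms \<Longrightarrow> merge_seq k S (take t ms)"
  using merge_seq_append[of k S "take t ms" "drop t ms"] by simp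

lemma level_determines_step:
  assumes ms: "merge_seq k {1..n} ms" and ms': "merge_seq k {1..n} ms'"
    and t: "t < length ms" "t < length ms'"
    and eq: "level n (take t ms) = level n (take t ms')"
    and eq': "level n (take (Suc t) ms) = level n (take (Suc t) ms')"
  shows "ms ! t = ms' ! t"
proof -
  obtain a b r where m: "ms ! t = (a, b, r)" by (cases "ms ! t")
  obtain a' b' r' where m': "ms' ! t = (a', b', r')" by (cases "ms' ! t")
  let ?S = "{1..n} - absorbed ` set (take t ms)" and ?S' = "{1..n} - absorbed ` set (take t ms')"
  have tk: "take (Suc t) ms = take t ms @ [(a, b, r)]" "take (Suc t) ms' = take t ms' @ [(a', b', r')]"
    using t m m' by (simp_all add: take_Suc_conv_app_nth)
  note f = forest_on_level[OF merge_seq_take[OF ms, of t]]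
  note f' = forest_on_level[OF merge_seq_take[OF ms', of t]]
  have S: "?S = ?S'" using partition_of_eq(1)[OF f f'] eq by (simp only: level_def)
  have c: "a \<in> ?S" "b \<in> ?S" "a < b" "r \<in> {1..k}"
    using merge_seq_take[OF ms, of "Suc t"] unfolding tk by (simp_all add: merge_seq_append)
  have c': "a' \<in> ?S'" "b' \<in> ?S'" "a' < b'" "r' \<in> {1..k}"
    using merge_seq_take[OF ms', of "Suc t"] unfolding tk by (simp_all add: merge_seq_append)
  have "(a, b, r) = (a', b', r')"
    by (rule merge_step_unique[OF f[unfolded S] f' eq[unfolded level_def S] c[unfolded S] c'
          eq'[unfolded tk level_snoc S]])
  then show ?thesis by (simp add: m m')
qed

section \<open>Intervals of length two\<close>

text \<open>The chains that join three blocks with minima p < q < s: any of three pairs can come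
  first, with the colors in either order. Merging \<open>q\<close> and \<open>s\<close> leaves the
  minimum \<open>q\<close>, hence the second step \<open>(p, q, y)\<close>. As this is a set, equal
  colors leave three chains instead of six.\<close>

definition triple_merges :: "nat \<Rightarrow> nat \<Rightarrow> nat \<Rightarrow> nat \<Rightarrow> nat \<Rightarrow> merge_step list set" where
  "triple_merges p q s c d = (\<Union>(x, y)\<in>{(c, d), (d, c)}.
    {[(p, q, x), (p, s, y)], [(p, s, x), (p, q, y)], [(q, s, x), (p, q, y)]})"

text \<open>The block made by the first step has minimum \<open>a\<close>, so the second step
  involves it precisely if \<open>a' = a\<close>, where it is enlarged, or \<open>b' = a\<close>,
  where it is absorbed.\<close>

fun alternatives :: "merge_step \<Rightarrow> merge_step \<Rightarrow> merge_step list set" where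
  "alternatives (a, b, r) (a', b', r') =
    (if a' = a then triple_merges a (min b b') (max b b') r r'
     else if b' = a then triple_merges a' a b r r'
     else {[(a, b, r), (a', b', r')], [(a', b', r'), (a, b, r)]})"

text \<open>The weight of a block remembers only the multiset of colors, so two merges into one
  block are determined up to an exchange of their colors.\<close>

lemma unit_comp_add_eq:
  "(\<forall>x. unit_comp r x + unit_comp r' x = unit_comp s x + unit_comp s' x) \<longleftrightarrow>
    r = s \<and> r' = s' \<or> r = s' \<and> r' = s"
proof
  assume *: "\<forall>x. unit_comp r x + unit_comp r' x = unit_comp s x + unit_comp s' x"
  have "r = s \<or> r = s'"
  proof (rule ccontr)
    assume "\<not> (r = s \<or> r = s')"
    then show False using *[rule_format, of r] by (simp add: unit_comp_def)
  qed
  then show "r = s \<and> r' = s' \<or> r = s' \<and> r' = s"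
  proof
    assume "r = s"
    then have "unit_comp r' = unit_comp s'" using * by (intro ext) simp
    then show ?thesis using \<open>r = s\<close> by simp
  next
    assume "r = s'"
    then have "unit_comp r' = unit_comp s" using * by (intro ext) (simp add: add.commute)
    then show ?thesis using \<open>r = s'\<close> by simp
  qed
qed auto

text \<open>The end partition fixes the set of absorbed minima. The blocks in which these end up
  leave few possibilities for the surviving minima, and the weights settle the colors.\<close>

lemma alternatives_complete:
  assumes \<phi>: "forest_on n k \<phi> S"
    and m: "merge_seq k S [(a, b, r), (a', b', r')]" and w: "merge_seq k S [(c, d, s), (c', d', s')]"
    and eq: "partition_of (grow \<phi> [(c, d, s), (c', d', s')]) (S - {d, d'}) =
      partition_of (grow \<phi> [(a, b, r), (a', b', r')]) (S - {b, b'})"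
  shows "[(c, d, s), (c', d', s')] \<in> alternatives (a, b, r) (a', b', r')"
proof -
  let ?\<psi> = "grow \<phi> [(a, b, r), (a', b', r')]"
  let ?\<chi> = "grow \<phi> [(c, d, s), (c', d', s')]"
  have f: "forest_on n k ?\<psi> (S - {b, b'})"
    using forest_on_seq[OF \<phi> m] by (simp add: insert_commute)
  have f': "forest_on n k ?\<chi> (S - {d, d'})"
    using forest_on_seq[OF \<phi> w] by (simp add: insert_commute)
  have S: "a \<in> S" "b \<in> S" "a < b" "a' \<in> S" "b' \<in> S" "a' < b'" "a' \<noteq> b" "b' \<noteq> b"
    and S': "c \<in> S" "d \<in> S" "c < d" "c' \<in> S" "d' \<in> S" "c' < d'" "c' \<noteq> d" "d' \<noteq> d"
    using m w by auto
  have "S - {d, d'} = S - {b, b'}" using partition_of_eq(1)[OF f' f eq] .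
  then have dd: "{d, d'} = {b, b'}" using S S' by blast
  have labels: "y \<in> set (labels (\<phi> x)) \<longleftrightarrow> x = y" if "x \<in> S" "y \<in> S" for x y
    using forest_on_label_iff[OF \<phi> that] .
  have same: "set (labels (?\<chi> x)) = set (labels (?\<psi> x))" "color_count (?\<chi> x) = color_count (?\<psi> x)"
    if "x \<in> S" "x \<noteq> b" "x \<noteq> b'" for x
    using partition_of_eq(2)[OF f' f eq, of x] that dd by (auto simp: doubleton_eq_iff)
  \<comment> \<open>\<open>z\<close> is the minimum of the final block that contains
    \<open>b\<close>: it is \<open>a\<close>, unless the second step absorbs
    \<open>a\<close>.\<close>
  define z where "z = (if a = b' then a' else a)"
  have z: "z \<in> S" "z \<noteq> b" "z \<noteq> b'" using S by (auto simp: z_def)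
  have "b' \<in> set (labels (?\<psi> a'))" using labels[of b' b'] S by (cases "b' = a") simp_all
  then have 1: "b' \<in> set (labels (?\<chi> a'))" using same(1)[of a'] S by simp
  have "b \<in> set (labels (?\<psi> z))" using labels[of b b] S by (simp add: z_def)
  then have 2: "b \<in> set (labels (?\<chi> z))" using same(1)[of z] z by simp
  have 3: "y \<in> set (labels (?\<chi> x)) \<longleftrightarrow>
      x = y \<or> x = c' \<and> y = d' \<or> y = d \<and> (if c = d' then x = c' else x = c)"
    if "x \<in> S" "y \<in> S" "x \<noteq> d" "x \<noteq> d'" for x y
  proof -
    define \<phi>' where "\<phi>' = merge_trees \<phi> (c, d, s)"
    have "y \<in> set (labels (\<phi>' u)) \<longleftrightarrow> u = y \<or> u = c \<and> y = d" if "u \<in> S" for u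
      using labels[of u y] labels[of d y] that \<open>y \<in> S\<close> S' by (auto simp: \<phi>'_def)
    moreover have "?\<chi> x = (if x = c' then Node s' (\<phi>' c') (\<phi>' d') else \<phi>' x)"
      by (simp add: \<phi>'_def)
    ultimately show ?thesis using that S' by auto
  qed
  \<comment> \<open>The two disjuncts distinguish which of \<open>b\<close> and \<open>b'\<close> is
    absorbed earlier.\<close>
  have G: "d = b \<and> d' = b' \<and> c' = a' \<and> (if c = b' then c' else c) = z \<or>
    d = b' \<and> d' = b \<and> c' = z \<and> (if c = b then c' else c) = a'"
  proof -
    consider "d = b" "d' = b'" | "d = b'" "d' = b" using dd by (auto simp: doubleton_eq_iff)
    then show ?thesis
    proof cases
      case 1
      then show ?thesis
        using \<open>b' \<in> set (labels (?\<chi> a'))\<close> \<open>b \<in> set (labels (?\<chi> z))\<close> 3[of a' b'] 3[of z b] S z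
        by (simp split: if_splits)
    next
      case 2
      then show ?thesis
        using \<open>b' \<in> set (labels (?\<chi> a'))\<close> \<open>b \<in> set (labels (?\<chi> z))\<close> 3[of a' b'] 3[of z b] S z
        by (simp split: if_splits)
    qed
  qed
  have col: "color_count (?\<chi> x) y = color_count (?\<psi> x) y" if "x \<in> S" "x \<noteq> b" "x \<noteq> b'" for x y
    using same(2)[OF that] by simp
  have pair: "s = r \<and> s' = r' \<or> s = r' \<and> s' = r"
    if "\<And>y. unit_comp s y + unit_comp s' y = unit_comp r y + unit_comp r' y"
    using unit_comp_add_eq[of s s' r r'] that by blast
  have single: "u = v" if "\<And>y. unit_comp u y = unit_comp v y" for u v
    using that unit_comp_eq_iff by blast
  consider (1) "d = b" "d' = b'" "c' = a'" "a \<noteq> b'" "c = a" "a' = a"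
    | (2) "d = b" "d' = b'" "c' = a'" "a \<noteq> b'" "c = a" "a' \<noteq> a"
    | (3) "d = b" "d' = b'" "c' = a'" "a \<noteq> b'" "c = b'" "a' = a"
    | (4) "d = b" "d' = b'" "c' = a'" "a = b'" "c = a'"
    | (5) "d = b" "d' = b'" "c' = a'" "a = b'" "c = a"
    | (6) "d = b'" "d' = b" "c' = a" "a \<noteq> b'" "c = a'" "a' = a"
    | (7) "d = b'" "d' = b" "c' = a" "a \<noteq> b'" "c = a'" "a' \<noteq> a"
    | (8) "d = b'" "d' = b" "c' = a" "a \<noteq> b'" "c = b" "a' = a"
    | (9) "d = b'" "d' = b" "c' = a'" "a = b'" "c = a'"
    using G S(3,6,7) S'(3) unfolding z_def by (smt (verit) order_less_asym)
  then show ?thesis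
  proof cases
    case 1
    have "unit_comp s y + unit_comp s' y = unit_comp r y + unit_comp r' y" for y
      using col[of a y] 1 S S' by simp
    from pair[OF this] show ?thesis
      using 1 S S' by (auto simp: triple_merges_def min_def max_def)
  next
    case 2
    have "unit_comp s y = unit_comp r y" "unit_comp s' y = unit_comp r' y" for y
      using col[of a y] col[of a' y] 2 S S' by simp_all
    then have "s = r" "s' = r'" by (blast intro: single)+
    then show ?thesis using 2 S S' by simp
  next
    case 3
    have "unit_comp s y + unit_comp s' y = unit_comp r y + unit_comp r' y" for y
      using col[of a y] 3 S S' by simp
    from pair[OF this] show ?thesis
      using 3 S S' by (auto simp: triple_merges_def min_def max_def)
  next
    case 4
    have "unit_comp s y + unit_comp s' y = unit_comp r y + unit_comp r' y" for y
      using col[of a' y] 4 S S' by simp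
    from pair[OF this] show ?thesis
      using 4 S S' by (auto simp: triple_merges_def min_def max_def)
  next
    case 5
    have "unit_comp s y + unit_comp s' y = unit_comp r y + unit_comp r' y" for y
      using col[of a' y] 5 S S' by simp
    from pair[OF this] show ?thesis
      using 5 S S' by (auto simp: triple_merges_def min_def max_def)
  next
    case 6
    have "unit_comp s y + unit_comp s' y = unit_comp r y + unit_comp r' y" for y
      using col[of a y] 6 S S' by simp
    from pair[OF this] show ?thesis
      using 6 S S' by (auto simp: triple_merges_def min_def max_def)
  next
    case 7
    have "unit_comp s' y = unit_comp r y" "unit_comp s y = unit_comp r' y" for y
      using col[of a y] col[of a' y] 7 S S' by simp_all
    then have "s' = r" "s = r'" by (blast intro: single)+
    then show ?thesis using 7 S S' by simp
  next
    case 8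
    have "unit_comp s y + unit_comp s' y = unit_comp r y + unit_comp r' y" for y
      using col[of a y] 8 S S' by simp
    from pair[OF this] show ?thesis
      using 8 S S' by (auto simp: triple_merges_def min_def max_def)
  next
    case 9
    have "unit_comp s y + unit_comp s' y = unit_comp r y + unit_comp r' y" for y
      using col[of a' y] 9 S S' by simp
    from pair[OF this] show ?thesis
      using 9 S S' by (auto simp: triple_merges_def min_def max_def)
  qed
qed

lemma alternatives_sound:
  assumes \<phi>: "forest_on n k \<phi> S" and m: "merge_seq k S [(a, b, r), (a', b', r')]"
    and v: "v \<in> alternatives (a, b, r) (a', b', r')"
  shows "merge_seq k S v" "absorbed ` set v = {b, b'}" "length v = 2"
    "partition_of (grow \<phi> v) (S - {b, b'}) =
      partition_of (grow \<phi> [(a, b, r), (a', b', r')]) (S - {b, b'})"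
proof -
  show "merge_seq k S v" "absorbed ` set v = {b, b'}" "length v = 2"
    using m v by (auto simp: triple_merges_def min_def max_def split: if_splits)
  have neq: "a \<noteq> b" "a' \<noteq> b'" "a' \<noteq> b" "b' \<noteq> b" using m by auto
  consider (same) "a' = a" | (nested) "b' = a" "a' \<noteq> a" | (disjoint) "b' \<noteq> a" "a' \<noteq> a" by blast
  then show "partition_of (grow \<phi> v) (S - {b, b'}) =
      partition_of (grow \<phi> [(a, b, r), (a', b', r')]) (S - {b, b'})"
  proof cases
    case same
    from v same have "v \<in> triple_merges a (min b b') (max b b') r r'" by simp
    then show ?thesis
      using same neq by (cases "b < b'")
        (auto simp: triple_merges_def ac_simps intro!: partition_of_cong)
  next
    case nested
    from v nested have "v \<in> triple_merges a' a b r r'" by simp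
    then show ?thesis
      using nested neq by (auto simp: triple_merges_def ac_simps intro!: partition_of_cong)
  next
    case disjoint
    then have "v = [(a, b, r), (a', b', r')] \<or> v = [(a', b', r'), (a, b, r)]" using v by simp
    then show ?thesis
      using disjoint neq by (auto intro!: partition_of_cong)
  qed
qed

section \<open>Maximal chains\<close>

text \<open>
  The sign of the order in which the minima of blocks are absorbed, as in the Chevalley--Eilenberg
  differential. With this sign the chains through an interval of length two add up to a Jacobi or
  compatibility relation of the trees they build.
\<close>

primrec inv_sign :: "nat list \<Rightarrow> int" where
  "inv_sign [] = 1"
| "inv_sign (x # xs) = (- 1) ^ length (filter (\<lambda>y. y < x) xs) * inv_sign xs"

lemma inv_sign_swap:
  assumes "x \<noteq> y"
  shows "inv_sign (us @ x # y # ws) = - inv_sign (us @ y # x # ws)"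
proof (induction us)
  case Nil
  then show ?case using assms by auto
qed simp

lemma inv_sign_square [simp]: "inv_sign xs * inv_sign xs = 1"
  by (induction xs) (simp_all add: power_mult_distrib[symmetric] mult.assoc mult.left_commute)

definition tree_of :: "merge_step list \<Rightarrow> lctree" where
  "tree_of ms = grow Leaf ms 1"

definition full_seqs :: "nat \<Rightarrow> nat \<Rightarrow> (nat \<Rightarrow> nat) \<Rightarrow> merge_step list set" where
  "full_seqs n k \<mu> = {ms. merge_seq k {1..n} ms \<and> length ms = n - 1 \<and> level n ms = wtop n \<mu>}"

lemma full_active:
  assumes "merge_seq k {1..n} ms" "length ms = n - 1" "n \<ge> 1"
  shows "{1..n} - absorbed ` set ms = {1}"
proof -
  have "1 \<in> {1..n} - absorbed ` set ms" using length_merge_seq(2)[OF assms(1,3)] assms(3) by simp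
  moreover have "card ({1..n} - absorbed ` set ms) = 1"
    using card_Diff_subset[OF _ merge_seq_absorbed(1)[OF assms(1)]] card_absorbed[OF assms(1)] assms(2,3)
    by simp
  ultimately show ?thesis using card_1_singletonE by (metis singletonD)
qed

lemma full_seqs_iff:
  assumes "n \<ge> 1"
  shows "ms \<in> full_seqs n k \<mu> \<longleftrightarrow>
    merge_seq k {1..n} ms \<and> length ms = n - 1 \<and> color_count (tree_of ms) = \<mu>"
proof -
  have "level n ms = wtop n \<mu> \<longleftrightarrow> color_count (tree_of ms) = \<mu>"
    if ms: "merge_seq k {1..n} ms" "length ms = n - 1"
  proof -
    note act = full_active[OF ms assms]
    have "set (labels (grow Leaf ms 1)) = {1..n}"
      using forest_on_level[OF ms(1)] unfolding act by (simp add: forest_on_def)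
    then show ?thesis unfolding level_def act partition_of_def wtop_def tree_of_def by simp
  qed
  then show ?thesis by (auto simp: full_seqs_def)
qed

lemma tree_of_normal_trees:
  assumes "ms \<in> full_seqs n k \<mu>" "n \<ge> 1"
  shows "tree_of ms \<in> normal_trees n \<mu>"
proof -
  have ms: "merge_seq k {1..n} ms" "length ms = n - 1" "color_count (tree_of ms) = \<mu>"
    using assms(1) by (simp_all add: full_seqs_iff[OF assms(2)])
  note act = full_active[OF ms(1,2) assms(2)]
  have f: "distinct (labels (tree_of ms))" "normalized (tree_of ms)" "set (labels (tree_of ms)) = {1..n}"
    "supp (color_count (tree_of ms)) \<subseteq> {1..k}"
    using forest_on_level[OF ms(1)] unfolding act by (simp_all add: forest_on_def tree_of_def)
  then have "color_count (tree_of ms) 0 = 0" by (auto simp: supp_def)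
  then show ?thesis using f ms(3) by (auto simp: normal_trees_def labeled_trees_iff)
qed

lemma finite_full_seqs: "finite (full_seqs n k \<mu>)"
proof (rule finite_subset)
  have "set ms \<subseteq> S \<times> S \<times> {1..k}" if "merge_seq k S ms" for S ms
    using that
  proof (induction k S ms rule: merge_seq.induct)
    case (2 k S a b r ms)
    then have "set ms \<subseteq> (S - {b}) \<times> (S - {b}) \<times> {1..k}" by simp
    also have "\<dots> \<subseteq> S \<times> S \<times> {1..k}" by blast
    finally show ?case using 2 by simp
  qed simp
  then show "full_seqs n k \<mu> \<subseteq> {ms. set ms \<subseteq> {1..n} \<times> {1..n} \<times> {1..k} \<and> length ms = n - 1}"
    unfolding full_seqs_def by blast
  show "finite {ms. set ms \<subseteq> {1..n} \<times> {1..n} \<times> {1..k} \<and> length ms = n - 1}"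
    by (rule finite_lists_length_eq) simp
qed

text \<open>Level t is the partition after t merges: level 0 is the bottom, level n - 1 the top, and
  the levels from 1 to n - 2 are the vertices of the face.\<close>

definition chain_of :: "nat \<Rightarrow> merge_step list \<Rightarrow> wpartition set" where
  "chain_of n ms = (\<lambda>t. level n (take t ms)) ` {1..<n - 1}"

definition ridge_of :: "nat \<Rightarrow> nat \<Rightarrow> merge_step list \<Rightarrow> wpartition set" where
  "ridge_of n t ms = (\<lambda>t. level n (take t ms)) ` ({1..<n - 1} - {t})"

lemma card_level_take:
  assumes "ms \<in> full_seqs n k \<mu>" "t \<le> n - 1"
  shows "card (level n (take t ms)) = n - t"
  using assms card_level[OF merge_seq_take] by (auto simp: full_seqs_def)

lemma inj_on_level:
  assumes "ms \<in> full_seqs n k \<mu>"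
  shows "inj_on (\<lambda>t. level n (take t ms)) {0..n - 1}"
proof (rule inj_onI)
  fix s t assume "s \<in> {0..n - 1}" "t \<in> {0..n - 1}" "level n (take s ms) = level n (take t ms)"
  moreover from this have "n - s = n - t" using card_level_take[OF assms] by (metis atLeastAtMost_iff)
  ultimately show "s = t" by auto
qed

lemma level_eq_of_image:
  assumes ms: "ms \<in> full_seqs n k \<mu>" and ms': "ms' \<in> full_seqs n k \<mu>" and A: "A \<subseteq> {0..n - 1}"
    and eq: "(\<lambda>t. level n (take t ms)) ` A = (\<lambda>t. level n (take t ms')) ` A" and t: "t \<in> A"
  shows "level n (take t ms) = level n (take t ms')"
proof -
  obtain s where s: "s \<in> A" "level n (take t ms) = level n (take s ms')" using eq t by blast
  have "s \<le> n - 1" "t \<le> n - 1" using s(1) t A by auto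
  moreover from this have "n - t = n - s"
    using s(2) card_level_take[OF ms, of t] card_level_take[OF ms', of s] by simp
  ultimately have "s = t" by simp
  then show ?thesis using s by simp
qed

lemma level_take_end:
  assumes "ms \<in> full_seqs n k \<mu>" "ms' \<in> full_seqs n k \<mu>"
  shows "level n (take 0 ms) = level n (take 0 ms')"
    "level n (take (n - 1) ms) = level n (take (n - 1) ms')"
  using assms by (auto simp: full_seqs_def)

lemma ridge_of_eqD:
  assumes ms: "ms \<in> full_seqs n k \<mu>" and ms': "ms' \<in> full_seqs n k \<mu>"
    and eq: "ridge_of n t ms = ridge_of n t ms'" and s: "s \<le> n - 1" "s \<noteq> t"
  shows "level n (take s ms) = level n (take s ms')"
proof -
  have A: "{1..<n - 1} - {t} \<subseteq> {0..n - 1}" by auto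
  consider "s = 0" | "s = n - 1" | "s \<in> {1..<n - 1} - {t}" using s by fastforce
  then show ?thesis
  proof cases
    case 3
    then show ?thesis using level_eq_of_image[OF ms ms' A eq[unfolded ridge_of_def]] by blast
  qed (use level_take_end[OF ms ms'] in auto)
qed

lemma chain_of_inj:
  assumes ms: "ms \<in> full_seqs n k \<mu>" and ms': "ms' \<in> full_seqs n k \<mu>" and eq: "chain_of n ms = chain_of n ms'"
  shows "ms = ms'"
proof -
  \<comment> \<open>Level n is not a vertex, so omitting it omits nothing, and the lemma on ridges
    covers whole chains as well.\<close>
  have "ridge_of n n ms = ridge_of n n ms'"
  proof -
    have "{1..<n - 1} - {n} = {1..<n - 1}" by auto
    then show ?thesis using eq by (simp only: chain_of_def ridge_of_def)
  qed
  then have lev: "level n (take s ms) = level n (take s ms')" if "s \<le> n - 1" for s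
    using ridge_of_eqD[OF ms ms', of n s] that by (cases "n = 0") (auto simp: full_seqs_def)
  have m: "merge_seq k {1..n} ms" "merge_seq k {1..n} ms'" "length ms = n - 1" "length ms' = n - 1"
    using ms ms' by (simp_all add: full_seqs_def)
  show ?thesis
  proof (rule nth_equalityI)
    fix s assume "s < length ms"
    then show "ms ! s = ms' ! s"
      using lev[of s] lev[of "Suc s"] m by (intro level_determines_step[OF m(1,2)]) auto
  qed (simp add: m)
qed

lemma partition_of_foldl_cong:
  assumes "forest_on n k \<phi> S" "forest_on n k \<psi> S" "partition_of \<phi> S = partition_of \<psi> S" "merge_seq k S w"
  shows "partition_of (grow \<phi> w) (S - absorbed ` set w) =
    partition_of (grow \<psi> w) (S - absorbed ` set w)"
  using assms
proof (induction k S w arbitrary: \<phi> \<psi> rule: merge_seq.induct)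
  case (2 k S a b r w)
  have m: "a \<in> S" "b \<in> S" "a < b" "r \<in> {1..k}" "merge_seq k (S - {b}) w" using 2 by simp_all
  have "partition_of (merge_trees \<phi> (a, b, r)) (S - {b}) = partition_of (merge_trees \<psi> (a, b, r)) (S - {b})"
    using partition_of_eq(2)[OF 2(2,3,4)] m(1,2) by (intro partition_of_cong) auto
  from 2(1)[OF forest_on_step[OF 2(2) m(1-4)] forest_on_step[OF 2(3) m(1-4)] this m(5)]
  moreover have "S - absorbed ` set ((a, b, r) # w) = S - {b} - absorbed ` set w" by auto
  ultimately show ?case by (simp only: foldl_Cons)
qed simp

lemma grow_cong:
  assumes "merge_seq k S w" "\<And>x. x \<in> S \<Longrightarrow> \<phi> x = \<psi> x" "x \<in> S - absorbed ` set w"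
  shows "grow \<phi> w x = grow \<psi> w x"
  using assms
proof (induction k S w arbitrary: \<phi> \<psi> rule: merge_seq.induct)
  case (2 k S a b r w)
  have "grow (merge_trees \<phi> (a, b, r)) w x = grow (merge_trees \<psi> (a, b, r)) w x"
    using 2(2-) by (intro 2(1)) auto
  then show ?case by simp
qed simp

text \<open>The later merges put the tree at \<open>p\<close> into a fixed context, and
  \<open>z\<close> is the one minimum that remains.\<close>

lemma invariant_merge_tail:
  assumes "\<And>T. invariant_at N T" "merge_seq k S w" "p \<in> S" "S - absorbed ` set w = {z}"
  shows "invariant_at (\<lambda>T. N (grow (\<phi>(p := T)) w z)) T"
  using assms(2-)
proof (induction k S w arbitrary: \<phi> p T rule: merge_seq.induct)
  case (1 k S)
  then show ?case using assms(1) by simp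
next
  case (2 k S a b r w \<phi> p T)
  have m: "a \<in> S - {b}" "b \<in> S" "a \<noteq> b" "merge_seq k (S - {b}) w" "S - {b} - absorbed ` set w = {z}"
    using 2 by (auto simp flip: Diff_insert2)
  consider "p = a" | "p = b" | "p \<noteq> a" "p \<noteq> b" by blast
  then show ?case
  proof cases
    case 1
    have "invariant_at (\<lambda>T. N (grow (\<phi>(a := T)) w z)) (Node r T (\<phi> b))"
      by (rule 2(1)[OF m(4,1,5)])
    note inv = invariant_left[OF this]
    have "merge_trees (\<phi>(p := T)) (a, b, r) = \<phi>(a := Node r T (\<phi> b))" for T
      using 1 m(3) by (simp add: fun_eq_iff)
    then show ?thesis using inv by (simp only: foldl_Cons)
  next
    case b: 2
    have "invariant_at (\<lambda>T. N (grow (\<phi>(a := T)) w z)) (Node r (\<phi> a) T)"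
      by (rule 2(1)[OF m(4,1,5)])
    note inv = invariant_right[OF this]
    \<comment> \<open>The two forests differ only in the stale entry at \<open>b\<close>, which is
      no current minimum any more.\<close>
    have "grow (merge_trees (\<phi>(p := T)) (a, b, r)) w z =
        grow (\<phi>(a := Node r (\<phi> a) T)) w z" for T
      by (rule grow_cong[OF m(4)]) (use b m in auto)
    then show ?thesis using inv by (simp only: foldl_Cons)
  next
    case 3
    have "p \<in> S - {b}" using 3 2(3) by simp
    note inv = 2(1)[OF m(4) this m(5), of "\<phi>(a := Node r (\<phi> a) (\<phi> b))" T]
    have "merge_trees (\<phi>(p := T)) (a, b, r) = (\<phi>(a := Node r (\<phi> a) (\<phi> b)))(p := T)" for T
      using 3 by (simp add: fun_eq_iff)
    then show ?thesis using inv by (simp only: foldl_Cons)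
  qed
qed

lemma sum_triple_merges:
  fixes G :: "merge_step list \<Rightarrow> 'a::comm_monoid_add"
  assumes "p < q" "q < s"
  defines "g \<equiv> \<lambda>x y. G [(p, q, x), (p, s, y)] + G [(p, s, x), (p, q, y)] + G [(q, s, x), (p, q, y)]"
  shows "(\<Sum>v\<in>triple_merges p q s c d. G v) = (if c = d then g c c else g c d + g d c)"
proof (cases "c = d")
  case True
  then show ?thesis using assms by (simp add: triple_merges_def add.assoc)
next
  case False
  have "triple_merges p q s c d =
    {[(p, q, c), (p, s, d)], [(p, s, c), (p, q, d)], [(q, s, c), (p, q, d)],
     [(p, q, d), (p, s, c)], [(p, s, d), (p, q, c)], [(q, s, d), (p, q, c)]}"
    by (auto simp: triple_merges_def)
  then show ?thesis using assms False by (simp add: add.assoc)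
qed

text \<open>A facet over the ridge agrees with the given one in all levels but \<open>t\<close>. So
  all steps agree except the one into and the one out of level \<open>t\<close>, and these two run
  through the same interval of length two.\<close>

lemma same_ridge_seqs:
  assumes ms: "u @ [m, m'] @ w \<in> full_seqs n k \<mu>" (is "?ms \<in> _") and t: "t = Suc (length u)"
  shows "{ms' \<in> full_seqs n k \<mu>. ridge_of n t ms' = ridge_of n t ?ms} =
    (\<lambda>v. u @ v @ w) ` alternatives m m'" (is "?L = ?R")
proof -
  obtain a b r where m: "m = (a, b, r)" by (cases m)
  obtain a' b' r' where m': "m' = (a', b', r')" by (cases m')
  let ?\<phi> = "grow Leaf u" and ?S = "{1..n} - absorbed ` set u"
  have seq: "merge_seq k {1..n} u" "merge_seq k ?S [m, m']"
    "merge_seq k (?S - absorbed ` set [m, m']) w"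
    and len: "length u + length w + 2 = n - 1" and top: "level n ?ms = wtop n \<mu>"
    using ms unfolding full_seqs_def mem_Collect_eq merge_seq_append by simp_all
  note f = forest_on_level[OF seq(1)]
  have level2: "level n (u @ v) = partition_of (grow ?\<phi> v) (?S - absorbed ` set v)" for v
    by (simp add: level_def image_Un Diff_Un Diff_Int_distrib2 set_diff_eq)
  have level3: "level n (u @ v @ v') = partition_of (grow (grow ?\<phi> v) v')
      (?S - absorbed ` set v - absorbed ` set v')" for v v'
    by (simp add: level_def image_Un Diff_Un Diff_Int_distrib2 set_diff_eq)
  show ?thesis
  proof (intro equalityI subsetI)
    fix ms' assume "ms' \<in> ?L"
    then have ms': "ms' \<in> full_seqs n k \<mu>" and eq: "ridge_of n t ?ms = ridge_of n t ms'" by auto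
    have lev: "level n (take s ?ms) = level n (take s ms')" if "s \<le> n - 1" "s \<noteq> t" for s
      by (rule ridge_of_eqD[OF ms ms' eq that])
    have q: "merge_seq k {1..n} ms'" "length ms' = n - 1" "merge_seq k {1..n} ?ms" "length ?ms = n - 1"
      using ms ms' len by (simp_all add: full_seqs_def)
    have nth: "?ms ! s = ms' ! s" if "s < n - 1" "s \<noteq> t" "Suc s \<noteq> t" for s
      using that q by (intro level_determines_step[OF q(3,1)] lev) auto
    have "take (length u) ms' = u"
    proof (rule nth_equalityI)
      fix i assume "i < length (take (length u) ms')"
      then have i: "i < length u" by simp
      then have "i < n - 1" using len by simp
      from nth[OF this] i t show "take (length u) ms' ! i = u ! i" by (simp add: nth_append)
    qed (use len q in simp)
    moreover have "drop (length u + 2) ms' = w"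
    proof (rule nth_equalityI)
      fix i assume "i < length (drop (length u + 2) ms')"
      then have "length u + 2 + i < n - 1" using q by simp
      from nth[OF this] q t show "drop (length u + 2) ms' ! i = w ! i"
        by (simp add: nth_append)
    qed (use len q in simp)
    moreover obtain x y where xy: "take 2 (drop (length u) ms') = [x, y]"
    proof -
      have "length (take 2 (drop (length u) ms')) = 2" using len q by simp
      then show ?thesis using that unfolding numeral_2_eq_2 length_Suc_conv length_0_conv by blast
    qed
    moreover have "ms' = take (length u) ms' @ take 2 (drop (length u) ms') @ drop (length u + 2) ms'"
      using append_take_drop_id[of 2 "drop (length u) ms'"] by (simp add: add.commute)
    ultimately have split: "ms' = u @ [x, y] @ w" by simp
    obtain c d s c' d' s' where x: "x = (c, d, s)" and y: "y = (c', d', s')" by (cases x; cases y)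
    have "take (length u + 2) ?ms = u @ [m, m']" "take (length u + 2) ms' = u @ [x, y]"
      by (simp_all add: split)
    then have "level n (u @ [m, m']) = level n (u @ [x, y])"
      using lev[of "length u + 2"] len t by simp
    then have "[x, y] \<in> alternatives m m'"
      using alternatives_complete[OF f, of a b r a' b' r' c d s c' d' s'] seq(2) q(1)
      unfolding level2 unfolding split x y m m' merge_seq_append by simp
    then show "ms' \<in> ?R" by (auto simp: split)
  next
    fix ms' assume "ms' \<in> ?R"
    then obtain v where v: "v \<in> alternatives m m'" and split: "ms' = u @ v @ w" by auto
    note snd = alternatives_sound[OF f seq(2)[unfolded m m'] v[unfolded m m']]
    have act: "?S - absorbed ` set v = ?S - absorbed ` set [m, m']"
      by (simp only: snd(2)) (simp add: m m')
    have q: "merge_seq k {1..n} (u @ v @ w)"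
      unfolding merge_seq_append act using seq snd(1) by simp
    have part: "partition_of (grow ?\<phi> v) (?S - absorbed ` set v) =
      partition_of (grow ?\<phi> [m, m']) (?S - absorbed ` set v)"
      using snd(2,4) by (simp add: m m')
    have fv: "forest_on n k (grow ?\<phi> v) (?S - absorbed ` set v)"
      by (rule forest_on_seq[OF f snd(1)])
    have fm: "forest_on n k (grow ?\<phi> [m, m']) (?S - absorbed ` set v)"
      unfolding act by (rule forest_on_seq[OF f seq(2)])
    have tail: "level n (u @ v @ take s w) = level n (u @ [m, m'] @ take s w)" for s
    proof -
      have "merge_seq k (?S - absorbed ` set v) (take s w)"
        unfolding act by (rule merge_seq_take[OF seq(3)])
      from partition_of_foldl_cong[OF fv fm part this] show ?thesis
        unfolding level3 by (simp only: act)
    qed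
    have full: "ms' \<in> full_seqs n k \<mu>"
      using q tail[of "length w"] top len snd(3) by (simp add: full_seqs_def split)
    have "level n (take s ms') = level n (take s ?ms)" if "s \<noteq> t" for s
    proof (cases "s \<le> length u")
      case True
      then show ?thesis by (simp add: split)
    next
      case False
      then have "s \<ge> length u + 2" using that t by simp
      then obtain j where "s = length u + 2 + j" using le_Suc_ex by blast
      then show ?thesis using tail[of j] snd(3) by (simp add: split)
    qed
    then have "ridge_of n t ms' = ridge_of n t ?ms"
      unfolding ridge_of_def by (intro image_cong) auto
    then show "ms' \<in> ?L" using full by simp
  qed
qed

lemma foldl_two_merges:
  assumes "a \<noteq> b" "a \<noteq> b'" "b \<noteq> b'"
  shows "x \<noteq> b \<Longrightarrow> x \<noteq> b' \<Longrightarrow> grow \<phi> [(a, b, r), (a, b', r')] x =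
      (\<phi>(a := lnest r r' (\<phi> a) (\<phi> b) (\<phi> b'))) x"
    and "x \<noteq> b \<Longrightarrow> x \<noteq> b' \<Longrightarrow> grow \<phi> [(b, b', r), (a, b, r')] x =
      (\<phi>(a := rnest r r' (\<phi> a) (\<phi> b) (\<phi> b'))) x"
  using assms by simp_all

text \<open>The coefficient of one ridge in the boundary of the chain with coefficients
  \<open>N\<close>. The sign of omitting level \<open>t\<close> is common to all facets over the
  ridge and is left out.\<close>

lemma ridge_sum_zero:
  fixes N :: "lctree \<Rightarrow> int"
  assumes N: "\<And>T. invariant_at N T" and ms: "ms \<in> full_seqs n k \<mu>" and t: "t \<in> {1..<n - 1}"
  shows "(\<Sum>ms' | ms' \<in> full_seqs n k \<mu> \<and> ridge_of n t ms' = ridge_of n t ms.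
    inv_sign (map absorbed ms') * N (tree_of ms')) = 0"
proof -
  have len: "length ms = n - 1" using ms by (simp add: full_seqs_def)
  define u m m' w where "u = take (t - 1) ms" and "m = ms ! (t - 1)" and "m' = ms ! t"
    and "w = drop (Suc t) ms"
  have split: "ms = u @ [m, m'] @ w" and tu: "t = Suc (length u)"
  proof -
    have "ms = take (t - 1) ms @ ms ! (t - 1) # ms ! t # drop (Suc t) ms"
    proof -
      have "t - 1 < length ms" "t < length ms" "Suc (t - 1) = t" using t len by auto
      then show ?thesis using id_take_nth_drop[of "t - 1" ms] Cons_nth_drop_Suc[of t ms] by simp
    qed
    then show "ms = u @ [m, m'] @ w" by (simp add: u_def m_def m'_def w_def)
    show "t = Suc (length u)" using t len by (auto simp: u_def min_def)
  qed
  obtain a b r where m: "m = (a, b, r)" by (cases m)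
  obtain a' b' r' where m': "m' = (a', b', r')" by (cases m')
  let ?\<phi> = "grow Leaf u" and ?S = "{1..n} - absorbed ` set u"
  have seq: "merge_seq k {1..n} u" "merge_seq k ?S [m, m']"
    "merge_seq k (?S - absorbed ` set [m, m']) w" "merge_seq k {1..n} ms"
    using ms unfolding full_seqs_def mem_Collect_eq split merge_seq_append by simp_all
  note f = forest_on_level[OF seq(1)]
  let ?S2 = "?S - {b, b'}"
  have w: "merge_seq k ?S2 w" using seq(3) by (simp add: m m')
  have z: "?S2 - absorbed ` set w = {1}"
  proof -
    have "{1..n} - absorbed ` set ms = {1}" using t by (intro full_active[OF seq(4) len]) auto
    moreover have "?S2 - absorbed ` set w = {1..n} - absorbed ` set ms" by (auto simp: split m m')
    ultimately show ?thesis by (simp only:)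
  qed
  have S: "a \<in> ?S" "b \<in> ?S" "a < b" "a' \<in> ?S - {b}" "b' \<in> ?S - {b}" "a' < b'"
    using seq(2) by (simp_all add: m m')
  have val: "valency (?\<phi> x) = x" if "x \<in> ?S" for x using f that by (simp add: forest_on_def)
  let ?G = "\<lambda>v. inv_sign (map absorbed (u @ v @ w)) * N (tree_of (u @ v @ w))"
  have tree: "tree_of (u @ v @ w) = grow \<psi> w 1"
    if "\<And>x. x \<in> ?S2 \<Longrightarrow> grow ?\<phi> v x = \<psi> x" for v \<psi>
  proof -
    have one: "1 \<in> ?S2 - absorbed ` set w" unfolding z by simp
    have "grow (grow ?\<phi> v) w 1 = grow \<psi> w 1"
      by (rule grow_cong[OF w _ one]) (rule that)
    then show ?thesis by (simp add: tree_of_def)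
  qed
  have triple: "(\<Sum>v\<in>triple_merges p q s c d. ?G v) = 0"
    if pqs: "p \<in> ?S2" "q \<in> ?S" "s \<in> ?S" "p < q" "q < s" "{q, s} = {b, b'}" for p q s c d
  proof -
    define N' where "N' T = N (grow (?\<phi>(p := T)) w 1)" for T
    have inv: "invariant_at N' T" for T
      unfolding N'_def by (rule invariant_merge_tail[OF N w pqs(1) z])
    have qs: "x \<noteq> q" "x \<noteq> s" if "x \<in> ?S2" for x using that pqs(6) by auto
    let ?P = "?\<phi> p" and ?Q = "?\<phi> q" and ?R = "?\<phi> s"
    \<comment> \<open>The minima are absorbed in the order q, s for [[P, Q], S] and s, q for the
      other two trees. This gives precisely the signs +, -, - of \<open>jacobi_sum\<close>.\<close>
    define \<sigma> where "\<sigma> = inv_sign (map absorbed u @ q # s # map absorbed w)"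
    have \<sigma>': "inv_sign (map absorbed u @ s # q # map absorbed w) = - \<sigma>"
      unfolding \<sigma>_def using pqs(5) by (intro inv_sign_swap) simp
    have neq: "p \<noteq> q" "p \<noteq> s" "q \<noteq> s" "s \<noteq> q" using pqs by auto
    have G1: "?G [(p, q, x), (p, s, y)] = \<sigma> * N' (lnest x y ?P ?Q ?R)" for x y
    proof -
      have "tree_of (u @ [(p, q, x), (p, s, y)] @ w) = grow (?\<phi>(p := lnest x y ?P ?Q ?R)) w 1"
        by (rule tree, rule foldl_two_merges(1)) (use neq qs in auto)
      then show ?thesis by (simp add: \<sigma>_def N'_def)
    qed
    have G2: "?G [(p, s, x), (p, q, y)] = - \<sigma> * N' (lnest x y ?P ?R ?Q)" for x y
    proof -
      have "tree_of (u @ [(p, s, x), (p, q, y)] @ w) = grow (?\<phi>(p := lnest x y ?P ?R ?Q)) w 1"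
        by (rule tree, rule foldl_two_merges(1)) (use neq qs in auto)
      then show ?thesis by (simp add: \<sigma>' N'_def)
    qed
    have G3: "?G [(q, s, x), (p, q, y)] = - \<sigma> * N' (rnest x y ?P ?Q ?R)" for x y
    proof -
      have "tree_of (u @ [(q, s, x), (p, q, y)] @ w) = grow (?\<phi>(p := rnest x y ?P ?Q ?R)) w 1"
        by (rule tree, rule foldl_two_merges(2)) (use neq qs in auto)
      then show ?thesis by (simp add: \<sigma>' N'_def)
    qed
    have "(\<Sum>v\<in>triple_merges p q s c d. ?G v) = \<sigma> * jacobi_pair N' c d ?P ?Q ?R"
      unfolding sum_triple_merges[OF pqs(4,5)] G1 G2 G3
      by (simp add: jacobi_pair_def jacobi_sum_def algebra_simps)
    moreover have "jacobi_pair N' c d ?P ?Q ?R = 0"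
      using pqs by (intro invariant_root inv) (simp_all add: val)
    ultimately show ?thesis by simp
  qed
  have "(\<Sum>v\<in>alternatives m m'. ?G v) = 0"
  proof -
    consider (same) "a' = a" | (nested) "b' = a" "a' \<noteq> a" | (disjoint) "b' \<noteq> a" "a' \<noteq> a" by blast
    then show ?thesis
    proof cases
      case same
      have "(\<Sum>v\<in>triple_merges a (min b b') (max b b') r r'. ?G v) = 0"
        by (rule triple) (use S same in \<open>auto simp: min_def max_def\<close>)
      then show ?thesis using same by (simp add: m m')
    next
      case nested
      have "(\<Sum>v\<in>triple_merges a' a b r r'. ?G v) = 0"
        by (rule triple) (use S nested in auto)
      then show ?thesis using nested by (simp add: m m')
    next
      case disjoint
      have neq: "[m, m'] \<noteq> [m', m]" using disjoint by (simp add: m m')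
      have "tree_of (u @ [m', m] @ w) = grow (grow ?\<phi> [m, m']) w 1"
        by (rule tree) (use S disjoint in \<open>auto simp: m m'\<close>)
      then have "tree_of (u @ [m', m] @ w) = tree_of (u @ [m, m'] @ w)" by (simp add: tree_of_def)
      moreover have "inv_sign (map absorbed (u @ [m', m] @ w)) = - inv_sign (map absorbed (u @ [m, m'] @ w))"
        using inv_sign_swap[of b' b] S by (simp add: m m')
      ultimately have "?G [m, m'] + ?G [m', m] = 0" by simp
      moreover have "alternatives m m' = {[m, m'], [m', m]}" using disjoint by (simp add: m m')
      ultimately show ?thesis using neq by simp
    qed
  qed
  moreover have "{ms' \<in> full_seqs n k \<mu>. ridge_of n t ms' = ridge_of n t ms} =
    (\<lambda>v. u @ v @ w) ` alternatives m m'"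
    using same_ridge_seqs[OF ms[unfolded split] tu] unfolding split .
  ultimately show ?thesis by (simp add: sum.reindex inj_on_def)
qed

section \<open>Faces of the open interval\<close>

lemma wle_levelD:
  assumes "n \<ge> 1" "merge_seq k {1..n} ms" "wle n k (level n ms) \<beta>"
  shows "card \<beta> \<le> card (level n ms)" "card \<beta> = card (level n ms) \<Longrightarrow> \<beta> = level n ms"
    "card \<beta> \<ge> 1"
proof -
  obtain ms' where ms': "merge_seq k {1..n} (ms @ ms')" "\<beta> = level n (ms @ ms')"
    using wle_level_ex[OF assms(2,3)] by blast
  have len: "length ms + length ms' \<le> n - 1" using length_merge_seq(1)[OF ms'(1) assms(1)] by simp
  have c: "card \<beta> = n - (length ms + length ms')" "card (level n ms) = n - length ms"
    using card_level[OF ms'(1)] card_level[OF assms(2)] ms'(2) by simp_all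
  show "card \<beta> \<le> card (level n ms)" "card \<beta> \<ge> 1" using c len assms(1) by auto
  assume "card \<beta> = card (level n ms)"
  then have "length ms' = 0" using c len assms(1) by linarith
  then show "\<beta> = level n ms" using ms'(2) by simp
qed

lemma card_wtop: "card (wtop n \<mu>) = 1"
  by (simp add: wtop_def)

lemma card_wbot: "card (wbot n) = n"
  using card_level[of 0 n "[]"] by (simp add: level_Nil)

lemma open_interval_level:
  assumes n: "n \<ge> 1" and z: "z \<in> open_interval (wle n k) (wbot n) (wtop n \<mu>)"
  obtains ms where "merge_seq k {1..n} ms" "z = level n ms" "card z \<in> {2..n - 1}"
proof -
  have z': "wle n k (level n []) z" "z \<noteq> level n []" "wle n k z (wtop n \<mu>)" "z \<noteq> wtop n \<mu>"
    using z by (auto simp: open_interval_def level_Nil)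
  obtain ms where ms: "merge_seq k {1..n} ms" "z = level n ms"
    using wle_level_ex[OF _ z'(1)] by auto
  have "card z \<noteq> n" using wle_levelD(1,2)[OF n _ z'(1)] z'(2) card_wbot[of n] by (auto simp: level_Nil)
  moreover have "card z \<le> n" using wle_levelD(1)[OF n _ z'(1)] card_wbot[of n] by (simp add: level_Nil)
  moreover have "card z \<noteq> 1"
    using wle_levelD(2)[OF n ms(1), of "wtop n \<mu>"] z'(3,4) ms(2) card_wtop[of n \<mu>] by auto
  moreover have "card z \<ge> 1" using wle_levelD(3)[OF n _ z'(1)] by simp
  ultimately have "card z \<in> {2..n - 1}" by auto
  then show ?thesis using that ms by blast
qed

abbreviation weighted_complex :: "nat \<Rightarrow> nat \<Rightarrow> (nat \<Rightarrow> nat) \<Rightarrow> wpartition set set" where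
  "weighted_complex n k \<mu> \<equiv> interval_complex (wle n k) (wbot n) (wtop n \<mu>)"

text \<open>The number of blocks drops strictly along the order, so a chain has at most one element
  for each number from 2 to n - 1.\<close>

lemma weighted_complexD:
  assumes "n \<ge> 1" "F \<in> weighted_complex n k \<mu>"
  shows "finite F" "inj_on card F" "card ` F \<subseteq> {2..n - 1}" "card F \<le> n - 2"
proof -
  have F: "finite F" "F \<subseteq> open_interval (wle n k) (wbot n) (wtop n \<mu>)"
    "Complete_Partial_Order.chain (wle n k) F"
    using assms(2) by (simp_all add: order_complex_def)
  show "finite F" by (rule F)
  show sub: "card ` F \<subseteq> {2..n - 1}" using F(2) open_interval_level[OF assms(1)] by blast
  have eq: "z = w" if zw: "z \<in> F" "w \<in> F" "card z = card w" "wle n k z w" for z w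
  proof -
    obtain ms where "merge_seq k {1..n} ms" "z = level n ms"
      using open_interval_level[OF assms(1)] zw(1) F(2) by blast
    then show ?thesis using wle_levelD(2)[OF assms(1)] zw by metis
  qed
  show inj: "inj_on card F"
  proof (rule inj_onI)
    fix z w assume zw: "z \<in> F" "w \<in> F" "card z = card w"
    then consider "wle n k z w" | "wle n k w z" using F(3) by (auto simp: chain_def)
    then show "z = w" using eq[of z w] eq[of w z] zw by cases auto
  qed
  have "card F = card (card ` F)" using card_image[OF inj] by simp
  also have "\<dots> \<le> card {2..n - 1}" by (rule card_mono) (use sub in auto)
  finally show "card F \<le> n - 2" by simp
qed

lemma chain_of_weighted_complex:
  assumes "n \<ge> 1" "ms \<in> full_seqs n k \<mu>"
  shows "chain_of n ms \<in> weighted_complex n k \<mu>" "card (chain_of n ms) = n - 2"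
proof -
  have ms: "merge_seq k {1..n} ms" "length ms = n - 1" "level n ms = wtop n \<mu>"
    using assms(2) by (simp_all add: full_seqs_def)
  have inj: "inj_on (\<lambda>t. level n (take t ms)) {1..<n - 1}"
    by (rule inj_on_subset[OF inj_on_level[OF assms(2)]]) auto
  then show "card (chain_of n ms) = n - 2" by (simp add: chain_of_def card_image)
  have "level n (take t ms) \<in> open_interval (wle n k) (wbot n) (wtop n \<mu>)" if t: "t \<in> {1..<n - 1}" for t
  proof -
    have c: "card (level n (take t ms)) = n - t" using t by (intro card_level_take[OF assms(2)]) simp
    have "wle n k (level n (take 0 ms)) (level n (take t ms))"
      "wle n k (level n (take t ms)) (level n (take (n - 1) ms))"
      by (rule wle_take_level[OF ms(1)], use t in simp)+
    then have "wle n k (wbot n) (level n (take t ms))" "wle n k (level n (take t ms)) (wtop n \<mu>)"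
      using ms by (simp_all add: level_Nil)
    moreover have "level n (take t ms) \<noteq> wbot n" "level n (take t ms) \<noteq> wtop n \<mu>"
      using c card_wbot[of n] card_wtop[of n \<mu>] t by auto
    ultimately show ?thesis by (simp add: open_interval_def)
  qed
  moreover have "Complete_Partial_Order.chain (wle n k) (chain_of n ms)"
    unfolding chain_of_def chain_def using wle_take_level[OF ms(1)] nat_le_linear by blast
  ultimately show "chain_of n ms \<in> weighted_complex n k \<mu>"
    by (auto simp: order_complex_def chain_of_def)
qed

lemma WComp_one:
  assumes "\<mu> \<in> WComp 1"
  obtains r where "\<mu> = unit_comp r" "r \<in> supp \<mu>"
proof -
  have fin: "finite (supp \<mu>)" and sum: "(\<Sum>j\<in>supp \<mu>. \<mu> j) = 1" using assms by (simp_all add: WComp_def)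
  then obtain r where r: "r \<in> supp \<mu>" by fastforce
  then have "\<mu> r + (\<Sum>j\<in>supp \<mu> - {r}. \<mu> j) = 1" "\<mu> r \<ge> 1"
    using sum.remove[OF fin r, of \<mu>] sum by (auto simp: supp_def)
  then have "\<mu> r = 1" "(\<Sum>j\<in>supp \<mu> - {r}. \<mu> j) = 0" by linarith+
  then have "\<mu> r = 1" "\<forall>j\<in>supp \<mu> - {r}. \<mu> j = 0" using fin by simp_all
  have "\<mu> = unit_comp r"
  proof
    fix j
    have "\<mu> j = 0" if "j \<noteq> r" "j \<in> supp \<mu>"
      using \<open>\<forall>j\<in>supp \<mu> - {r}. \<mu> j = 0\<close> that by blast
    moreover have "\<mu> j = 0" if "j \<notin> supp \<mu>" using that by (simp add: supp_def)
    ultimately show "\<mu> j = unit_comp r j"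
      using \<open>\<mu> r = 1\<close> unfolding unit_comp_def by metis
  qed
  then show ?thesis using that r by blast
qed

text \<open>A face with n - 2 vertices meets every rank of the open interval, so its consecutive
  elements are joined by a single merge.\<close>

lemma facet_is_chain_of:
  assumes n: "n \<ge> 1" and \<mu>: "\<mu> \<in> WComp (n - 1)" "supp \<mu> \<subseteq> {1..k}"
    and F: "F \<in> weighted_complex n k \<mu>" "card F = n - 2"
  shows "\<exists>ms\<in>full_seqs n k \<mu>. F = chain_of n ms"
proof -
  note FD = weighted_complexD[OF n F(1)]
  \<comment> \<open>For n at most 2 the face is empty and does not show how the top is reached; the
    sequence is then made from \<mu> itself.\<close>
  consider "n = 1" | "n = 2" | "n \<ge> 3" using n by linarith
  then show ?thesis
  proof cases
    case 1
    have "\<mu> = (\<lambda>_. 0)" using \<mu>(1) 1 by (auto simp: WComp_def supp_def fun_eq_iff sum_eq_0_iff)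
    then have "[] \<in> full_seqs n k \<mu>"
      unfolding full_seqs_iff[OF n] using 1 by (simp add: tree_of_def)
    moreover have "F = chain_of n []" using F(2) FD(1) 1 by (simp add: chain_of_def)
    ultimately show ?thesis by blast
  next
    case 2
    then have "\<mu> \<in> WComp 1" using \<mu>(1) by simp
    then obtain r where r: "\<mu> = unit_comp r" "r \<in> {1..k}" using WComp_one \<mu>(2) by blast
    have "[(1, 2, r)] \<in> full_seqs n k \<mu>"
      unfolding full_seqs_iff[OF n] using r 2 by (simp add: tree_of_def fun_eq_iff)
    moreover have "F = chain_of n [(1, 2, r)]" using F(2) FD(1) 2 by (simp add: chain_of_def)
    ultimately show ?thesis by blast
  next
    case 3
    have FI: "F \<subseteq> open_interval (wle n k) (wbot n) (wtop n \<mu>)"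
      and chain: "Complete_Partial_Order.chain (wle n k) F"
      using F(1) by (simp_all add: order_complex_def)
    have "card ` F = {2..n - 1}"
    proof (rule card_subset_eq)
      show "card (card ` F) = card {2..n - 1}" using card_image[OF FD(2)] F(2) 3 by simp
    qed (use FD in auto)
    have "\<forall>t\<in>{1..<n - 1}. \<exists>z\<in>F. card z = n - t"
    proof
      fix t assume "t \<in> {1..<n - 1}"
      then have "n - t \<in> card ` F" unfolding \<open>card ` F = {2..n - 1}\<close> by auto
      then show "\<exists>z\<in>F. card z = n - t" by auto
    qed
    then obtain f where f: "\<And>t. t \<in> {1..<n - 1} \<Longrightarrow> f t \<in> F \<and> card (f t) = n - t" by metis
    define \<alpha> where "\<alpha> t = (if t = 0 then wbot n else if t = n - 1 then wtop n \<mu> else f t)" for t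
    have card_\<alpha>: "card (\<alpha> t) = n - t" if "t \<le> n - 1" for t
      using f[of t] that 3 card_wbot[of n] card_wtop[of n \<mu>] by (auto simp: \<alpha>_def)
    have le: "wle n k (\<alpha> t) (\<alpha> (Suc t))" if t: "Suc t \<le> n - 1" for t
    proof -
      consider "t = 0" | "Suc t = n - 1" "t \<noteq> 0" | "t \<noteq> 0" "Suc t < n - 1" using t by linarith
      then show ?thesis
      proof cases
        case 1
        then have "f 1 \<in> F" using f[of 1] 3 by simp
        then show ?thesis using 1 3 FI by (auto simp: \<alpha>_def open_interval_def)
      next
        case 2
        then have "f t \<in> F" using f[of t] by simp
        then show ?thesis using 2 FI by (auto simp: \<alpha>_def open_interval_def)
      next
        case 3
        then have ft: "f t \<in> F" "f (Suc t) \<in> F" "card (f t) = n - t" "card (f (Suc t)) = n - Suc t"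
          using f[of t] f[of "Suc t"] by auto
        have "\<not> wle n k (f (Suc t)) (f t)"
        proof
          assume *: "wle n k (f (Suc t)) (f t)"
          obtain ms where "merge_seq k {1..n} ms" "f (Suc t) = level n ms"
            using open_interval_level[OF n] ft(2) FI by blast
          then have "card (f t) \<le> card (f (Suc t))" using wle_levelD(1)[OF n] * by metis
          then show False using ft 3 by simp
        qed
        then have "wle n k (f t) (f (Suc t))" using chain ft(1,2) by (auto simp: chain_def)
        then show ?thesis using 3 by (simp add: \<alpha>_def)
      qed
    qed
    have ex: "\<exists>ms. merge_seq k {1..n} ms \<and> length ms = t \<and> (\<forall>s\<le>t. level n (take s ms) = \<alpha> s)"
      if "t \<le> n - 1" for t
      using that
    proof (induction t)
      case 0
      show ?case by (rule exI[of _ "[]"]) (simp add: level_Nil \<alpha>_def)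
    next
      case (Suc t)
      then obtain ms where ms: "merge_seq k {1..n} ms" "length ms = t" "\<forall>s\<le>t. level n (take s ms) = \<alpha> s"
        by auto
      then have "level n ms = \<alpha> t" by auto
      then obtain ms' where ms': "merge_seq k {1..n} (ms @ ms')" "\<alpha> (Suc t) = level n (ms @ ms')"
        using wle_level_ex[OF ms(1)] le[OF Suc.prems] by metis
      have "n - Suc t = n - (t + length ms')"
        using card_\<alpha>[OF Suc.prems] card_level[OF ms'(1)] ms'(2) ms(2) by simp
      moreover have "t + length ms' \<le> n - 1" using length_merge_seq(1)[OF ms'(1) n] ms(2) by simp
      ultimately have "length ms' = 1" using Suc.prems n by linarith
      moreover have "level n (take s (ms @ ms')) = \<alpha> s" if "s \<le> Suc t" for s
      proof (cases "s \<le> t")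
        case True
        then show ?thesis using ms by simp
      next
        case False
        then show ?thesis using that ms(2) ms'(2) \<open>length ms' = 1\<close> by (simp add: le_Suc_eq)
      qed
      ultimately show ?case using ms'(1) ms(2) by (intro exI[of _ "ms @ ms'"]) simp
    qed
    then obtain ms where ms: "merge_seq k {1..n} ms" "length ms = n - 1"
      "\<And>s. s \<le> n - 1 \<Longrightarrow> level n (take s ms) = \<alpha> s" by blast
    have "level n ms = wtop n \<mu>" using ms(3)[of "n - 1"] ms(2) 3 by (simp add: \<alpha>_def)
    then have full: "ms \<in> full_seqs n k \<mu>" using ms by (simp add: full_seqs_def)
    have "chain_of n ms \<subseteq> F"
      using ms(3) f by (auto simp: chain_of_def \<alpha>_def)
    then have "chain_of n ms = F"
      using card_subset_eq[OF FD(1)] chain_of_weighted_complex(2)[OF n full] F(2) by simp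
    then show ?thesis using full by blast
  qed
qed

text \<open>The exponent is t - 1 since the bottom is no vertex of the face, which leaves the levels
  1, ..., t - 1 below level t.\<close>

lemma coboundary_chain_of:
  fixes f :: "wpartition set \<Rightarrow> 'k::field"
  assumes n: "n \<ge> 1" and ms: "ms \<in> full_seqs n k \<mu>"
  shows "coboundary (wle n k) (weighted_complex n k \<mu>) f (chain_of n ms) =
    (\<Sum>t\<in>{1..<n - 1}. (- 1) ^ (t - 1) * f (ridge_of n t ms))"
proof -
  let ?l = "\<lambda>t. level n (take t ms)"
  have q: "merge_seq k {1..n} ms" using ms by (simp add: full_seqs_def)
  have inj: "inj_on ?l {1..<n - 1}"
    by (rule inj_on_subset[OF inj_on_level[OF ms]]) auto
  have le_iff: "wle n k (?l s) (?l t) \<longleftrightarrow> s \<le> t" if "s \<le> n - 1" "t \<le> n - 1" for s t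
  proof
    assume "wle n k (?l s) (?l t)"
    then have "card (?l t) \<le> card (?l s)" by (rule wle_levelD(1)[OF n merge_seq_take[OF q]])
    then show "s \<le> t" using card_level_take[OF ms] that n by simp
  qed (rule wle_take_level[OF q])
  have sign: "card {y \<in> chain_of n ms. wle n k y (?l t) \<and> y \<noteq> ?l t} = t - 1" if t: "t \<in> {1..<n - 1}" for t
  proof -
    have "{y \<in> chain_of n ms. wle n k y (?l t) \<and> y \<noteq> ?l t} = ?l ` {1..<t}"
    proof (intro equalityI subsetI)
      fix y assume "y \<in> {y \<in> chain_of n ms. wle n k y (?l t) \<and> y \<noteq> ?l t}"
      then obtain s where s: "s \<in> {1..<n - 1}" "y = ?l s" "wle n k (?l s) (?l t)" "?l s \<noteq> ?l t"
        unfolding chain_of_def by blast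
      then have "s \<le> t" "s \<noteq> t" using le_iff[of s t] t by auto
      then show "y \<in> ?l ` {1..<t}" using s by auto
    next
      fix y assume "y \<in> ?l ` {1..<t}"
      then obtain s where s: "s \<in> {1..<t}" "y = ?l s" by blast
      then have "?l s \<noteq> ?l t" using inj_onD[OF inj, of s t] t by auto
      then show "y \<in> {y \<in> chain_of n ms. wle n k y (?l t) \<and> y \<noteq> ?l t}"
        using s t le_iff by (auto simp: chain_of_def)
    qed
    moreover have "card (?l ` {1..<t}) = card {1..<t}"
      by (rule card_image[OF inj_on_subset[OF inj]]) (use t in auto)
    ultimately show ?thesis by simp
  qed
  have ridge: "chain_of n ms - {?l t} = ridge_of n t ms" if "t \<in> {1..<n - 1}" for t
    using inj_on_image_set_diff[OF inj, of "{1..<n - 1}" "{t}"] that by (simp add: chain_of_def ridge_of_def)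
  have "coboundary (wle n k) (weighted_complex n k \<mu>) f (chain_of n ms) =
    (\<Sum>x\<in>?l ` {1..<n - 1}. (- 1) ^ card {y \<in> chain_of n ms. wle n k y x \<and> y \<noteq> x} * f (chain_of n ms - {x}))"
    using chain_of_weighted_complex(1)[OF n ms] unfolding coboundary_def chain_of_def by simp
  also have "\<dots> = (\<Sum>t\<in>{1..<n - 1}. (- 1) ^ (t - 1) * f (ridge_of n t ms))"
    unfolding sum.reindex[OF inj] by (intro sum.cong refl) (simp add: sign ridge)
  finally show ?thesis .
qed

section \<open>Merge sequences building a given tree\<close>

definition tree_seq :: "lctree \<Rightarrow> merge_step list" where
  "tree_seq T = map (\<lambda>x. (valency (left x), valency (right x), color x)) (internal_nodes T)"

lemma tree_seq_simps [simp]: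
  "tree_seq (Leaf a) = []"
  "tree_seq (Node j l r) = tree_seq l @ tree_seq r @ [(valency l, valency r, j)]"
  by (simp_all add: tree_seq_def)

text \<open>The quantification over \<phi> and \<open>S\<close> makes the property local: the
  sequence builds \<open>T\<close> from its leaves whatever the surroundings are, and touches
  nothing else. Sequences of disjoint trees can therefore be concatenated.\<close>

definition realizes :: "nat \<Rightarrow> merge_step list \<Rightarrow> lctree \<Rightarrow> bool" where
  "realizes k L T \<longleftrightarrow> absorbed ` set L = set (labels T) - {valency T} \<and>
    (\<forall>\<phi> S. set (labels T) \<subseteq> S \<longrightarrow> (\<forall>a\<in>set (labels T). \<phi> a = Leaf a) \<longrightarrow>
      merge_seq k S L \<and> grow \<phi> L (valency T) = T \<and>
      (\<forall>x. x \<notin> set (labels T) \<longrightarrow> grow \<phi> L x = \<phi> x))"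

lemma realizes_absorbed: "realizes k L T \<Longrightarrow> absorbed ` set L = set (labels T) - {valency T}"
  by (simp add: realizes_def)

lemma realizesD:
  assumes "realizes k L T" "set (labels T) \<subseteq> S" "\<And>a. a \<in> set (labels T) \<Longrightarrow> \<phi> a = Leaf a"
  shows "merge_seq k S L" "grow \<phi> L (valency T) = T"
    "x \<notin> set (labels T) \<Longrightarrow> grow \<phi> L x = \<phi> x"
  using assms unfolding realizes_def by blast+

lemma realizes_two:
  assumes l: "realizes k L l" and r: "realizes k R r" and disj: "set (labels l) \<inter> set (labels r) = {}"
    and S: "set (labels l) \<union> set (labels r) \<subseteq> S"
    and \<phi>: "\<And>a. a \<in> set (labels l) \<union> set (labels r) \<Longrightarrow> \<phi> a = Leaf a"
  shows "merge_seq k S (L @ R)" "grow \<phi> (L @ R) (valency l) = l"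
    "grow \<phi> (L @ R) (valency r) = r"
    "x \<notin> set (labels l) \<union> set (labels r) \<Longrightarrow> grow \<phi> (L @ R) x = \<phi> x"
proof -
  have 1: "set (labels l) \<subseteq> S" "\<And>a. a \<in> set (labels l) \<Longrightarrow> \<phi> a = Leaf a" using S \<phi> by auto
  have S2: "set (labels r) \<subseteq> S - absorbed ` set L"
    using S disj by (auto simp: realizes_absorbed[OF l])
  have \<phi>2: "grow \<phi> L a = Leaf a" if "a \<in> set (labels r)" for a
  proof -
    have "a \<notin> set (labels l)" using that disj by blast
    from realizesD(3)[OF l 1 this] show ?thesis using \<phi>[of a] that by simp
  qed
  note R = realizesD[OF r S2 \<phi>2]
  show "merge_seq k S (L @ R)"
    using realizesD(1)[OF l 1] R(1) by (simp add: merge_seq_append)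
  show "grow \<phi> (L @ R) (valency r) = r" using R(2) by simp
  have "valency l \<notin> set (labels r)" using disj valency_in_labels[of l] by auto
  then show "grow \<phi> (L @ R) (valency l) = l"
    using R(3) realizesD(2)[OF l 1] by simp
  show "grow \<phi> (L @ R) x = \<phi> x" if "x \<notin> set (labels l) \<union> set (labels r)"
    using R(3)[of x] realizesD(3)[OF l 1, of x] that by simp
qed

lemma realizes_Leaf: "realizes k [] (Leaf a)"
  by (simp add: realizes_def)

lemma realizes_Node:
  assumes l: "realizes k L l" and r: "realizes k R r" and disj: "set (labels l) \<inter> set (labels r) = {}"
    and v: "valency l < valency r" and j: "j \<in> {1..k}"
  shows "realizes k (L @ R @ [(valency l, valency r, j)]) (Node j l r)"
  unfolding realizes_def
proof (intro conjI allI impI)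
  have "valency l \<notin> set (labels r)" "valency r \<notin> set (labels l)"
    using disj valency_in_labels[of l] valency_in_labels[of r] by auto
  then show "absorbed ` set (L @ R @ [(valency l, valency r, j)]) =
      set (labels (Node j l r)) - {valency (Node j l r)}"
    using realizes_absorbed[OF l] realizes_absorbed[OF r] v valency_in_labels[of r]
    by (auto simp: image_Un)
next
  fix \<phi> S assume "set (labels (Node j l r)) \<subseteq> S" "\<forall>a\<in>set (labels (Node j l r)). \<phi> a = Leaf a"
  then have S: "set (labels l) \<union> set (labels r) \<subseteq> S"
    and \<phi>: "\<And>a. a \<in> set (labels l) \<union> set (labels r) \<Longrightarrow> \<phi> a = Leaf a" by auto
  note two = realizes_two[OF l r disj S \<phi>]
  have in_l: "valency l \<in> set (labels l)" and in_r: "valency r \<in> set (labels r)"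
    by (rule valency_in_labels)+
  have "valency l \<in> S - absorbed ` set (L @ R)" "valency r \<in> S - absorbed ` set (L @ R)"
    using realizes_absorbed[OF l] realizes_absorbed[OF r] S in_l in_r disj by (auto simp: image_Un)
  then have "merge_seq k S ((L @ R) @ [(valency l, valency r, j)])"
    using two(1) v j unfolding merge_seq_append[of k S "L @ R"] by simp
  then show "merge_seq k S (L @ R @ [(valency l, valency r, j)])" by simp
  show "grow \<phi> (L @ R @ [(valency l, valency r, j)]) (valency (Node j l r)) = Node j l r"
    using two(2,3) v by simp
  fix x assume "x \<notin> set (labels (Node j l r))"
  then show "grow \<phi> (L @ R @ [(valency l, valency r, j)]) x = \<phi> x"
    using two(4)[of x] in_l by auto
qed

lemma realizes_tree_seq:
  assumes "normalized T" "distinct (labels T)" "supp (color_count T) \<subseteq> {1..k}"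
  shows "realizes k (tree_seq T) T"
  using assms
proof (induction T)
  case (Leaf a)
  then show ?case by (simp add: realizes_Leaf)
next
  case (Node j l r)
  have "supp (color_count l) \<subseteq> {1..k}" "supp (color_count r) \<subseteq> {1..k}" "j \<in> {1..k}"
    using Node.prems(3) unfolding supp_color_count_Node by auto
  moreover have "valency l < valency r"
    using Node.prems(1,2) valency_neq[of l r] by simp
  ultimately show ?case
    using Node by (auto intro!: realizes_Node)
qed

lemma realizes_full_seqs:
  assumes L: "realizes k L T" and T: "T \<in> normal_trees n \<mu>"
  shows "L \<in> full_seqs n k \<mu>" "tree_of L = T"
proof -
  have lab: "set (labels T) = {1..n}" and cc: "color_count T = \<mu>"
    using T by (simp_all add: normal_trees_def labeled_trees_iff)
  have n: "n \<ge> 1" using lab valency_in_labels[of T] by auto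
  have v: "valency T = 1" using n unfolding valency_def lab by (intro Min_eqI) auto
  note r = realizesD[OF L, of "{1..n}" Leaf]
  show tree: "tree_of L = T" using r(2) lab v by (simp add: tree_of_def)
  have "card (absorbed ` set L) = n - 1"
    using realizes_absorbed[OF L] lab v n by (simp add: card_Diff_subset)
  moreover have seq: "merge_seq k {1..n} L" using r(1) lab by simp
  ultimately have "length L = n - 1" using card_absorbed by metis
  then show "L \<in> full_seqs n k \<mu>" using seq tree cc by (simp add: full_seqs_iff[OF n])
qed

lemma realizes_triple:
  assumes P: "realizes k LP P" and Q: "realizes k LQ Q" and S: "realizes k LS S"
    and dist: "distinct (labels P @ labels Q @ labels S)"
    and v: "valency P < valency Q" "valency Q < valency S" and xy: "x \<in> {1..k}" "y \<in> {1..k}"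
  defines "L \<equiv> LP @ LQ @ LS" and "p \<equiv> valency P" and "q \<equiv> valency Q" and "s \<equiv> valency S"
  shows "realizes k (L @ [(p, q, x), (p, s, y)]) (lnest x y P Q S)"
    and "realizes k (L @ [(p, s, x), (p, q, y)]) (lnest x y P S Q)"
    and "realizes k (L @ [(q, s, x), (p, q, y)]) (rnest x y P Q S)"
proof -
  let ?X = "set (labels P) \<union> set (labels Q) \<union> set (labels S)"
  have disj: "set (labels P) \<inter> set (labels Q) = {}" "set (labels P) \<inter> set (labels S) = {}"
    "set (labels Q) \<inter> set (labels S) = {}" using dist by auto
  have inX: "p \<in> set (labels P)" "q \<in> set (labels Q)" "s \<in> set (labels S)"
    unfolding p_def q_def s_def by (rule valency_in_labels)+
  have neq: "p \<noteq> q" "p \<noteq> s" "q \<noteq> s" "p < q" "q < s" "p < s" using v by (auto simp: p_def q_def s_def)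
  have abs: "absorbed ` set L = ?X - {p, q, s}"
    using realizes_absorbed[OF P] realizes_absorbed[OF Q] realizes_absorbed[OF S] disj inX
    unfolding L_def p_def[symmetric] q_def[symmetric] s_def[symmetric] by (auto simp: image_Un)
  have run: "merge_seq k R L \<and> grow \<phi> L p = P \<and> grow \<phi> L q = Q \<and>
      grow \<phi> L s = S \<and> (\<forall>z. z \<notin> ?X \<longrightarrow> grow \<phi> L z = \<phi> z) \<and>
      p \<in> R - absorbed ` set L \<and> q \<in> R - absorbed ` set L \<and> s \<in> R - absorbed ` set L"
    if R: "?X \<subseteq> R" and \<phi>: "\<And>a. a \<in> ?X \<Longrightarrow> \<phi> a = Leaf a" for R \<phi>
  proof -
    have R1: "set (labels P) \<union> set (labels Q) \<subseteq> R" using R by simp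
    note two = realizes_two[OF P Q disj(1) R1 \<phi>]
    have R3: "set (labels S) \<subseteq> R - absorbed ` set (LP @ LQ)"
      using R disj realizes_absorbed[OF P] realizes_absorbed[OF Q] by (auto simp: image_Un)
    have \<phi>3: "grow \<phi> (LP @ LQ) a = Leaf a" if "a \<in> set (labels S)" for a
      using two(4)[of a] \<phi>[of a] that disj by auto
    note three = realizesD[OF S R3 \<phi>3]
    have "merge_seq k R ((LP @ LQ) @ LS)"
      using two(1) three(1) unfolding merge_seq_append[of k R "LP @ LQ"] by simp
    moreover have "grow \<phi> L p = P" "grow \<phi> L q = Q"
      using two(2,3) three(3)[of p] three(3)[of q] inX disj by (auto simp: L_def p_def q_def)
    moreover have "grow \<phi> L s = S" using three(2) by (simp add: L_def s_def)
    moreover have "grow \<phi> L z = \<phi> z" if "z \<notin> ?X" for z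
      using two(4)[of z] three(3)[of z] that by (simp add: L_def)
    moreover have "p \<in> R - absorbed ` set L" "q \<in> R - absorbed ` set L" "s \<in> R - absorbed ` set L"
      unfolding abs using R inX by auto
    ultimately show ?thesis by (simp add: L_def)
  qed
  have finish: "realizes k (L @ v) Z"
    if lab: "set (labels Z) = ?X" and Z: "valency Z = p" and v: "absorbed ` set v = {q, s}"
      and m: "\<And>R. p \<in> R \<Longrightarrow> q \<in> R \<Longrightarrow> s \<in> R \<Longrightarrow> merge_seq k R v"
      and f: "\<And>\<phi>. \<phi> p = P \<Longrightarrow> \<phi> q = Q \<Longrightarrow> \<phi> s = S \<Longrightarrow> grow \<phi> v p = Z"
        "\<And>\<phi> z. z \<notin> {p, q, s} \<Longrightarrow> grow \<phi> v z = \<phi> z" for v Z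
    unfolding realizes_def lab Z
  proof (intro conjI allI impI)
    show "absorbed ` set (L @ v) = ?X - {p}"
      unfolding set_append image_Un abs v using inX neq by auto
    fix \<phi> R assume "?X \<subseteq> R" "\<forall>a\<in>?X. \<phi> a = Leaf a"
    then have r: "merge_seq k R L \<and> grow \<phi> L p = P \<and> grow \<phi> L q = Q \<and>
      grow \<phi> L s = S \<and> (\<forall>z. z \<notin> ?X \<longrightarrow> grow \<phi> L z = \<phi> z) \<and>
      p \<in> R - absorbed ` set L \<and> q \<in> R - absorbed ` set L \<and> s \<in> R - absorbed ` set L"
      by (intro run) auto
    show "merge_seq k R (L @ v)"
      using r m[of "R - absorbed ` set L"] by (simp add: merge_seq_append)
    show "grow \<phi> (L @ v) p = Z"
      using r f(1)[of "grow \<phi> L"] by simp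
    fix z assume z: "z \<notin> ?X"
    then have "z \<notin> {p, q, s}" using inX by auto
    then show "grow \<phi> (L @ v) z = \<phi> z" using r z f(2) by simp
  qed
  have val: "valency P = p" "valency Q = q" "valency S = s" by (simp_all add: p_def q_def s_def)
  show "realizes k (L @ [(p, q, x), (p, s, y)]) (lnest x y P Q S)"
    "realizes k (L @ [(p, s, x), (p, q, y)]) (lnest x y P S Q)"
    "realizes k (L @ [(q, s, x), (p, q, y)]) (rnest x y P Q S)"
    by (rule finish; use neq xy val in auto)+
qed

text \<open>
  Every straightening relation of trees comes from an interval of length two: the trees in it are
  built by sequences that differ in two consecutive steps only.
\<close>

definition realizes_triples ::
  "nat \<Rightarrow> merge_step list \<Rightarrow> merge_step list \<Rightarrow> nat \<Rightarrow> nat \<Rightarrow> nat \<Rightarrow> nat set \<Rightarrow>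
    (nat \<Rightarrow> nat \<Rightarrow> lctree) \<Rightarrow> (nat \<Rightarrow> nat \<Rightarrow> lctree) \<Rightarrow> (nat \<Rightarrow> nat \<Rightarrow> lctree) \<Rightarrow> bool" where
  "realizes_triples k u w p q s X A B C \<longleftrightarrow> p < q \<and> q < s \<and>
    (\<forall>x\<in>{1..k}. \<forall>y\<in>{1..k}.
      set (labels (A x y)) = X \<and> set (labels (B x y)) = X \<and> set (labels (C x y)) = X \<and>
      realizes k (u @ [(p, q, x), (p, s, y)] @ w) (A x y) \<and>
      realizes k (u @ [(p, s, x), (p, q, y)] @ w) (B x y) \<and>
      realizes k (u @ [(q, s, x), (p, q, y)] @ w) (C x y))"

lemma realizes_triples_mono:
  assumes "realizes_triples k u w p q s X A B C"
    and "\<And>v Z. set (labels Z) = X \<Longrightarrow> realizes k (u @ v @ w) Z \<Longrightarrow> realizes k (u' @ v @ w') (\<kappa> Z)"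
    and "\<And>Z. set (labels Z) = X \<Longrightarrow> set (labels (\<kappa> Z)) = Y"
  shows "realizes_triples k u' w' p q s Y (\<lambda>x y. \<kappa> (A x y)) (\<lambda>x y. \<kappa> (B x y)) (\<lambda>x y. \<kappa> (C x y))"
  unfolding realizes_triples_def
proof (intro conjI ballI)
  fix x y assume "x \<in> {1..k}" "y \<in> {1..k}"
  then have *: "set (labels (A x y)) = X" "set (labels (B x y)) = X" "set (labels (C x y)) = X"
    "realizes k (u @ [(p, q, x), (p, s, y)] @ w) (A x y)"
    "realizes k (u @ [(p, s, x), (p, q, y)] @ w) (B x y)"
    "realizes k (u @ [(q, s, x), (p, q, y)] @ w) (C x y)"
    using assms(1) unfolding realizes_triples_def by blast+
  show "set (labels (\<kappa> (A x y))) = Y" "set (labels (\<kappa> (B x y))) = Y" "set (labels (\<kappa> (C x y))) = Y"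
    using *(1-3) by (simp_all add: assms(3))
  show "realizes k (u' @ [(p, q, x), (p, s, y)] @ w') (\<kappa> (A x y))"
    "realizes k (u' @ [(p, s, x), (p, q, y)] @ w') (\<kappa> (B x y))"
    "realizes k (u' @ [(q, s, x), (p, q, y)] @ w') (\<kappa> (C x y))"
    by (rule assms(2)[OF *(1,4)] assms(2)[OF *(2,5)] assms(2)[OF *(3,6)])+
qed (use assms(1) in \<open>simp_all add: realizes_triples_def\<close>)

lemma straighten_realizes:
  assumes "straighten T ps ns" "normalized T" "distinct (labels T)" "supp (color_count T) \<subseteq> {1..k}"
  obtains u w p q s b c A B C where "realizes_triples k u w p q s (set (labels T)) A B C"
    "b \<in> {1..k}" "c \<in> {1..k}" "T = A b c"
    "ps = (if b = c then [B b b, C b b] else [B b c, B c b, C b c, C c b])"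
    "ns = (if b = c then [] else [A c b])"
  using assms
proof (induction arbitrary: thesis)
  case (root P Q S b c)
  have bc: "b \<in> {1..k}" "c \<in> {1..k}" and sup: "supp (color_count P) \<subseteq> {1..k}"
    "supp (color_count Q) \<subseteq> {1..k}" "supp (color_count S) \<subseteq> {1..k}"
    using root(7) unfolding supp_color_count_Node by auto
  have r: "realizes k (tree_seq P) P" "realizes k (tree_seq Q) Q" "realizes k (tree_seq S) S"
    using root sup by (auto intro!: realizes_tree_seq)
  have d: "distinct (labels P @ labels Q @ labels S)" using root(6) by auto
  \<comment> \<open>\<open>P\<close>, \<open>Q\<close> and \<open>S\<close> are all built before the
    two merges of the redex, so that these become consecutive. This differs from postorder, where
    the merge of \<open>P\<close> and \<open>Q\<close> precedes the nodes of
    \<open>S\<close>.\<close>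
  have "realizes_triples k (tree_seq P @ tree_seq Q @ tree_seq S) [] (valency P) (valency Q) (valency S)
      (set (labels (lnest b c P Q S)))
      (\<lambda>x y. lnest x y P Q S) (\<lambda>x y. lnest x y P S Q) (\<lambda>x y. rnest x y P Q S)"
    using root(1,2) realizes_triple[OF r d root(1,2)] by (auto simp: realizes_triples_def)
  then show ?case by (rule root(4)[OF _ bc]) (simp_all add: root_pos_def root_neg_def)
next
  case (left l ps ns j r)
  have j: "j \<in> {1..k}" and sup: "supp (color_count l) \<subseteq> {1..k}" "supp (color_count r) \<subseteq> {1..k}"
    using left.prems(4) unfolding supp_color_count_Node by auto
  have v: "valency l < valency r" using left.prems(2,3) valency_neq[of l r] by simp
  have r: "realizes k (tree_seq r) r" using left.prems sup by (intro realizes_tree_seq) auto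
  have l: "normalized l" "distinct (labels l)" using left.prems by auto
  obtain u w p q s b c A B C where IH: "realizes_triples k u w p q s (set (labels l)) A B C"
    "b \<in> {1..k}" "c \<in> {1..k}" "l = A b c"
    "ps = (if b = c then [B b b, C b b] else [B b c, B c b, C b c, C c b])"
    "ns = (if b = c then [] else [A c b])"
    by (rule left.IH[OF _ l sup(1)])
  have "realizes k (u @ v @ w @ tree_seq r @ [(valency l, valency r, j)]) (Node j Z r)"
    if "set (labels Z) = set (labels l)" "realizes k (u @ v @ w) Z" for v Z
  proof -
    have "valency Z = valency l" using that(1) by (simp add: valency_def)
    then show ?thesis using realizes_Node[OF that(2) r _ _ j] left.prems(3) v that(1) by simp
  qed
  from realizes_triples_mono[OF IH(1), where Y = "set (labels (Node j l r))" and \<kappa> = "\<lambda>Z. Node j Z r", OF this] show ?case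
    by (rule left.prems(1)[OF _ IH(2,3)]) (simp_all add: IH(4-))
next
  case (right r ps ns j l)
  have j: "j \<in> {1..k}" and sup: "supp (color_count l) \<subseteq> {1..k}" "supp (color_count r) \<subseteq> {1..k}"
    using right.prems(4) unfolding supp_color_count_Node by auto
  have v: "valency l < valency r" using right.prems(2,3) valency_neq[of l r] by simp
  have l: "realizes k (tree_seq l) l" using right.prems sup by (intro realizes_tree_seq) auto
  have r: "normalized r" "distinct (labels r)" using right.prems by auto
  obtain u w p q s b c A B C where IH: "realizes_triples k u w p q s (set (labels r)) A B C"
    "b \<in> {1..k}" "c \<in> {1..k}" "r = A b c"
    "ps = (if b = c then [B b b, C b b] else [B b c, B c b, C b c, C c b])"
    "ns = (if b = c then [] else [A c b])"
    by (rule right.IH[OF _ r sup(2)])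
  have "realizes k ((tree_seq l @ u) @ v @ w @ [(valency l, valency r, j)]) (Node j l Z)"
    if "set (labels Z) = set (labels r)" "realizes k (u @ v @ w) Z" for v Z
  proof -
    have "valency Z = valency r" using that(1) by (simp add: valency_def)
    then show ?thesis using realizes_Node[OF l that(2) _ _ j] right.prems(3) v that(1) by simp
  qed
  from realizes_triples_mono[OF IH(1), where Y = "set (labels (Node j l r))" and \<kappa> = "Node j l", OF this] show ?case
    by (rule right.prems(1)[OF _ IH(2,3)]) (simp_all add: IH(4-))
qed

section \<open>Sequences building the same tree\<close>

text \<open>The root of the tree at \<open>a\<close> stems from the last merge into
  \<open>a\<close>. Afterwards neither \<open>a\<close> nor the absorbed \<open>b\<close> is
  touched, so this merge can be moved to the end.\<close>

lemma last_merge: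
  assumes "merge_seq k {1..n} ms" "a \<in> {1..n} - absorbed ` set ms"
    and "grow Leaf ms a = Node r X Y"
  shows "\<exists>u w b. ms = u @ (a, b, r) # w \<and> grow Leaf u a = X \<and>
    grow Leaf u b = Y \<and> b = valency Y \<and>
    (\<forall>(c, d, s)\<in>set w. c \<notin> {a, b} \<and> d \<notin> {a, b})"
  using assms
proof (induction ms rule: rev_induct)
  case (snoc m ms)
  obtain c d s where m: "m = (c, d, s)" by (cases m)
  have seq: "merge_seq k {1..n} ms" "c \<in> {1..n} - absorbed ` set ms" "d \<in> {1..n} - absorbed ` set ms"
    "c < d" using snoc.prems(1) by (simp_all add: m merge_seq_append)
  show ?case
  proof (cases "c = a")
    case True
    then have "r = s" "X = grow Leaf ms a" "Y = grow Leaf ms d"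
      using snoc.prems(3) seq(4) by (simp_all add: m)
    moreover have "valency (grow Leaf ms d) = d"
      using forest_on_level[OF seq(1)] seq(3) by (simp add: forest_on_def)
    ultimately show ?thesis
      using True by (intro exI[of _ ms] exI[of _ "[]"] exI[of _ d]) (simp add: m)
  next
    case False
    then have "grow Leaf ms a = Node r X Y" using snoc.prems(3) by (simp add: m)
    moreover have a: "a \<in> {1..n} - absorbed ` set ms" "a \<noteq> d" using snoc.prems(2) by (auto simp: m)
    ultimately obtain u w b where *: "ms = u @ (a, b, r) # w" "grow Leaf u a = X"
      "grow Leaf u b = Y" "b = valency Y" "\<forall>(c, d, s)\<in>set w. c \<notin> {a, b} \<and> d \<notin> {a, b}"
      using snoc.IH[OF seq(1)] by blast
    have "b \<in> absorbed ` set ms" using *(1) by simp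
    then have "c \<notin> {a, b} \<and> d \<notin> {a, b}" using False a seq(2,3) by auto
    then show ?thesis
      using * by (intro exI[of _ u] exI[of _ "w @ [m]"] exI[of _ b]) (simp add: m)
  qed
qed simp

lemma grow_avoid:
  assumes "\<forall>(c, d, s)\<in>set w. c \<notin> Z \<and> d \<notin> Z" "\<And>x. x \<notin> Z \<Longrightarrow> \<phi> x = \<psi> x"
  shows "x \<notin> Z \<Longrightarrow> grow \<phi> w x = grow \<psi> w x"
    and "x \<in> Z \<Longrightarrow> grow \<phi> w x = \<phi> x"
proof -
  show "x \<notin> Z \<Longrightarrow> grow \<phi> w x = grow \<psi> w x"
    using assms
  proof (induction w arbitrary: \<phi> \<psi>)
    case (Cons m w)
    obtain c d s where m: "m = (c, d, s)" by (cases m)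
    have "grow (merge_trees \<phi> m) w x = grow (merge_trees \<psi> m) w x"
      using Cons.prems by (intro Cons.IH) (auto simp: m)
    then show ?case by simp
  qed simp
  show "x \<in> Z \<Longrightarrow> grow \<phi> w x = \<phi> x"
    using assms(1)
  proof (induction w arbitrary: \<phi>)
    case (Cons m w)
    obtain c d s where m: "m = (c, d, s)" by (cases m)
    have "grow (merge_trees \<phi> m) w x = merge_trees \<phi> m x"
      using Cons.prems by (intro Cons.IH) auto
    then show ?case using Cons.prems by (auto simp: m)
  qed simp
qed

text \<open>
  Any two sequences building the same tree are connected by exchanging consecutive merges of
  disjoint pairs of blocks: the last step of one of them can be moved to the end of the other.
\<close>

lemma same_tree_seqs:
  fixes \<Phi> :: "merge_step list \<Rightarrow> 'a::ab_group_add"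
  assumes V: "0 \<in> V" "\<And>f g. f \<in> V \<Longrightarrow> g \<in> V \<Longrightarrow> f + g \<in> V" "\<And>f. f \<in> V \<Longrightarrow> - f \<in> V"
    and swap: "\<And>u a b r a' b' r' w. u @ (a, b, r) # (a', b', r') # w \<in> full_seqs n k \<mu> \<Longrightarrow>
      a' \<notin> {a, b} \<Longrightarrow> b' \<notin> {a, b} \<Longrightarrow>
      u @ (a', b', r') # (a, b, r) # w \<in> full_seqs n k \<mu> \<and>
      \<Phi> (u @ (a', b', r') # (a, b, r) # w) - \<Phi> (u @ (a, b, r) # (a', b', r') # w) \<in> V"
    and n: "n \<ge> 1" and ms: "ms \<in> full_seqs n k \<mu>" and ms': "ms' \<in> full_seqs n k \<mu>"
    and eq: "tree_of ms = tree_of ms'"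
  shows "\<Phi> ms' - \<Phi> ms \<in> V"
proof -
  have move: "u @ v @ (a, b, r) # w \<in> full_seqs n k \<mu> \<and>
      \<Phi> (u @ v @ (a, b, r) # w) - \<Phi> (u @ (a, b, r) # v @ w) \<in> V"
    if "u @ (a, b, r) # v @ w \<in> full_seqs n k \<mu>" "\<forall>(c, d, s)\<in>set v. c \<notin> {a, b} \<and> d \<notin> {a, b}"
    for u v w a b r
    using that
  proof (induction v arbitrary: u)
    case Nil
    then show ?case using V(1) by simp
  next
    case (Cons m v)
    obtain c d s where m: "m = (c, d, s)" by (cases m)
    have sw: "u @ (c, d, s) # (a, b, r) # v @ w \<in> full_seqs n k \<mu>"
      "\<Phi> (u @ (c, d, s) # (a, b, r) # v @ w) - \<Phi> (u @ (a, b, r) # (c, d, s) # v @ w) \<in> V"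
      using swap[of u a b r c d s "v @ w"] Cons.prems by (auto simp: m)
    have "(u @ [m]) @ (a, b, r) # v @ w \<in> full_seqs n k \<mu>" using sw(1) by (simp add: m)
    from Cons.IH[OF this] Cons.prems(2)
    have "u @ m # v @ (a, b, r) # w \<in> full_seqs n k \<mu>"
      "\<Phi> (u @ m # v @ (a, b, r) # w) - \<Phi> (u @ m # (a, b, r) # v @ w) \<in> V" by simp_all
    then show ?case using V(2)[OF _ sw(2)] by (fastforce simp: m)
  qed
  \<comment> \<open>The induction shortens the prefixes from their ends while the common tail
    \<open>w\<close> grows. Prefixes leave several trees behind, so the claim is about
    forests.\<close>
  have "\<Phi> (ms' @ w) - \<Phi> (ms @ w) \<in> V"
    if "ms @ w \<in> full_seqs n k \<mu>" "ms' @ w \<in> full_seqs n k \<mu>" "absorbed ` set ms = absorbed ` set ms'"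
      "\<And>x. x \<in> {1..n} - absorbed ` set ms \<Longrightarrow> grow Leaf ms x = grow Leaf ms' x"
    for ms ms' w
    using that
  proof (induction ms arbitrary: ms' w rule: rev_induct)
    case Nil
    then show ?case using V(1) by simp
  next
    case (snoc m ms)
    obtain a b r where m: "m = (a, b, r)" by (cases m)
    have seq: "merge_seq k {1..n} (ms @ [m])" "merge_seq k {1..n} ms'"
      using snoc.prems(1,2) merge_seq_append[of k "{1..n}" "ms @ [m]" w] merge_seq_append[of k "{1..n}" ms' w]
      unfolding full_seqs_def by blast+
    then have ab: "a \<in> {1..n} - absorbed ` set (ms @ [m])" "b \<in> {1..n} - absorbed ` set ms" "a < b"
      by (auto simp: m merge_seq_append)
    have fa: "grow Leaf ms' a = Node r (grow Leaf ms a) (grow Leaf ms b)"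
      using snoc.prems(4)[OF ab(1)] by (simp add: m)
    have "a \<in> {1..n} - absorbed ` set ms'" using ab(1) unfolding snoc.prems(3) .
    from last_merge[OF seq(2) this fa] obtain u v b' where uv: "ms' = u @ (a, b', r) # v"
      "grow Leaf u a = grow Leaf ms a"
      "grow Leaf u b' = grow Leaf ms b"
      "b' = valency (grow Leaf ms b)"
      "\<forall>(c, d, s)\<in>set v. c \<notin> {a, b'} \<and> d \<notin> {a, b'}" by blast
    have "merge_seq k {1..n} ms" using seq(1) by (simp add: merge_seq_append)
    \<comment> \<open>Trees are indexed by their valency, so the same tree was absorbed under the
      same index in both sequences.\<close>
    then have b': "b' = b" using uv(4) forest_on_level ab(2) by (auto simp: forest_on_def)
    have mv: "u @ v @ (a, b, r) # w \<in> full_seqs n k \<mu>"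
      "\<Phi> (u @ v @ (a, b, r) # w) - \<Phi> (u @ (a, b, r) # v @ w) \<in> V"
      using move[of u a b r v w] snoc.prems(2) uv(1,5) by (simp_all add: b')
    have b_notin: "b \<notin> absorbed ` set ms" "b \<notin> absorbed ` set (u @ v)"
    proof -
      show "b \<notin> absorbed ` set ms" using ab(2) by simp
      have "distinct (map absorbed ms')" by (rule merge_seq_absorbed(2)[OF seq(2)])
      then show "b \<notin> absorbed ` set (u @ v)" by (auto simp: uv(1) b' image_Un)
    qed
    have abs: "absorbed ` set ms = absorbed ` set (u @ v)"
    proof -
      have "insert b (absorbed ` set ms) = insert b (absorbed ` set (u @ v))"
        using snoc.prems(3) by (simp add: m uv(1) b' image_Un)
      then show ?thesis using b_notin by (metis Diff_insert_absorb)
    qed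
    have forest: "grow Leaf ms x = grow Leaf (u @ v) x"
      if x: "x \<in> {1..n} - absorbed ` set ms" for x
    proof (cases "x \<in> {a, b}")
      case True
      then have "grow Leaf (u @ v) x = grow Leaf u x"
        using grow_avoid(2)[of v "{a, b}" "grow Leaf u" "grow Leaf u" x] uv(5)
        by (simp add: b')
      then show ?thesis using True uv(2,3) b' by auto
    next
      case False
      have "grow Leaf ms x = grow Leaf (ms @ [m]) x" using False by (simp add: m)
      also have "\<dots> = grow Leaf ms' x" using snoc.prems(4)[of x] x False by (simp add: m)
      also have "\<dots> = grow Leaf (u @ v) x"
        using grow_avoid(1)[of v "{a, b}" "merge_trees (grow Leaf u) (a, b, r)"
            "grow Leaf u" x] uv(5) False by (simp add: uv(1) b')
      finally show ?thesis .
    qed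
    have "\<Phi> ((u @ v) @ m # w) - \<Phi> (ms @ m # w) \<in> V"
      using snoc.prems(1) mv(1) abs forest by (intro snoc.IH) (simp_all add: m)
    moreover have "- (\<Phi> ((u @ v) @ m # w) - \<Phi> (ms' @ w)) \<in> V"
      using mv(2) by (intro V(3)) (simp add: uv(1) b' m)
    ultimately have "(\<Phi> ((u @ v) @ m # w) - \<Phi> (ms @ m # w)) +
      - (\<Phi> ((u @ v) @ m # w) - \<Phi> (ms' @ w)) \<in> V" by (rule V(2))
    then show ?case by simp
  qed
  note main = this
  have m: "merge_seq k {1..n} ms" "length ms = n - 1" "merge_seq k {1..n} ms'" "length ms' = n - 1"
    using ms ms' by (simp_all add: full_seqs_def)
  have act: "{1..n} - absorbed ` set ms = {1}" "{1..n} - absorbed ` set ms' = {1}"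
    using full_active[OF m(1,2) n] full_active[OF m(3,4) n] .
  have "absorbed ` set l = {1..n} - ({1..n} - absorbed ` set l)" if "merge_seq k {1..n} l" for l
    by (rule double_diff[symmetric, OF merge_seq_absorbed(1)[OF that] order_refl])
  from this[OF m(1)] this[OF m(3)] have "absorbed ` set ms = absorbed ` set ms'"
    unfolding act by (rule trans[OF _ sym])
  then show ?thesis
    using main[of ms "[]" ms'] ms ms' eq unfolding act by (simp add: tree_of_def)
qed

section \<open>The cohomology side\<close>

text \<open>\<open>merge_at\<close> looks up blocks by the label sets of subtrees. To compare it
  with merges of minima one needs that in postorder both subtrees of a node are complete, at their
  minima, when the node is reached.\<close>

lemma nodes_built:
  assumes "normalized T" "distinct (labels T)" "supp (color_count T) \<subseteq> {1..k}"
    and "\<And>a. a \<in> set (labels T) \<Longrightarrow> \<phi> a = Leaf a" and "t < length (internal_nodes T)"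
  shows "grow \<phi> (take t (tree_seq T)) (valency (left (internal_nodes T ! t))) =
      left (internal_nodes T ! t) \<and>
    grow \<phi> (take t (tree_seq T)) (valency (right (internal_nodes T ! t))) =
      right (internal_nodes T ! t)"
  using assms
proof (induction T arbitrary: \<phi> t)
  case (Node j l r)
  let ?nl = "length (internal_nodes l)" and ?nr = "length (internal_nodes r)"
  have len: "length (tree_seq T) = length (internal_nodes T)" for T by (simp add: tree_seq_def)
  have sup: "supp (color_count l) \<subseteq> {1..k}" "supp (color_count r) \<subseteq> {1..k}"
    using Node.prems(3) unfolding supp_color_count_Node by auto
  have l: "realizes k (tree_seq l) l" and r: "realizes k (tree_seq r) r"
    using Node.prems(1,2) sup by (auto intro!: realizes_tree_seq)
  have disj: "set (labels l) \<inter> set (labels r) = {}" using Node.prems(2) by simp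
  have \<phi>: "\<And>a. a \<in> set (labels l) \<union> set (labels r) \<Longrightarrow> \<phi> a = Leaf a" using Node.prems(4) by simp
  consider "t < ?nl" | "?nl \<le> t" "t < ?nl + ?nr" | "t = ?nl + ?nr"
    using Node.prems(5) by fastforce
  then show ?case
  proof cases
    case 1
    then show ?thesis
      using Node.IH(1)[of \<phi> t] Node.prems sup by (simp add: nth_append len)
  next
    case 2
    have "grow \<phi> (tree_seq l) a = Leaf a" if "a \<in> set (labels r)" for a
      using realizesD(3)[OF l order_refl, of \<phi> a] \<phi> that disj by auto
    moreover have "t - ?nl < ?nr" "\<not> t < ?nl" using 2 by linarith+
    ultimately show ?thesis
      using Node.IH(2)[of "grow \<phi> (tree_seq l)" "t - ?nl"] Node.prems sup
      by (simp add: nth_append len)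
  next
    case 3
    then show ?thesis
      using realizes_two(2,3)[OF l r disj order_refl \<phi>] by (simp add: nth_append len)
  qed
qed simp

lemma weight_of_partition_of:
  assumes \<phi>: "forest_on n k \<phi> S" and a: "a \<in> S"
  shows "weight_of (partition_of \<phi> S) (set (labels (\<phi> a))) = color_count (\<phi> a)"
  unfolding weight_of_def
proof (rule the_equality)
  show "(set (labels (\<phi> a)), color_count (\<phi> a)) \<in> partition_of \<phi> S" using a by (simp add: partition_of_def)
  fix \<nu> assume "(set (labels (\<phi> a)), \<nu>) \<in> partition_of \<phi> S"
  then obtain b where b: "b \<in> S" "set (labels (\<phi> a)) = set (labels (\<phi> b))" "\<nu> = color_count (\<phi> b)"
    by (auto simp: partition_of_def)
  have "a \<in> set (labels (\<phi> b))"
    using forest_on_label_iff[OF \<phi> a a] unfolding b(2)[symmetric] by blast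
  then have "a = b" using forest_on_label_iff[OF \<phi> b(1) a] by blast
  then show "\<nu> = color_count (\<phi> a)" using b by simp
qed

lemma tree_seq_full_seqs:
  assumes "T \<in> normal_trees n \<mu>" "supp \<mu> \<subseteq> {1..k}"
  shows "tree_seq T \<in> full_seqs n k \<mu>" "tree_of (tree_seq T) = T"
proof -
  have "realizes k (tree_seq T) T"
    using assms by (intro realizes_tree_seq) (simp_all add: normal_trees_def labeled_trees_iff)
  then show "tree_seq T \<in> full_seqs n k \<mu>" "tree_of (tree_seq T) = T"
    by (rule realizes_full_seqs[OF _ assms(1)])+
qed

lemma tree_chain_bar_eq:
  assumes n: "n \<ge> 1" and T: "T \<in> normal_trees n \<mu>" and \<mu>: "supp \<mu> \<subseteq> {1..k}"
  shows "tree_chain_bar n \<mu> T = chain_of n (tree_seq T)"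
proof -
  have T': "normalized T" "distinct (labels T)" "supp (color_count T) \<subseteq> {1..k}"
    using T \<mu> by (simp_all add: normal_trees_def labeled_trees_iff)
  note full = tree_seq_full_seqs(1)[OF T \<mu>]
  have seq: "merge_seq k {1..n} (tree_seq T)" and len: "length (tree_seq T) = n - 1"
    and top: "level n (tree_seq T) = wtop n \<mu>"
    using full by (simp_all add: full_seqs_def)
  have len': "length (internal_nodes T) = n - 1" using len by (simp add: tree_seq_def)
  have lev: "foldl merge_at (wbot n) (take t (internal_nodes T)) = level n (take t (tree_seq T))"
    if "t \<le> n - 1" for t
    using that
  proof (induction t)
    case 0
    then show ?case by (simp add: level_Nil)
  next
    case (Suc t)
    let ?x = "internal_nodes T ! t" and ?\<phi> = "grow Leaf (take t (tree_seq T))"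
    let ?S = "{1..n} - absorbed ` set (take t (tree_seq T))"
    define a b r where "a = valency (left ?x)" and "b = valency (right ?x)" and "r = color ?x"
    have tk: "take (Suc t) (tree_seq T) = take t (tree_seq T) @ [(a, b, r)]"
      using Suc.prems len' len by (simp add: take_Suc_conv_app_nth tree_seq_def a_def b_def r_def)
    have built: "?\<phi> a = left ?x" "?\<phi> b = right ?x"
      using nodes_built[OF T', of Leaf t] Suc.prems len' by (simp_all add: a_def b_def)
    have "merge_seq k {1..n} (take t (tree_seq T) @ [(a, b, r)])"
      using merge_seq_take[OF seq, of "Suc t"] unfolding tk .
    then have ab: "a \<in> ?S" "b \<in> ?S" "a \<noteq> b" and f: "forest_on n k ?\<phi> ?S"
      using forest_on_level by (auto simp: merge_seq_append)
    have "foldl merge_at (wbot n) (take (Suc t) (internal_nodes T)) =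
        merge_at (level n (take t (tree_seq T))) ?x"
      using Suc len' by (simp add: take_Suc_conv_app_nth)
    also have "\<dots> = merge (partition_of ?\<phi> ?S) (set (labels (?\<phi> a)), color_count (?\<phi> a))
        (set (labels (?\<phi> b)), color_count (?\<phi> b)) r"
      using weight_of_partition_of[OF f ab(1)] weight_of_partition_of[OF f ab(2)]
      unfolding merge_at_def level_def Let_def built r_def by (simp only:)
    also have "\<dots> = level n (take (Suc t) (tree_seq T))"
      unfolding tk level_snoc by (rule partition_of_step[OF f ab, symmetric])
    finally show ?case .
  qed
  have chain: "tree_chain n T = (\<lambda>t. level n (take t (tree_seq T))) ` {0..n - 1}"
    unfolding tree_chain_def len' using lev by (intro image_cong) auto
  have card: "card (level n (take t (tree_seq T))) = n - t" if "t \<le> n - 1" for t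
    by (rule card_level_take[OF full that])
  show ?thesis
  proof (intro equalityI subsetI)
    fix z assume "z \<in> tree_chain_bar n \<mu> T"
    then obtain t where t: "t \<in> {0..n - 1}" "z = level n (take t (tree_seq T))" "z \<noteq> wbot n" "z \<noteq> wtop n \<mu>"
      unfolding tree_chain_bar_def chain by blast
    have "t \<noteq> 0" using t(2,3) level_Nil[of n] by (metis take0)
    moreover have "t \<noteq> n - 1" using t(2,4) top len by (metis order_refl take_all)
    ultimately show "z \<in> chain_of n (tree_seq T)" using t unfolding chain_of_def by auto
  next
    fix z assume "z \<in> chain_of n (tree_seq T)"
    then obtain t where t: "t \<in> {1..<n - 1}" "z = level n (take t (tree_seq T))"
      unfolding chain_of_def by blast
    then have "z \<noteq> wbot n" "z \<noteq> wtop n \<mu>" using card[of t] card_wbot[of n] card_wtop[of n \<mu>] by auto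
    then show "z \<in> tree_chain_bar n \<mu> T" using t unfolding tree_chain_bar_def chain by auto
  qed
qed

section \<open>Cochains and coboundaries in top degree\<close>

lemma linear_subspace_cochains: "linear_subspace (cochains \<Delta> d)"
  by (auto simp: linear_subspace_def cochains_def) (metis add.right_neutral)+

lemma coboundary_add: "coboundary R \<Delta> (f + g) = coboundary R \<Delta> f + coboundary R \<Delta> g"
  by (simp add: fun_eq_iff coboundary_def sum.distrib distrib_left)

lemma coboundary_scale: "coboundary R \<Delta> (\<lambda>F. c * f F) = (\<lambda>F. c * coboundary R \<Delta> f F)"
  by (simp add: fun_eq_iff coboundary_def sum_distrib_left mult.left_commute)

lemma linear_subspace_coboundaries:
  "linear_subspace (coboundaries R \<Delta> d :: ('a set \<Rightarrow> 'b::field) set)"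
proof -
  note C = linear_subspace_cochains[of \<Delta> "d - 1", unfolded linear_subspace_def]
  show ?thesis
    unfolding linear_subspace_def coboundaries_def
  proof (intro conjI ballI allI)
    have "coboundary R \<Delta> 0 = 0" by (simp add: fun_eq_iff coboundary_def)
    then show "0 \<in> coboundary R \<Delta> ` cochains \<Delta> (d - 1)" using C by (metis imageI)
  next
    fix f g :: "'a set \<Rightarrow> 'b" assume "f \<in> coboundary R \<Delta> ` cochains \<Delta> (d - 1)" "g \<in> coboundary R \<Delta> ` cochains \<Delta> (d - 1)"
    then show "f + g \<in> coboundary R \<Delta> ` cochains \<Delta> (d - 1)"
      using C by (auto simp flip: coboundary_add)
  next
    fix c f assume "f \<in> coboundary R \<Delta> ` cochains \<Delta> (d - 1)"
    then show "(\<lambda>x. c * f x) \<in> coboundary R \<Delta> ` cochains \<Delta> (d - 1)"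
      using C by (auto simp flip: coboundary_scale)
  qed
qed

lemma coboundary_nonzeroD:
  assumes "coboundary R \<Delta> f F \<noteq> 0"
  shows "F \<in> \<Delta>" "\<exists>x\<in>F. f (F - {x}) \<noteq> 0"
proof -
  show "F \<in> \<Delta>" using assms by (auto simp: coboundary_def split: if_splits)
  show "\<exists>x\<in>F. f (F - {x}) \<noteq> 0"
  proof (rule ccontr)
    assume "\<not> (\<exists>x\<in>F. f (F - {x}) \<noteq> 0)"
    then have "coboundary R \<Delta> f F = 0" by (simp add: coboundary_def)
    then show False using assms by simp
  qed
qed

lemma coboundary_cochains:
  assumes "\<And>F. F \<in> \<Delta> \<Longrightarrow> finite F" "f \<in> cochains \<Delta> (d - 1)"
  shows "coboundary R \<Delta> f \<in> cochains \<Delta> d"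
  unfolding cochains_def
proof (intro CollectI allI impI)
  fix F assume "coboundary R \<Delta> f F \<noteq> 0"
  from coboundary_nonzeroD[OF this] obtain x where F: "F \<in> \<Delta>" "x \<in> F" "f (F - {x}) \<noteq> 0" by blast
  then have "int (card (F - {x})) = d" using assms(2) by (auto simp: cochains_def)
  then have "int (card F) = d + 1"
    using card_Suc_Diff1[OF assms(1)[OF F(1)] F(2)] by linarith
  then show "F \<in> \<Delta> \<and> int (card F) = d + 1" using F by simp
qed

text \<open>No face has more than n - 2 vertices. The truncated difference makes the degree n - 3
  for n \<ge> 2 and -1 for n = 1, where the only face is the empty chain.\<close>

lemma cocycles_top:
  assumes n: "n \<ge> 1"
  shows "cocycles (wle n k) (weighted_complex n k \<mu>) (int (n - 2) - 1) =
    (cochains (weighted_complex n k \<mu>) (int (n - 2) - 1) :: (wpartition set \<Rightarrow> 'k::field) set)"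
proof -
  have "coboundary (wle n k) (weighted_complex n k \<mu>) f F = 0"
    if f: "f \<in> cochains (weighted_complex n k \<mu>) (int (n - 2) - 1)" for f :: "wpartition set \<Rightarrow> 'k" and F
  proof (rule ccontr)
    assume nz: "coboundary (wle n k) (weighted_complex n k \<mu>) f F \<noteq> 0"
    have "coboundary (wle n k) (weighted_complex n k \<mu>) f \<in> cochains (weighted_complex n k \<mu>) (int (n - 2))"
      using weighted_complexD(1)[OF n] f by (intro coboundary_cochains) auto
    then have "F \<in> weighted_complex n k \<mu>" "card F = n - 2 + 1" using nz by (auto simp: cochains_def)
    then show False using weighted_complexD(4)[OF n] by fastforce
  qed
  then show ?thesis by (auto simp: cocycles_def)
qed

lemma card_ridge_of:
  assumes "ms \<in> full_seqs n k \<mu>" "t \<in> {1..<n - 1}"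
  shows "card (ridge_of n t ms) = n - 3"
proof -
  have "card (ridge_of n t ms) = card ({1..<n - 1} - {t})"
    unfolding ridge_of_def by (rule card_image[OF inj_on_subset[OF inj_on_level[OF assms(1)]]]) auto
  then show ?thesis using assms(2) by simp
qed

lemma ridge_of_neq:
  assumes ms: "ms \<in> full_seqs n k \<mu>" and ms': "ms' \<in> full_seqs n k \<mu>"
    and s: "s \<in> {1..<n - 1}" and t: "t \<in> {1..<n - 1}" and st: "s \<noteq> t"
  shows "ridge_of n s ms \<noteq> ridge_of n t ms'"
proof
  assume eq: "ridge_of n s ms = ridge_of n t ms'"
  have "level n (take t ms) \<in> ridge_of n s ms" unfolding ridge_of_def using t st by auto
  then obtain u where u: "u \<in> {1..<n - 1}" "u \<noteq> t" "level n (take t ms) = level n (take u ms')"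
    unfolding eq unfolding ridge_of_def by blast
  then have "n - t = n - u" using card_level_take[OF ms, of t] card_level_take[OF ms', of u] t by simp
  then show False using u t by auto
qed

text \<open>With this sign, chains that build the same tree become cohomologous, and the
  straightening relations of trees hold for chains without further signs.\<close>

definition signed_chain :: "nat \<Rightarrow> merge_step list \<Rightarrow> wpartition set \<Rightarrow> 'k::field" where
  "signed_chain n ms = (\<lambda>F. of_int (inv_sign (map absorbed ms)) * point_mass (chain_of n ms) F)"

section \<open>The cohomology of the open interval below a fixed top element\<close>

context
  fixes n k :: nat and \<mu> :: "nat \<Rightarrow> nat" and W :: "(wpartition set \<Rightarrow> 'k::field) set"
  assumes n: "n \<ge> 1" and \<mu>: "\<mu> \<in> WComp (n - 1)" "supp \<mu> \<subseteq> {1..k}"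
    and W_def: "W = coboundaries (wle n k) (weighted_complex n k \<mu>) (int (n - 2) - 1)"
begin

private abbreviation (input) "\<Delta> \<equiv> weighted_complex n k \<mu>"
private abbreviation (input) "M \<equiv> full_seqs n k \<mu>"

private lemma W: "linear_subspace W"
  unfolding W_def by (rule linear_subspace_coboundaries)

text \<open>Up to sign the sum is the coboundary of the point mass at the ridge: every facet over it
  lacks the same level t, so all of them carry the same sign.\<close>

lemma ridge_class_coboundary:
  assumes ms: "ms \<in> M" and t: "t \<in> {1..<n - 1}"
  shows "(\<lambda>F. \<Sum>ms' | ms' \<in> M \<and> ridge_of n t ms' = ridge_of n t ms. point_mass (chain_of n ms') F) \<in> W"
proof -
  let ?\<rho> = "ridge_of n t ms"
  let ?d = "coboundary (wle n k) \<Delta> (point_mass ?\<rho> :: wpartition set \<Rightarrow> 'k)"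
  let ?C = "{ms' \<in> M. ridge_of n t ms' = ?\<rho>}"
  have "?\<rho> \<subseteq> chain_of n ms" by (auto simp: ridge_of_def chain_of_def)
  then have "?\<rho> \<in> \<Delta>"
    using chain_of_weighted_complex(1)[OF n ms]
    by (auto simp: order_complex_def chain_def intro: finite_subset)
  moreover have "int (card ?\<rho>) = int (n - 2) - 1" using card_ridge_of[OF ms t] t by auto
  ultimately have \<rho>: "point_mass ?\<rho> \<in> (cochains \<Delta> (int (n - 2) - 1 - 1) :: (wpartition set \<Rightarrow> 'k) set)"
    by (simp add: cochains_def point_mass_def)
  have fin: "finite ?C" using finite_full_seqs[of n k \<mu>] by simp
  have eq: "(\<Sum>ms'\<in>?C. point_mass (chain_of n ms') F) = (- 1) ^ (t - 1) * ?d F" for F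
  proof (cases "F \<in> \<Delta> \<and> card F = n - 2")
    case True
    then obtain m where m: "m \<in> full_seqs n k \<mu>" "F = chain_of n m"
      using facet_is_chain_of[OF n \<mu>] by blast
    have "?d F = (\<Sum>s\<in>{1..<n - 1}. (- 1) ^ (s - 1) * point_mass ?\<rho> (ridge_of n s m))"
      unfolding m(2) by (rule coboundary_chain_of[OF n m(1)])
    also have "\<dots> = (\<Sum>s\<in>{t}. (- 1) ^ (s - 1) * point_mass ?\<rho> (ridge_of n s m))"
      using t ridge_of_neq[OF m(1) ms _ t]
      by (intro sum.mono_neutral_right) (auto simp: point_mass_def)
    finally have d: "?d F = (- 1) ^ (t - 1) * point_mass ?\<rho> (ridge_of n t m)" by simp
    have "(\<Sum>ms'\<in>?C. point_mass (chain_of n ms') F) = (\<Sum>ms'\<in>?C. if ms' = m then 1 else (0::'k))"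
      using chain_of_inj[OF _ m(1)] by (intro sum.cong refl) (auto simp: point_mass_def m(2))
    also have "\<dots> = point_mass ?\<rho> (ridge_of n t m)"
      using fin m(1) by (simp add: point_mass_def)
    finally show ?thesis unfolding d by (simp flip: mult.assoc power_add)
  next
    case False
    have "?d \<in> cochains \<Delta> (int (n - 2) - 1)"
      using weighted_complexD(1)[OF n] \<rho> by (intro coboundary_cochains) auto
    then have "?d F = 0" using False by (auto simp: cochains_def)
    moreover have "point_mass (chain_of n ms') F = (0::'k)" if "ms' \<in> ?C" for ms'
      using False chain_of_weighted_complex[OF n, of ms' k \<mu>] that by (auto simp: point_mass_def)
    ultimately show ?thesis by simp
  qed
  have "?d \<in> W" using \<rho> by (auto simp: W_def coboundaries_def)
  then have "(\<lambda>F. (- 1) ^ (t - 1) * ?d F) \<in> W" using W unfolding linear_subspace_def by blast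
  then show ?thesis by (simp only: eq)
qed

lemma alternatives_coboundary:
  assumes "u @ [m, m'] @ w \<in> M"
  shows "(\<lambda>F. c * (\<Sum>v\<in>alternatives m m'. point_mass (chain_of n (u @ v @ w)) F)) \<in> W"
proof -
  have t: "Suc (length u) \<in> {1..<n - 1}" using assms by (auto simp: full_seqs_def)
  have "(\<Sum>ms' | ms' \<in> M \<and> ridge_of n (Suc (length u)) ms' = ridge_of n (Suc (length u)) (u @ [m, m'] @ w).
      point_mass (chain_of n ms') F) =
    (\<Sum>v\<in>alternatives m m'. point_mass (chain_of n (u @ v @ w)) F :: 'k)" for F
    unfolding same_ridge_seqs[OF assms refl] by (simp add: sum.reindex inj_on_def)
  then show ?thesis using ridge_class_coboundary[OF assms t] W by (simp add: linear_subspace_def)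
qed

text \<open>The interval contains two chains, whose classes add up to zero. The exchange also
  changes \<open>inv_sign\<close>, so the signed classes agree.\<close>

lemma signed_chain_swap:
  assumes "u @ (a, b, r) # (a', b', r') # w \<in> M" and ab: "a' \<notin> {a, b}" "b' \<notin> {a, b}"
  shows "u @ (a', b', r') # (a, b, r) # w \<in> M \<and>
    signed_chain n (u @ (a', b', r') # (a, b, r) # w) - signed_chain n (u @ (a, b, r) # (a', b', r') # w) \<in> W"
proof -
  let ?v = "[(a, b, r), (a', b', r')]" and ?v' = "[(a', b', r'), (a, b, r)]"
  have ms: "u @ ?v @ w \<in> M" using assms(1) by simp
  have alt: "alternatives (a, b, r) (a', b', r') = {?v, ?v'}" using ab by simp
  let ?s = "of_int (inv_sign (map absorbed (u @ ?v' @ w))) :: 'k"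
  have "inv_sign (map absorbed (u @ ?v @ w)) = - inv_sign (map absorbed (u @ ?v' @ w))"
    using inv_sign_swap[of b b'] ab by simp
  then have "signed_chain n (u @ ?v' @ w) - signed_chain n (u @ ?v @ w) =
      (\<lambda>F. ?s * (\<Sum>v\<in>alternatives (a, b, r) (a', b', r'). point_mass (chain_of n (u @ v @ w)) F))"
    using ab unfolding alt signed_chain_def by (simp add: fun_eq_iff algebra_simps)
  then have "signed_chain n (u @ ?v' @ w) - signed_chain n (u @ ?v @ w) \<in> W"
    using alternatives_coboundary[OF ms] by simp
  moreover have "u @ ?v' @ w \<in> M" using same_ridge_seqs[OF ms refl] unfolding alt by blast
  ultimately show ?thesis by simp
qed

lemma signed_chain_same_tree:
  assumes "ms \<in> M" "ms' \<in> M" "tree_of ms = tree_of ms'"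
  shows "signed_chain n ms' - signed_chain n ms \<in> W"
  using W linear_subspace_neg[OF W] signed_chain_swap
  by (intro same_tree_seqs[OF _ _ _ _ n assms]) (auto simp: linear_subspace_def)

text \<open>The relation \<open>g\<close> holds for sequences that differ in two consecutive steps.
  The postorder sequences in \<open>h\<close> are different ones, but they build the same trees and
  so agree with those modulo \<open>W\<close>.\<close>

lemma signed_chain_straighten:
  assumes T: "T \<in> normal_trees n \<mu>" and str: "straighten T ps ns"
  shows "signed_chain n (tree_seq T) - signed_sum (\<lambda>t. signed_chain n (tree_seq t)) ps ns \<in> W"
proof -
  have T': "normalized T" "distinct (labels T)" "supp (color_count T) \<subseteq> {1..k}"
    using T \<mu>(2) by (simp_all add: normal_trees_def labeled_trees_iff)
  obtain u w p q s b c A B C where R: "realizes_triples k u w p q s (set (labels T)) A B C"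
    and bc: "b \<in> {1..k}" "c \<in> {1..k}" and ABC: "T = A b c"
    "ps = (if b = c then [B b b, C b b] else [B b c, B c b, C b c, C c b])"
    "ns = (if b = c then [] else [A c b])"
    by (rule straighten_realizes[OF str T'])
  have pqs: "p < q" "q < s" using R by (simp_all add: realizes_triples_def)
  define G where "G v = (signed_chain n (u @ v @ w) :: wpartition set \<Rightarrow> 'k)" for v
  define \<Psi> where "\<Psi> = (\<lambda>X. signed_chain n (tree_seq X) :: wpartition set \<Rightarrow> 'k)"
  let ?a = "\<lambda>x y. [(p, q, x), (p, s, y)]" and ?b = "\<lambda>x y. [(p, s, x), (p, q, y)]"
    and ?c = "\<lambda>x y. [(q, s, x), (p, q, y)]"
  define g where "g x y = G (?a x y) - G (?b x y) - G (?c x y)" for x y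
  define h where "h x y = \<Psi> (A x y) - \<Psi> (B x y) - \<Psi> (C x y)" for x y
  have cmp: "\<Psi> X - G v \<in> W" if "X \<in> normal_trees n \<mu>" "realizes k (u @ v @ w) X" for X v
    unfolding G_def \<Psi>_def using realizes_full_seqs[OF that(2,1)] tree_seq_full_seqs[OF that(1) \<mu>(2)]
    by (intro signed_chain_same_tree) simp_all
  have members: "X \<in> normal_trees n \<mu>" if "X \<in> set (T # ps @ ns)" for X
    using straighten_normal_trees[OF str _ T] T that by auto
  have hg: "h x y - g x y \<in> W" if "x = b \<and> y = c \<or> x = c \<and> y = b" for x y
  proof -
    have "A x y \<in> normal_trees n \<mu>" "B x y \<in> normal_trees n \<mu>" "C x y \<in> normal_trees n \<mu>"
      using that members ABC by (auto split: if_splits)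
    moreover have "realizes k (u @ ?a x y @ w) (A x y)" "realizes k (u @ ?b x y @ w) (B x y)"
      "realizes k (u @ ?c x y @ w) (C x y)" using R that bc unfolding realizes_triples_def by blast+
    ultimately have "(\<Psi> (A x y) - G (?a x y)) - (\<Psi> (B x y) - G (?b x y)) - (\<Psi> (C x y) - G (?c x y)) \<in> W"
      by (blast intro: linear_subspace_diff[OF W] cmp)
    then show ?thesis by (simp add: h_def g_def algebra_simps)
  qed
  have "(if b = c then g b b else g b c + g c b) \<in> W"
  proof -
    have "realizes k (u @ ?a b c @ w) T" using R bc ABC(1) by (simp add: realizes_triples_def)
    then have full: "u @ [(p, q, b), (p, s, c)] @ w \<in> M" by (rule realizes_full_seqs[OF _ T])
    have alt: "alternatives (p, q, b) (p, s, c) = triple_merges p q s b c" using pqs by simp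
    let ?\<sigma> = "of_int (inv_sign (map absorbed u @ q # s # map absorbed w)) :: 'k"
    have sg: "inv_sign (map absorbed u @ s # q # map absorbed w) =
        - inv_sign (map absorbed u @ q # s # map absorbed w)"
      using pqs by (intro inv_sign_swap) simp
    have "(if b = c then g b b else g b c + g c b) =
        (\<lambda>F. ?\<sigma> * (\<Sum>v\<in>triple_merges p q s b c. point_mass (chain_of n (u @ v @ w)) F))"
      unfolding sum_triple_merges[OF pqs] g_def G_def signed_chain_def
      by (simp add: fun_eq_iff sg algebra_simps)
    then show ?thesis using alternatives_coboundary[OF full, unfolded alt] by simp
  qed
  moreover have "(if b = c then h b b else h b c + h c b) - (if b = c then g b b else g b c + g c b) \<in> W"
  proof -
    have add: "f \<in> W \<Longrightarrow> f' \<in> W \<Longrightarrow> f + f' \<in> W" for f f' using W by (simp add: linear_subspace_def)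
    show ?thesis using hg[of b c] add[OF hg[of b c] hg[of c b]] by (auto simp: algebra_simps)
  qed
  moreover have "\<Psi> T - signed_sum \<Psi> ps ns = (if b = c then h b b else h b c + h c b)"
    by (simp add: ABC signed_sum_def h_def algebra_simps)
  ultimately have "(\<Psi> T - signed_sum \<Psi> ps ns) - (if b = c then g b b else g b c + g c b) +
      (if b = c then g b b else g b c + g c b) \<in> W"
    using W unfolding linear_subspace_def by (simp only:)
  then have "\<Psi> T - signed_sum \<Psi> ps ns \<in> W" by (simp only: diff_add_cancel)
  then show ?thesis unfolding \<Psi>_def .
qed

lemma chain_of_expansion:
  fixes f :: "wpartition set \<Rightarrow> 'k"
  assumes f: "f \<in> cochains \<Delta> (int (n - 2) - 1)"
  shows "f = (\<lambda>F. \<Sum>ms\<in>M. f (chain_of n ms) * point_mass (chain_of n ms) F)"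
proof
  fix F
  show "f F = (\<Sum>ms\<in>M. f (chain_of n ms) * point_mass (chain_of n ms) F)"
  proof (cases "F \<in> chain_of n ` M")
    case True
    then obtain m where m: "m \<in> M" "F = chain_of n m" by blast
    have "(\<Sum>ms\<in>M. f (chain_of n ms) * point_mass (chain_of n ms) F) = (\<Sum>ms\<in>M. if ms = m then f F else 0)"
      using chain_of_inj[OF _ m(1)] m(2) by (intro sum.cong refl) (auto simp: point_mass_def)
    then show ?thesis using m(1) by (simp add: finite_full_seqs)
  next
    case False
    have "f F = 0"
      using f False facet_is_chain_of[OF n \<mu>, of F] by (auto simp: cochains_def)
    moreover have "point_mass (chain_of n ms) F = (0 :: 'k)" if "ms \<in> M" for ms
      using False that by (auto simp: point_mass_def)
    ultimately show ?thesis by simp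
  qed
qed

lemma Lyn_chains_span:
  assumes V: "linear_subspace V" and WV: "W \<subseteq> V"
    and Lyn: "\<And>T. T \<in> Lyn n \<mu> \<Longrightarrow> point_mass (tree_chain_bar n \<mu> T) \<in> V"
  shows "cochains \<Delta> (int (n - 2) - 1) \<subseteq> V"
proof -
  let ?p = "\<lambda>ms. point_mass (chain_of n ms) :: wpartition set \<Rightarrow> 'k"
  have Vops: "0 \<in> V" "\<And>f g. f \<in> V \<Longrightarrow> g \<in> V \<Longrightarrow> f + g \<in> V" "\<And>f. f \<in> V \<Longrightarrow> - f \<in> V"
    "\<And>c f. f \<in> V \<Longrightarrow> (\<lambda>F. c * f F) \<in> V"
    using V linear_subspace_neg[OF V] by (auto simp: linear_subspace_def)
  have normal: "signed_chain n (tree_seq T) \<in> V" if "T \<in> normal_trees n \<mu>" for T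
  proof (rule normal_trees_span[OF Vops(1-3) _ _ that])
    show "signed_chain n (tree_seq T) - signed_sum (\<lambda>t. signed_chain n (tree_seq t)) ps ns \<in> V"
      if "T \<in> normal_trees n \<mu>" "straighten T ps ns" for T ps ns
      using signed_chain_straighten[OF that] WV by blast
    fix T assume T: "T \<in> Lyn n \<mu>"
    then have "?p (tree_seq T) \<in> V" using Lyn[OF T] tree_chain_bar_eq[OF n _ \<mu>(2)] by (simp add: Lyn_iff)
    then show "signed_chain n (tree_seq T) \<in> V" unfolding signed_chain_def by (rule Vops(4))
  qed
  have pV: "?p ms \<in> V" if ms: "ms \<in> M" for ms
  proof -
    have T: "tree_of ms \<in> normal_trees n \<mu>" by (rule tree_of_normal_trees[OF ms n])
    have "signed_chain n ms - signed_chain n (tree_seq (tree_of ms)) \<in> V"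
      using tree_seq_full_seqs[OF T \<mu>(2)] ms WV signed_chain_same_tree by auto
    from Vops(2)[OF this normal[OF T]] have "signed_chain n ms \<in> V" by simp
    \<comment> \<open>A sign is its own inverse, so multiplying by it once more removes it.\<close>
    then have "(\<lambda>F. of_int (inv_sign (map absorbed ms)) * signed_chain n ms F) \<in> V" by (rule Vops(4))
    moreover have "(\<lambda>F. of_int (inv_sign (map absorbed ms)) * signed_chain n ms F) = ?p ms"
      by (simp add: signed_chain_def fun_eq_iff flip: mult.assoc of_int_mult)
    ultimately show ?thesis by simp
  qed
  show ?thesis
  proof
    fix f :: "wpartition set \<Rightarrow> 'k" assume f: "f \<in> cochains \<Delta> (int (n - 2) - 1)"
    have "(\<lambda>F. \<Sum>ms\<in>M'. f (chain_of n ms) * ?p ms F) \<in> V" if "finite M'" "M' \<subseteq> M" for M'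
      using that
    proof (induction M' rule: finite_induct)
      case empty
      then show ?case using Vops(1) by (simp add: zero_fun_def)
    next
      case (insert m M')
      then have "(\<lambda>F. f (chain_of n m) * ?p m F) + (\<lambda>F. \<Sum>ms\<in>M'. f (chain_of n ms) * ?p ms F) \<in> V"
        using Vops(2)[OF Vops(4)[OF pV]] by simp
      then show ?case using insert by (simp add: plus_fun_def)
    qed
    from this[OF finite_full_seqs order_refl] show "f \<in> V" using chain_of_expansion[OF f] by simp
  qed
qed

text \<open>
  Evaluation on the top-dimensional chain with coefficients \<open>N\<close>; it is a cycle if \<open>N\<close> respects all
  straightening relations.
\<close>

definition cycle_functional :: "(lctree \<Rightarrow> int) \<Rightarrow> (wpartition set \<Rightarrow> 'k) \<Rightarrow> 'k" where
  "cycle_functional N f =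
    (\<Sum>ms\<in>M. of_int (inv_sign (map absorbed ms) * N (tree_of ms)) * f (chain_of n ms))"

text \<open>After exchanging the sums and collecting the facets by the ridge left when level t is
  omitted, each ridge contributes zero.\<close>

lemma cycle_functional_coboundary:
  assumes N: "\<And>T. invariant_at N T" and f: "f \<in> W"
  shows "cycle_functional N f = 0"
proof -
  define h where "h ms = (of_int (inv_sign (map absorbed ms) * N (tree_of ms)) :: 'k)" for ms
  obtain g where g: "f = coboundary (wle n k) \<Delta> g" using f unfolding W_def coboundaries_def by blast
  have ridge: "(\<Sum>ms\<in>M. h ms * g (ridge_of n t ms)) = 0" if t: "t \<in> {1..<n - 1}" for t
  proof -
    have "(\<Sum>ms\<in>M. h ms * g (ridge_of n t ms)) =
      (\<Sum>\<rho>\<in>ridge_of n t ` M. \<Sum>ms | ms \<in> M \<and> ridge_of n t ms = \<rho>. h ms * g (ridge_of n t ms))"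
      by (rule sum.image_gen[OF finite_full_seqs])
    also have "\<dots> = 0"
    proof (rule sum.neutral, rule ballI)
      fix \<rho> assume "\<rho> \<in> ridge_of n t ` M"
      then obtain m where m: "m \<in> M" "\<rho> = ridge_of n t m" by blast
      have "(\<Sum>ms | ms \<in> M \<and> ridge_of n t ms = \<rho>. h ms * g (ridge_of n t ms)) =
        (\<Sum>ms | ms \<in> M \<and> ridge_of n t ms = \<rho>. h ms) * g \<rho>"
        unfolding sum_distrib_right by (rule sum.cong) auto
      also have "(\<Sum>ms | ms \<in> M \<and> ridge_of n t ms = \<rho>. h ms) = 0"
        unfolding h_def of_int_sum[symmetric] m(2) ridge_sum_zero[OF N m(1) t] by simp
      finally show "(\<Sum>ms | ms \<in> M \<and> ridge_of n t ms = \<rho>. h ms * g (ridge_of n t ms)) = 0" by simp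
    qed
    finally show ?thesis .
  qed
  have "cycle_functional N f =
      (\<Sum>ms\<in>M. \<Sum>t\<in>{1..<n - 1}. (- 1) ^ (t - 1) * (h ms * g (ridge_of n t ms)))"
    unfolding cycle_functional_def g h_def
    by (intro sum.cong refl) (simp add: coboundary_chain_of[OF n] sum_distrib_left mult.left_commute)
  also have "\<dots> = (\<Sum>t\<in>{1..<n - 1}. (- 1) ^ (t - 1) * (\<Sum>ms\<in>M. h ms * g (ridge_of n t ms)))"
    by (subst sum.swap) (simp add: sum_distrib_left)
  also have "\<dots> = 0" using ridge by (intro sum.neutral ballI) simp
  finally show ?thesis .
qed

lemma cycle_functional_chain:
  assumes "ms \<in> M"
  shows "cycle_functional N (point_mass (chain_of n ms)) = of_int (inv_sign (map absorbed ms) * N (tree_of ms))"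
proof -
  have "cycle_functional N (point_mass (chain_of n ms)) =
      (\<Sum>m\<in>M. if m = ms then of_int (inv_sign (map absorbed m) * N (tree_of m)) else 0)"
    unfolding cycle_functional_def using chain_of_inj[OF _ assms]
    by (intro sum.cong refl) (auto simp: point_mass_def)
  then show ?thesis using assms by (simp add: finite_full_seqs)
qed

lemma weighted_cohomology_basis:
  "vectorspace.basis (class_ring :: 'k ring)
    (reduced_cohomology (wle n k) \<Delta> (int (n - 2) - 1)) {tree_chain_class n k \<mu> T | T. T \<in> Lyn n \<mu>}"
proof -
  let ?U = "cochains \<Delta> (int (n - 2) - 1) :: (wpartition set \<Rightarrow> 'k) set"
  let ?\<Phi> = "\<lambda>T. point_mass (tree_chain_bar n \<mu> T) :: wpartition set \<Rightarrow> 'k"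
  have full: "tree_seq T \<in> M" "tree_of (tree_seq T) = T" and bar: "tree_chain_bar n \<mu> T = chain_of n (tree_seq T)"
    if "T \<in> Lyn n \<mu>" for T
    using that tree_seq_full_seqs[of T, OF _ \<mu>(2)] tree_chain_bar_eq[OF n _ \<mu>(2)] by (auto simp: Lyn_iff)
  have WU: "W \<subseteq> ?U"
    using weighted_complexD(1)[OF n] unfolding W_def coboundaries_def by (auto intro!: coboundary_cochains)
  have "vectorspace.basis class_ring (quotient_space ?U W) {?\<Phi> T +o W | T. T \<in> Lyn n \<mu>}"
  proof (rule quotient_space_basis[OF linear_subspace_cochains W WU])
    show "?\<Phi> T \<in> ?U" if "T \<in> Lyn n \<mu>" for T
      using chain_of_weighted_complex[OF n full(1)[OF that]] bar[OF that]
      by (simp add: cochains_def point_mass_def)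
    show "?U \<subseteq> V" if "linear_subspace V" "W \<subseteq> V" "?\<Phi> ` Lyn n \<mu> \<subseteq> V" for V
      using that by (intro Lyn_chains_span) auto
  next
    fix T0 assume T0: "T0 \<in> Lyn n \<mu>"
    obtain N :: "lctree \<Rightarrow> int" where N: "\<And>T. invariant_at N T"
      "\<And>T. (\<nexists>ps ns. straighten T ps ns) \<Longrightarrow> N T = (if T = T0 then 1 else 0)"
      using invariant_functional[of "\<lambda>T. if T = T0 then 1 else 0"] by blast
    have dual: "cycle_functional N (?\<Phi> T) =
        (if T = T0 then of_int (inv_sign (map absorbed (tree_seq T))) else 0)" if T: "T \<in> Lyn n \<mu>" for T
      using N(2)[of T] T unfolding bar[OF T] cycle_functional_chain[OF full(1)[OF T]] full(2)[OF T]
      by (simp add: Lyn_iff)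
    \<comment> \<open>The square of the sign is 1, so the sign is nonzero in every
      characteristic.\<close>
    have nz: "(of_int (inv_sign xs) :: 'k) \<noteq> 0" for xs
    proof
      assume "(of_int (inv_sign xs) :: 'k) = 0"
      then have "(of_int (inv_sign xs * inv_sign xs) :: 'k) = 0" unfolding of_int_mult by simp
      then show False unfolding inv_sign_square by simp
    qed
    show "\<exists>\<Lambda>. (\<forall>f\<in>?U. \<forall>g\<in>?U. \<Lambda> (f + g) = \<Lambda> f + \<Lambda> g) \<and> (\<forall>c. \<forall>f\<in>?U. \<Lambda> (\<lambda>x. c * f x) = c * \<Lambda> f) \<and>
      (\<forall>f\<in>W. \<Lambda> f = (0::'k)) \<and> \<Lambda> (?\<Phi> T0) \<noteq> 0 \<and> (\<forall>T\<in>Lyn n \<mu>. T \<noteq> T0 \<longrightarrow> \<Lambda> (?\<Phi> T) = 0)"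
    proof (intro exI[of _ "cycle_functional N"] conjI ballI allI impI)
      show "cycle_functional N (f + g) = cycle_functional N f + cycle_functional N g" for f g
        by (simp add: cycle_functional_def distrib_left sum.distrib)
      show "cycle_functional N (\<lambda>x. c * f x) = c * cycle_functional N f" for c f
        by (simp add: cycle_functional_def sum_distrib_left mult.left_commute)
    qed (use cycle_functional_coboundary[OF N(1)] dual T0 nz in auto)
  qed
  moreover have "tree_chain_class n k \<mu> T = ?\<Phi> T +o W" if "T \<in> Lyn n \<mu>" for T
    using chain_of_weighted_complex(2)[OF n full(1)[OF that]] bar[OF that]
    by (simp add: tree_chain_class_def face_class_def W_def)
  then have "{tree_chain_class n k \<mu> T | T. T \<in> Lyn n \<mu>} = {?\<Phi> T +o W | T. T \<in> Lyn n \<mu>}"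
    by auto
  ultimately show ?thesis
    unfolding reduced_cohomology_def cocycles_top[OF n] W_def by simp
qed

end

text \<open>For n = 1 bottom and top coincide, and the degree shift in
  \<open>interval_cohomology\<close> matches the truncation of n - 2 to 0.\<close>

lemma interval_cohomology_degree:
  assumes n: "n \<ge> 1" and \<mu>: "\<mu> \<in> WComp (n - 1)"
  shows "interval_cohomology (wle n k) (wbot n) (wtop n \<mu>) (int n - 3) =
    reduced_cohomology (wle n k) (weighted_complex n k \<mu>) (int (n - 2) - 1)"
proof (cases "n = 1")
  case True
  then have "\<mu> \<in> WComp 0" using \<mu> by simp
  then have "\<mu> = (\<lambda>_. 0)" by (auto simp: WComp_def supp_def fun_eq_iff)
  then have "wbot n = wtop n \<mu>" using True by (simp add: wbot_def wtop_def)
  then show ?thesis using True by (simp add: interval_cohomology_def)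
next
  case False
  then have "wbot n \<noteq> wtop n \<mu>" using card_wbot[of n] card_wtop[of n \<mu>] by metis
  moreover have "int n - 3 = int (n - 2) - 1" using False n by linarith
  ultimately show ?thesis unfolding interval_cohomology_def by (simp only: if_False)
qed

theorem theorem5p1:
  fixes n k :: nat and \<mu> :: "nat \<Rightarrow> nat"
  assumes "n \<ge> 1" and "k \<ge> 1" and "\<mu> \<in> WComp (n - 1)" and "supp \<mu> \<subseteq> {1..k}"
  shows "vectorspace.basis (class_ring :: 'k::field ring)
           (interval_cohomology (wle n k) (wbot n) (wtop n \<mu>) (int n - 3))
           {tree_chain_class n k \<mu> T | T. T \<in> Lyn n \<mu>}
       \<and> vectorspace.basis (class_ring :: 'k ring)
           (Lie n \<mu>)
           {bracketing_class n T | T. T \<in> Lyn n \<mu>}"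
proof
  show "vectorspace.basis (class_ring :: 'k ring)
      (interval_cohomology (wle n k) (wbot n) (wtop n \<mu>) (int n - 3))
      {tree_chain_class n k \<mu> T | T. T \<in> Lyn n \<mu>}"
    unfolding interval_cohomology_degree[OF assms(1,3)]
    by (rule weighted_cohomology_basis[OF assms(1,3,4) refl])
  show "vectorspace.basis (class_ring :: 'k ring) (Lie n \<mu>) {bracketing_class n T | T. T \<in> Lyn n \<mu>}"
    by (rule Lie_basis)
qed

end
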